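(* Let $\mathcal{F}$ be a square polynomial system of $n$ polynomials in $\mathbb{C}[x_1,\dots,x_n]$, let $z^\ast\in\mathbb{C}^n$ be a point approximating a cluster of zeros of $\mathcal{F}$, and let $d$ be a positive integer. If the cluster inflation algorithm (defined in the context) succeeds on $(\mathcal{F},z^\ast,d)$, then it produces a pair of regions $R_-$ and $R_+$, both containing $z^\ast$ and the cluster of zeros (and no other zeros of $\mathcal{F}$), such that $R_-\subseteq R_+^\circ$ (the interior of $R_+$). Moreover, the number of zeros in the cluster, counted with multiplicity, is $d^\kappa$.
   Context: A square system is a system of $n$ polynomials in $n$ variables over $\mathbb{C}$, regarded as a column vector of polynomials. The breadth of a system at a zero is the nullity of its Jacobian there. $\|\cdot\|$ is the Hermitian norm on $\mathbb{C}^n$. "The cluster" means the set of zeros of $\mathcal{F}$ isolated by the output regions. For a polynomial system $\mathcal{H}$, $(\mathcal{H})_d$, $(\mathcal{H})_{>d}$, $(\mathcal{H})_{<d}$ denote the parts consisting of the terms of total degree equal to, greater than, and less than $d$, respectively. Pre-inflation procedure with parameters $k,\ell$, applied to a square system $\mathcal{G}$ with a zero $z^\ast$ of breadth $\kappa$: Step 1. Choose an invertible affine map $A:\mathbb{C}^n\to\mathbb{C}^n$ with $A(0)=z^\ast$ such that the kernel of the Jacobian at $0$ of $\mathcal{A}=\mathcal{G}\circ A$ is spanned by the standard basis vectors $e_1,\dots,e_\kappa$. Step 2. Choose $B\in GL_n(\mathbb{C})$ such that $\mathcal{B}=B\mathcal{A}=\{b_1,\dots,b_n\}$ satisfies: $b_1,\dots,b_\kappa$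 have no linear terms and the linear part of $b_i$ is $x_i$ for $i>\kappa$. Step 3. Choose an invertible $\mathbb{C}[x]$-linear map $C_k\in GL_n(\mathbb{C}[x_1,\dots,x_n])$ such that $\mathcal{C}_k=C_k\mathcal{B}=\{c_1,\dots,c_n\}$ still has the properties of Step 2 and, in addition, every term of $c_1,\dots,c_\kappa$ involving one of $x_{\kappa+1},\dots,x_n$ has degree greater than $k$. Step 4. Choose a change of variables $D_\ell$ of the form $x_i\mapsto x_i$ for $i\le\kappa$ and $x_i\mapsto x_i+q_i(x_1,\dots,x_\kappa)$ for $i>\kappa$, with polynomials $q_i$ having no constant or linear terms, such that in $\mathcal{P}_{k,\ell}=\mathcal{C}_k\circ D_\ell=\{p_1,\dots,p_n\}$ every term of $p_{\kappa+1},\dots,p_n$ involving only $x_1,\dots,x_\kappa$ has degree greater than $\ell$. Set $T=A\circ D_\ell$ and $U=(C_k\circ D_\ell)B\in GL_n(\mathbb{C}[x_1,\dots,x_n])$, so that $\mathcal{P}_{k,\ell}=U\cdot(\mathcal{G}\circ T)$, written $U\circ\mathcal{G}\circ T$. For any other square system $\mathcal{F}$, $U\circ\mathcal{F}\circ T$ denotes $U\cdot(\mathcal{F}\circ T)$. Inflation operator of order $d$ and breadth $\kappa$: $S_\kappa^d:\mathbb{C}^n\to\mathbb{C}^n$, $S_\kappa^d(x_1,\dots,x_n)=(x_1,\dots,x_\kappa,x_{\kappa+1}^d,\dots,x_n^d)$. Cluster inflation algorithm, applied to $\mathcal{F}$, $z^\ast$ and $d$: 1. Choose a square polynomial system $\mathcal{G}$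 (intended to be close to $\mathcal{F}$) with a singular zero at $z^\ast$; let $\kappa$ be its breadth at $z^\ast$. 2. Apply the pre-inflation procedure with $k=\ell=d$ to $\mathcal{G}$ and collect $U$ and $T$. 3. Compute $\mathcal{H}=U\circ\mathcal{F}\circ T\circ S_\kappa^d$. 4. Compute a positive lower bound $M$ for $\|(\mathcal{H})_d(x)\|$ on the unit sphere $\|x\|=1$. 5. Compute $M_1>0$ with $\|(\mathcal{H})_{>d}(x)\|\le M_1\|x\|^{d+1}$ for all $\|x\|\le1$. 6. Compute $M_2>0$ with $\|(\mathcal{H})_{<d}(x)\|\le M_2$ for all $\|x\|\le1$. 7. Set $\varepsilon_-=\left(\frac{2M_2}{M}\right)^{1/d}$ and $\varepsilon_+=\frac{M}{2M_1}$. 8. The algorithm succeeds if $\varepsilon_-<\varepsilon_+$; then it outputs $R_-$ and $R_+$, the regions in the original coordinates corresponding to the balls of radii $\varepsilon_-$ and $\varepsilon_+$ centered at the origin, i.e. the images of these balls under $T\circ S_\kappa^d$.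
   Formalization: The bounds of steps 5 and 6 are also assumed for all ‖x‖≤ε₊, not only for ‖x‖≤1 (automatic if ε₊≤1). Without this the claim fails: for F=G=x²−x⁴/8, z*=0, d=2, M=1, M₁=1/8 and tiny M₂, R₊ contains the extra zeros ±√8. *)

theory Defs
  imports
    "HOL-Analysis.Analysis"
    "HOL-Library.Poly_Mapping"
    "HOL-Computational_Algebra.Fraction_Field"
begin

section \<open>Polynomials and polynomial systems\<close>

text \<open>
  The index type of the variables is a finite linearly ordered type, so that
  ``the first \<open>\<kappa>\<close> variables'' makes sense; the number of variables is its cardinality.
\<close>

abbreviation lookup :: "('a \<Rightarrow>\<^sub>0 'b::zero) \<Rightarrow> 'a \<Rightarrow> 'b" where
  "lookup \<equiv> Poly_Mapping.lookup"

abbreviation keys :: "('a \<Rightarrow>\<^sub>0 'b::zero) \<Rightarrow> 'a set" where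
  "keys \<equiv> Poly_Mapping.keys"

type_synonym 'n mpoly = "('n \<Rightarrow>\<^sub>0 nat) \<Rightarrow>\<^sub>0 complex"

type_synonym 'n system = "('n mpoly)^'n"

type_synonym 'n point = "complex^'n"

type_synonym 'n poly_matrix = "('n mpoly)^'n^'n"

definition mconst :: "complex \<Rightarrow> 'n mpoly" where
  "mconst c = Poly_Mapping.single 0 c"

definition mvar :: "'n \<Rightarrow> 'n mpoly" where
  "mvar i = Poly_Mapping.single (Poly_Mapping.single i 1) 1"

definition mdeg :: "('n::finite \<Rightarrow>\<^sub>0 nat) \<Rightarrow> nat" where
  "mdeg m = (\<Sum>i\<in>UNIV. lookup m i)"

definition meval :: "('n::finite) mpoly \<Rightarrow> 'n point \<Rightarrow> complex" where
  "meval p x = (\<Sum>m\<in>keys p. lookup p m * (\<Prod>i\<in>UNIV. (x $ i) ^ lookup m i))"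

definition msubst :: "('n::finite) mpoly \<Rightarrow> 'n system \<Rightarrow> 'n mpoly" where
  "msubst p \<sigma> =
     (\<Sum>m\<in>keys p. mconst (lookup p m) * (\<Prod>i\<in>UNIV. (\<sigma> $ i) ^ lookup m i))"

definition mderiv :: "'n \<Rightarrow> 'n mpoly \<Rightarrow> 'n mpoly" where
  "mderiv j p = (\<Sum>m\<in>keys p.
     Poly_Mapping.single (m - Poly_Mapping.single j 1) (of_nat (lookup m j) * lookup p m))"

definition deg_part :: "(nat \<Rightarrow> bool) \<Rightarrow> ('n::finite) mpoly \<Rightarrow> 'n mpoly" where
  "deg_part Q p = (\<Sum>m\<in>{m \<in> keys p. Q (mdeg m)}. Poly_Mapping.single m (lookup p m))"

definition sys_eval :: "('n::finite) system \<Rightarrow> 'n point \<Rightarrow> 'n point" where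
  "sys_eval F x = (\<chi> i. meval (F $ i) x)"

definition sys_comp :: "('n::finite) system \<Rightarrow> 'n system \<Rightarrow> 'n system" where
  "sys_comp F G = (\<chi> i. msubst (F $ i) G)"

definition sys_part :: "(nat \<Rightarrow> bool) \<Rightarrow> ('n::finite) system \<Rightarrow> 'n system" where
  "sys_part Q F = (\<chi> i. deg_part Q (F $ i))"

definition const_matrix :: "complex^'n^'n \<Rightarrow> 'n poly_matrix" where
  "const_matrix B = (\<chi> i j. mconst (B $ i $ j))"

definition matrix_subst :: "('n::finite) poly_matrix \<Rightarrow> 'n system \<Rightarrow> 'n poly_matrix" where
  "matrix_subst C D = (\<chi> i j. msubst (C $ i $ j) D)"

definition first_vars :: "nat \<Rightarrow> ('n::{finite,linorder}) set" where
  "first_vars \<kappa> = {i. card {j. j < i} < \<kappa>}"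


section \<open>Jacobian, breadth and multiplicity\<close>

definition jacobian :: "('n::finite) system \<Rightarrow> 'n point \<Rightarrow> complex^'n^'n" where
  "jacobian F z = (\<chi> i j. meval (mderiv j (F $ i)) z)"

definition breadth :: "('n::finite) system \<Rightarrow> 'n point \<Rightarrow> nat" where
  "breadth F z = vec.dim {v. jacobian F z *v v = 0}"

definition singular_zero :: "('n::finite) system \<Rightarrow> 'n point \<Rightarrow> bool" where
  "singular_zero F z \<longleftrightarrow> sys_eval F z = 0 \<and> \<not> invertible (jacobian F z)"

text \<open>
  The local ring at \<open>z\<close> is the localization of the polynomial ring at the maximal
  ideal of \<open>z\<close>, as a subring of the field of rational functions.
\<close>

definition local_ring :: "('n::{finite,linorder}) point \<Rightarrow> 'n mpoly fract set" where
  "local_ring z = {Fract p q | p q. meval q z \<noteq> 0}"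

definition local_ideal ::
    "('n::{finite,linorder}) system \<Rightarrow> 'n point \<Rightarrow> 'n mpoly fract set" where
  "local_ideal F z =
     {\<Sum>i\<in>UNIV. a i * Fract (F $ i) 1 | a. \<forall>i. a i \<in> local_ring z}"

text \<open>
  The multiplicity of \<open>F\<close> at \<open>z\<close> is the complex dimension of the local ring modulo the
  ideal generated by \<open>F\<close>: \<open>F\<close> has multiplicity \<open>m\<close> at \<open>z\<close> iff
  some \<open>m\<close> elements of the local ring represent a basis of that quotient.  As a relation,
  it holds for no \<open>m\<close> if the quotient has infinite dimension.
\<close>

definition has_multiplicity ::
    "('n::{finite,linorder}) system \<Rightarrow> 'n point \<Rightarrow> nat \<Rightarrow> bool" where
  "has_multiplicity F z m \<longleftrightarrow>
     (\<exists>S. S \<subseteq> local_ring z \<and> finite S \<and> card S = m \<and>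
        (\<forall>f\<in>local_ring z. \<exists>c. f - (\<Sum>b\<in>S. Fract (mconst (c b)) 1 * b) \<in> local_ideal F z) \<and>
        (\<forall>c. (\<Sum>b\<in>S. Fract (mconst (c b)) 1 * b) \<in> local_ideal F z \<longrightarrow> (\<forall>b\<in>S. c b = 0)))"


section \<open>Pre-inflation\<close>

definition invertible_affine :: "('n::finite) system \<Rightarrow> bool" where
  "invertible_affine A \<longleftrightarrow>
     (\<exists>L b. invertible L \<and> A = (\<chi> i. mconst (b $ i) + (\<Sum>j\<in>UNIV. mconst (L $ i $ j) * mvar j)))"

definition normalized_linear_part :: "nat \<Rightarrow> ('n::{finite,linorder}) system \<Rightarrow> bool" where
  "normalized_linear_part \<kappa> F \<longleftrightarrow>
     (\<forall>i. deg_part (\<lambda>e. e = 1) (F $ i) = (if i \<in> first_vars \<kappa> then 0 else mvar i))"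

definition preinflation ::
    "nat \<Rightarrow> nat \<Rightarrow> ('n::{finite,linorder}) system \<Rightarrow> 'n point \<Rightarrow>
     'n poly_matrix \<Rightarrow> 'n system \<Rightarrow> bool" where
  "preinflation k l G z U T \<longleftrightarrow>
     (let \<kappa> = breadth G z in
      \<exists>A B C D q.
        invertible_affine A \<and> sys_eval A 0 = z \<and>
        {v. jacobian (sys_comp G A) 0 *v v = 0} = vec.span {axis i 1 | i. i \<in> first_vars \<kappa>} \<and>
        invertible B \<and>
        normalized_linear_part \<kappa> (const_matrix B *v sys_comp G A) \<and>
        invertible C \<and>
        normalized_linear_part \<kappa> (C *v (const_matrix B *v sys_comp G A)) \<and>
        (\<forall>i\<in>first_vars \<kappa>. \<forall>m\<in>keys ((C *v (const_matrix B *v sys_comp G A)) $ i).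
           (\<exists>j. j \<notin> first_vars \<kappa> \<and> lookup m j \<noteq> 0) \<longrightarrow> k < mdeg m) \<and>
        D = (\<chi> i. if i \<in> first_vars \<kappa> then mvar i else mvar i + q i) \<and>
        (\<forall>i. i \<notin> first_vars \<kappa> \<longrightarrow>
           (\<forall>m\<in>keys (q i). 2 \<le> mdeg m \<and> (\<forall>j. j \<notin> first_vars \<kappa> \<longrightarrow> lookup m j = 0))) \<and>
        (\<forall>i. i \<notin> first_vars \<kappa> \<longrightarrow>
           (\<forall>m\<in>keys (sys_comp (C *v (const_matrix B *v sys_comp G A)) D $ i).
              (\<forall>j. j \<notin> first_vars \<kappa> \<longrightarrow> lookup m j = 0) \<longrightarrow> l < mdeg m)) \<and>
        T = sys_comp A D \<and>
        U = matrix_subst C D ** const_matrix B)"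


section \<open>Cluster inflation\<close>

definition inflation :: "nat \<Rightarrow> nat \<Rightarrow> ('n::{finite,linorder}) system" where
  "inflation \<kappa> d = (\<chi> i. if i \<in> first_vars \<kappa> then mvar i else mvar i ^ d)"

text \<open>
  The algorithm leaves several choices open.  The predicate below says that the breadth \<open>\<kappa>\<close>,
  the change of variables \<open>T\<close>, the system \<open>H\<close> and the bounds \<open>M\<close>, \<open>M1\<close>, \<open>M2\<close>
  may arise from a run up to the computation of the bounds.
\<close>

definition cluster_inflation ::
    "('n::{finite,linorder}) system \<Rightarrow> 'n point \<Rightarrow> nat \<Rightarrow>
     nat \<Rightarrow> 'n system \<Rightarrow> 'n system \<Rightarrow> real \<Rightarrow> real \<Rightarrow> real \<Rightarrow> bool" where
  "cluster_inflation F z d \<kappa> T H M M1 M2 \<longleftrightarrow>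
     (\<exists>G U.
        singular_zero G z \<and> \<kappa> = breadth G z \<and>
        preinflation d d G z U T \<and>
        H = sys_comp (U *v sys_comp F T) (inflation \<kappa> d)) \<and>
     0 < M \<and> (\<forall>x. norm x = 1 \<longrightarrow> M \<le> norm (sys_eval (sys_part (\<lambda>e. e = d) H) x)) \<and>
     0 < M1 \<and> (\<forall>x. norm x \<le> 1 \<longrightarrow>
        norm (sys_eval (sys_part (\<lambda>e. d < e) H) x) \<le> M1 * norm x ^ (d + 1)) \<and>
     0 < M2 \<and> (\<forall>x. norm x \<le> 1 \<longrightarrow>
        norm (sys_eval (sys_part (\<lambda>e. e < d) H) x) \<le> M2)"

text \<open>
  The bounds \<open>M1\<close> and \<open>M2\<close> are only required on the unit ball.  If \<open>eps_plus M M1 > 1\<close>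
  they do not control the outer region: for one variable, \<open>d = 2\<close> and
  \<open>F = G = x^2 - x^4 / 8\<close> at \<open>z = 0\<close>, one may take \<open>M = 1\<close>, \<open>M1 = 1/8\<close>
  and \<open>M2\<close> arbitrarily small, and the outer ball of radius 4 contains the additional zeros
  of modulus \<open>sqrt 8\<close>.  A theorem about the output therefore has to assume both
  bounds on the ball of radius \<open>eps_plus M M1\<close> as well, which is automatic if this
  radius is at most 1.
\<close>

definition eps_minus :: "nat \<Rightarrow> real \<Rightarrow> real \<Rightarrow> real" where
  "eps_minus d M M2 = (2 * M2 / M) powr (1 / real d)"

definition eps_plus :: "real \<Rightarrow> real \<Rightarrow> real" where
  "eps_plus M M1 = M / (2 * M1)"

text \<open>The balls are taken closed.\<close>

definition region ::
    "('n::{finite,linorder}) system \<Rightarrow> nat \<Rightarrow> nat \<Rightarrow> real \<Rightarrow> 'n point set" where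
  "region T \<kappa> d r = sys_eval (sys_comp T (inflation \<kappa> d)) ` cball 0 r"

end

theory Submission
  imports Defs "HOL-Computational_Algebra.Fundamental_Theorem_Algebra"
begin

text \<open>
  In the coordinates of the pre-inflation, the system is \<open>F' = U (F \<circ> T)\<close> and \<open>H = F' \<circ> S\<close>, and the
  ball of radius \<open>r\<close> becomes the weighted ball \<open>W = S(ball)\<close>, so the ramification of \<open>S\<close> plays no
  role.  On its boundary the weighted homogeneous part of \<open>F'\<close> dominates, and along a straight
  line it can be deformed without zeros on the boundary into
  \<open>(c x\<^sub>1\<^sup>d, \<dots>, c x\<^sub>\<kappa>\<^sup>d, c x\<^sub>\<kappa>\<^sub>+\<^sub>1, \<dots>, c x\<^sub>n)\<close>, which has multiplicity \<open>d\<^sup>\<kappa>\<close> at 0.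

  Conservation of the number of zeros in \<open>W\<close> is proved algebraically.  A system
  \<open>x\<^sub>i\<^sup>N + (terms of degree < N)\<close> has a quotient ring with a basis of monomials that does not
  depend on the lower terms, and the trace of the multiplication by a polynomial \<open>p\<close> is the sum
  of \<open>p\<close> over the zeros with multiplicity.  These traces are continuous in the coefficients, and with a
  \<open>p\<close> that interpolates the indicator function of \<open>W\<close> on the zeros they count the zeros in \<open>W\<close>.

  A general system \<open>F\<close> is replaced by \<open>P + \<beta> F\<close> with \<open>P\<^sub>i\<close> a product of powers of \<open>x\<^sub>i - y\<^sub>i\<close> over the
  zeros \<open>y\<close> of \<open>F\<close> in \<open>W\<close>; for large \<open>\<beta>\<close> it has the same zeros in \<open>W\<close> and the same local ideals there.
\<close>

section \<open>Polynomials and their values\<close>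

text \<open>Multiplicities are defined through local rings, so the count follows traces rather than
  a topological degree. The obstacle is that the quotient ring of \<open>F\<close> may have infinite
  dimension because of zeros outside \<open>W\<close>. Leading powers \<open>x_i ^ N\<close> make it
  finite-dimensional at the price of extra zeros; a large factor \<open>\<beta>\<close> keeps these
  off the boundary of \<open>W\<close>, because \<open>\<beta> F\<close> dominates all other terms
  there. Only for \<open>F\<close> itself must the zeros inside \<open>W\<close> be identified
  exactly. The total count \<open>D\<close> bounds each multiplicity, so
  \<open>(x_i - y_i) ^ D\<close> lies in the local ideal at \<open>y\<close>. If the added term
  vanishes to higher order than \<open>D\<close>, it lies in the maximal ideal times the span of
  these powers, and Nakayama's lemma removes it. Finiteness of the zeros in \<open>W\<close> comes
  out of the same construction: for any finite set \<open>Y\<close> of zeros it gives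
  \<open>card Y \<le> D\<close>. The factor \<open>c\<close> of the pure powers is a generic complex
  number: there are finitely many \<open>l\<close> such that the leading form equals
  \<open>l\<close> times the \<open>d\<close>-th powers at a nonzero point, and the ray of the
  \<open>- \<tau> c\<close> must miss them.\<close>

lemma mconst_0 [simp]: "mconst 0 = 0" by (simp add: mconst_def)
lemma mconst_1 [simp]: "mconst 1 = 1" by (simp add: mconst_def)
lemma mconst_add: "mconst (a + b) = mconst a + mconst b" by (simp add: mconst_def single_add)
lemma mconst_mult: "mconst (a * b) = mconst a * mconst b" by (simp add: mconst_def mult_single)
lemma mconst_diff: "mconst (a - b) = mconst a - mconst b" by (simp add: mconst_def single_diff)
lemma mconst_uminus: "mconst (- b) = - mconst b" by (simp add: mconst_def single_uminus)
lemma mconst_sum: "mconst (sum f A) = (\<Sum>i\<in>A. mconst (f i))"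
  by (induction A rule: infinite_finite_induct) (auto simp: mconst_add)

lemma lookup_mconst_mult [simp]: "lookup (mconst c * p) m = c * lookup p m"
proof -
  have "mconst c * p = Poly_Mapping.map ((*) c) p"
    unfolding mconst_def by (rule mult_map_scale_conv_mult[symmetric])
  then show ?thesis by (simp add: Poly_Mapping.map.rep_eq when_def)
qed

lemma keys_mconst_mult: "keys (mconst c * p) \<subseteq> keys p"
  by (auto simp: in_keys_iff)

lemma single_eq_mconst: "Poly_Mapping.single m c = mconst c * Poly_Mapping.single m 1"
  by (simp add: mconst_def mult_single)

lemma mpoly_expand:
  assumes "finite S" "keys p \<subseteq> S"
  shows "p = (\<Sum>m\<in>S. Poly_Mapping.single m (lookup p m))"
proof (rule poly_mapping_eqI)
  fix k
  have "lookup (\<Sum>m\<in>S. Poly_Mapping.single m (lookup p m)) k = (\<Sum>m\<in>S. if m = k then lookup p m else 0)"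
    by (simp add: lookup_sum lookup_single when_def)
  also have "\<dots> = lookup p k" using assms by (auto simp: in_keys_iff)
  finally show "lookup p k = lookup (\<Sum>m\<in>S. Poly_Mapping.single m (lookup p m)) k" ..
qed

lemma mpoly_expand_keys: "p = (\<Sum>m\<in>keys p. Poly_Mapping.single m (lookup p m))"
  by (rule mpoly_expand) auto

lemma meval_superset:
  assumes "finite S" "keys p \<subseteq> S"
  shows "meval p x = (\<Sum>m\<in>S. lookup p m * (\<Prod>i\<in>UNIV. (x $ i) ^ lookup m i))"
  unfolding meval_def using assms by (intro sum.mono_neutral_left) (auto simp: in_keys_iff)

lemma meval_add [simp]: "meval (p + q) x = meval p x + meval q x"
proof -
  have "meval r x = (\<Sum>m\<in>keys p \<union> keys q. lookup r m * (\<Prod>i\<in>UNIV. (x $ i) ^ lookup m i))"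
    if "r = p \<or> r = q \<or> r = p + q" for r
    using that Poly_Mapping.keys_add[of p q] by (intro meval_superset) auto
  then show ?thesis by (simp add: lookup_add algebra_simps sum.distrib)
qed

lemma meval_0 [simp]: "meval 0 x = 0" by (simp add: meval_def)

lemma meval_single: "meval (Poly_Mapping.single m c) x = c * (\<Prod>i\<in>UNIV. (x $ i) ^ lookup m i)"
  by (subst meval_superset[where S="{m}"]) auto

lemma meval_sum [simp]: "meval (sum f A) x = (\<Sum>a\<in>A. meval (f a) x)"
  by (induction A rule: infinite_finite_induct) auto

lemma meval_mconst [simp]: "meval (mconst c) x = c"
  by (simp add: mconst_def meval_single)

lemma meval_mvar [simp]: "meval (mvar i) x = x $ i"
proof -
  have "(\<Prod>j\<in>UNIV. x $ j ^ lookup (Poly_Mapping.single i 1) j) = (\<Prod>j\<in>UNIV. if j = i then x $ i else 1)"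
    by (intro prod.cong) (auto simp: lookup_single when_def)
  then show ?thesis by (simp add: mvar_def meval_single)
qed

lemma meval_mult [simp]: "meval (p * q) x = meval p x * meval q x"
proof -
  have s: "meval (Poly_Mapping.single m c * Poly_Mapping.single n d) x =
    meval (Poly_Mapping.single m c) x * meval (Poly_Mapping.single n d) x" for m c n d
    by (simp add: mult_single meval_single lookup_add power_add prod.distrib)
  have "meval (p * q) x = meval ((\<Sum>m\<in>keys p. Poly_Mapping.single m (lookup p m)) *
      (\<Sum>m\<in>keys q. Poly_Mapping.single m (lookup q m))) x"
    by (simp only: mpoly_expand_keys[symmetric])
  also have "\<dots> = meval (\<Sum>m\<in>keys p. Poly_Mapping.single m (lookup p m)) x *
      meval (\<Sum>m\<in>keys q. Poly_Mapping.single m (lookup q m)) x"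
    by (simp add: sum_product s)
  also have "\<dots> = meval p x * meval q x"
    by (simp only: mpoly_expand_keys[symmetric])
  finally show ?thesis .
qed

lemma meval_1 [simp]: "meval 1 x = 1" using meval_mconst[of 1 x] by (simp del: meval_mconst)
lemma meval_uminus [simp]: "meval (- p) x = - meval p x"
  using meval_add[of p "-p" x] by (simp del: meval_add add: eq_neg_iff_add_eq_0 add.commute)
lemma meval_diff [simp]: "meval (p - q) x = meval p x - meval q x"
  using meval_add[of p "-q" x] by (simp del: meval_add) 
lemma meval_power [simp]: "meval (p ^ n) x = meval p x ^ n" by (induction n) auto
lemma meval_prod [simp]: "meval (prod f A) x = (\<Prod>a\<in>A. meval (f a) x)"
  by (induction A rule: infinite_finite_induct) auto

text \<open>Dedekind's independence of characters, applied to the monoid of points under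
  componentwise multiplication: scaling one coordinate by 2 separates two monomials.\<close>

lemma meval_eq_0_imp_eq_0:
  fixes p :: "('n::finite) mpoly"
  assumes "\<And>x. meval p x = 0"
  shows "p = 0"
  using assms
proof (induction "card (keys p)" arbitrary: p rule: less_induct)
  case less
  show ?case
  proof (rule ccontr)
    assume "p \<noteq> 0"
    then obtain m where m: "m \<in> keys p" by (metis all_not_in_conv keys_eq_empty)
    show False
    proof (cases "keys p = {m}")
      case True
      then have "meval p (\<chi> i. 1) = lookup p m" by (simp add: meval_def)
      then show False using less.prems m by (simp add: in_keys_iff)
    next
      case False
      with m obtain m' where m': "m' \<in> keys p" "m' \<noteq> m" by blast
      then obtain i where i: "lookup m' i \<noteq> lookup m i" by (metis poly_mapping_eqI)
      \<comment> \<open>\<open>q\<close> is \<open>p\<close> with coordinate \<open>i\<close>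
        doubled, minus \<open>2 ^ lookup m i\<close> times \<open>p\<close>: it still vanishes
        everywhere and has lost the term \<open>m\<close>, but keeps \<open>m'\<close>.\<close>
      define q where "q = (\<Sum>k\<in>keys p. Poly_Mapping.single k ((2 ^ lookup k i - 2 ^ lookup m i) * lookup p k))"
      have lq: "lookup q k = (2 ^ lookup k i - 2 ^ lookup m i) * lookup p k" for k
        by (auto simp: q_def lookup_sum lookup_single when_def in_keys_iff)
      have "keys q \<subseteq> keys p - {m}" by (auto simp: in_keys_iff lq)
      then have card: "card (keys q) < card (keys p)"
        using m by (intro psubset_card_mono) auto
      have "meval q x = 0" for x
      proof -
        define y where "y = (\<chi> j. if j = i then 2 * x $ j else x $ j)"
        have e: "(\<Prod>j\<in>UNIV. (y $ j) ^ lookup k j) = 2 ^ lookup k i * (\<Prod>j\<in>UNIV. (x $ j) ^ lookup k j)" for k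
        proof -
          have "(\<Prod>j\<in>UNIV. (y $ j) ^ lookup k j) = (\<Prod>j\<in>UNIV. (if j = i then 2 ^ lookup k i else 1) * (x $ j) ^ lookup k j)"
            by (intro prod.cong) (auto simp: y_def power_mult_distrib)
          then show ?thesis by (simp add: prod.distrib)
        qed
        have "meval q x = meval p y - 2 ^ lookup m i * meval p x"
          unfolding q_def meval_sum meval_single meval_def[of p] e
          by (simp add: sum_distrib_left sum_subtractf algebra_simps)
        then show ?thesis using less.prems by simp
      qed
      then have "q = 0" using less.hyps card by blast
      then have "(2 ^ lookup m' i - 2 ^ lookup m i) * lookup p m' = 0" using lq[of m'] by simp
      moreover have "(2::complex) ^ lookup m' i \<noteq> 2 ^ lookup m i"
      proof
        assume "(2::complex) ^ lookup m' i = 2 ^ lookup m i"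
        from arg_cong[OF this, of norm] show False using i by (simp add: norm_power)
      qed
      ultimately show False using m' by (simp add: in_keys_iff)
    qed
  qed
qed

text \<open>Polynomials are determined by their values, so identities that involve substitution are
  later checked pointwise.\<close>

lemma mpoly_eqI:
  fixes p :: "('n::finite) mpoly"
  assumes "\<And>x. meval p x = meval q x"
  shows "p = q"
  using meval_eq_0_imp_eq_0[of "p - q"] assms by simp

lemma meval_msubst: "meval (msubst p \<sigma>) x = meval p (sys_eval \<sigma> x)"
  by (simp add: msubst_def sys_eval_def meval_def[of p])

lemma sys_eval_nth [simp]: "sys_eval F x $ i = meval (F $ i) x" by (simp add: sys_eval_def)

lemma sys_eval_comp: "sys_eval (sys_comp F G) x = sys_eval F (sys_eval G x)"
  by (simp add: vec_eq_iff sys_comp_def meval_msubst)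

lemma mpoly_induct:
  fixes p :: "('n::finite) mpoly"
  assumes c: "\<And>c. P (mconst c)" and v: "\<And>i. P (mvar i)"
    and a: "\<And>p q. P p \<Longrightarrow> P q \<Longrightarrow> P (p + q)" and m: "\<And>p q. P p \<Longrightarrow> P q \<Longrightarrow> P (p * q)"
  shows "P p"
proof -
  have pw: "P (mvar i ^ k)" for i k
    by (induction k) (use c[of 1] m v in auto)
  have pr: "P (\<Prod>i\<in>A. mvar i ^ f i)" if "finite A" for A and f :: "'n \<Rightarrow> nat"
    using that by (induction A) (use c[of 1] m pw in auto)
  have e: "p = (\<Sum>k\<in>keys p. mconst (lookup p k) * (\<Prod>i\<in>UNIV. mvar i ^ lookup k i))"
    by (rule mpoly_eqI) (simp add: meval_def[of p])
  have "P (\<Sum>k\<in>A. mconst (lookup p k) * (\<Prod>i\<in>UNIV. mvar i ^ lookup k i))" if "finite A" for A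
    using that by (induction A) (use c[of 0] c pr a m in auto)
  then show ?thesis by (subst e) simp
qed

lemma continuous_on_meval: "continuous_on S (\<lambda>x. meval p x)"
  unfolding meval_def by (intro continuous_intros)

lemma continuous_on_sys_eval: "continuous_on S (\<lambda>x. sys_eval F x)"
  unfolding sys_eval_def by (intro continuous_intros continuous_on_meval)

section \<open>Ideals of finite codimension\<close>

definition is_ideal :: "'n mpoly set \<Rightarrow> bool" where
  "is_ideal I \<longleftrightarrow> 0 \<in> I \<and> (\<forall>p\<in>I. \<forall>q\<in>I. p + q \<in> I) \<and> (\<forall>p\<in>I. \<forall>r. r * p \<in> I)"

lemma is_idealD:
  assumes "is_ideal I"
  shows "0 \<in> I" "p \<in> I \<Longrightarrow> q \<in> I \<Longrightarrow> p + q \<in> I" "p \<in> I \<Longrightarrow> r * p \<in> I"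
    "p \<in> I \<Longrightarrow> p * r \<in> I" "p \<in> I \<Longrightarrow> - p \<in> I" "p \<in> I \<Longrightarrow> q \<in> I \<Longrightarrow> p - q \<in> I"
proof -
  show a: "0 \<in> I" "p \<in> I \<Longrightarrow> q \<in> I \<Longrightarrow> p + q \<in> I" "p \<in> I \<Longrightarrow> r * p \<in> I" for p q r
    using assms by (auto simp: is_ideal_def)
  show b: "p \<in> I \<Longrightarrow> - p \<in> I" for p using a(3)[of p "-1"] by simp
  show "p \<in> I \<Longrightarrow> p * r \<in> I" using a(3)[of p r] by (simp add: mult.commute)
  show "p \<in> I \<Longrightarrow> q \<in> I \<Longrightarrow> p - q \<in> I" using a(2)[of p "-q"] b[of q] by simp
qed

lemma ideal_sum:
  assumes "is_ideal I" "\<And>a. a \<in> A \<Longrightarrow> f a \<in> I"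
  shows "sum f A \<in> I"
  using assms(2) by (induction A rule: infinite_finite_induct) (auto intro: is_idealD[OF assms(1)])

lemma is_ideal_UNIV: "is_ideal UNIV" by (simp add: is_ideal_def)

definition sys_ideal :: "('n::finite) system \<Rightarrow> 'n mpoly set" where
  "sys_ideal F = {(\<Sum>i\<in>UNIV. a i * F $ i) | a. True}"

lemma sys_idealI: "(\<Sum>i\<in>UNIV. a i * F $ i) \<in> sys_ideal F"
  by (auto simp: sys_ideal_def)

lemma is_ideal_sys_ideal: "is_ideal (sys_ideal F)"
  unfolding is_ideal_def
proof (intro conjI ballI allI)
  show "0 \<in> sys_ideal F" using sys_idealI[of "\<lambda>_. 0" F] by simp
next
  fix p q assume "p \<in> sys_ideal F" "q \<in> sys_ideal F"
  then obtain a b where "p = (\<Sum>i\<in>UNIV. a i * F $ i)" "q = (\<Sum>i\<in>UNIV. b i * F $ i)"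
    by (auto simp: sys_ideal_def)
  then show "p + q \<in> sys_ideal F"
    using sys_idealI[of "\<lambda>i. a i + b i" F] by (simp add: algebra_simps sum.distrib)
next
  fix p r assume "p \<in> sys_ideal F"
  then obtain a where "p = (\<Sum>i\<in>UNIV. a i * F $ i)" by (auto simp: sys_ideal_def)
  then show "r * p \<in> sys_ideal F"
    using sys_idealI[of "\<lambda>i. r * a i" F] by (simp add: algebra_simps sum_distrib_left)
qed

lemma sys_ideal_gen: "F $ i \<in> sys_ideal F"
  using sys_idealI[of "\<lambda>j. if j = i then 1 else 0" F] by (simp add: if_distrib[of "\<lambda>x. x * _"] cong: if_cong)

lemma sys_ideal_subset:
  assumes "is_ideal I" "\<And>i. F $ i \<in> I"
  shows "sys_ideal F \<subseteq> I"
  by (auto simp: sys_ideal_def intro!: ideal_sum[OF assms(1)] is_idealD(3)[OF assms(1)] assms(2))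

lemma meval_sys_ideal: "p \<in> sys_ideal F \<Longrightarrow> sys_eval F x = 0 \<Longrightarrow> meval p x = 0"
  by (auto simp: sys_ideal_def vec_eq_iff)

section \<open>The maximal ideal of a point and localization\<close>

definition vanish :: "('n::finite) point \<Rightarrow> 'n mpoly set" where
  "vanish y = sys_ideal (\<chi> i. mvar i - mconst (y $ i))"

lemma is_ideal_vanish: "is_ideal (vanish y)"
  unfolding vanish_def by (rule is_ideal_sys_ideal)

text \<open>The product case rests on
  \<open>pq - p(y)q(y) = q(p - p(y)) + p(y)(q - q(y))\<close>.\<close>

lemma diff_meval_in_vanish: "p - mconst (meval p y) \<in> vanish y"
proof (induction p rule: mpoly_induct)
  case (1 c) then show ?case by (simp add: is_idealD[OF is_ideal_vanish])
next
  case (2 i) then show ?case using sys_ideal_gen[of "\<chi> i. mvar i - mconst (y $ i)" i] by (simp add: vanish_def)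
next
  case (3 p q)
  have "p + q - mconst (meval (p + q) y) = (p - mconst (meval p y)) + (q - mconst (meval q y))"
    by (simp add: mconst_add)
  with is_idealD(2)[OF is_ideal_vanish 3] show ?case by (simp only:)
next
  case (4 p q)
  have "p * q - mconst (meval (p * q) y) = q * (p - mconst (meval p y)) + mconst (meval p y) * (q - mconst (meval q y))"
    by (simp add: mconst_mult algebra_simps)
  also have "\<dots> \<in> vanish y" using 4 by (intro is_idealD(2,3)[OF is_ideal_vanish])
  finally show ?case .
qed

lemma vanish_iff: "p \<in> vanish y \<longleftrightarrow> meval p y = 0"
proof
  show "p \<in> vanish y \<Longrightarrow> meval p y = 0"
    unfolding vanish_def by (rule meval_sys_ideal) (auto simp: vec_eq_iff)
  show "meval p y = 0 \<Longrightarrow> p \<in> vanish y" using diff_meval_in_vanish[of p y] by simp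
qed

definition radical :: "'n mpoly set \<Rightarrow> 'n mpoly set" where
  "radical I = {p. \<exists>n. p ^ n \<in> I}"

lemma is_ideal_radical:
  assumes I: "is_ideal I"
  shows "is_ideal (radical I)"
  unfolding is_ideal_def
proof (intro conjI ballI allI)
  show "0 \<in> radical I" using is_idealD(1)[OF I] by (auto simp: radical_def intro!: exI[of _ 1])
next
  fix p q assume "p \<in> radical I" "q \<in> radical I"
  then obtain m n where mn: "p ^ m \<in> I" "q ^ n \<in> I" by (auto simp: radical_def)
  have "p ^ k * q ^ (m + n - k) \<in> I" for k
  proof (cases "m \<le> k")
    case True
    then have "p ^ k = p ^ m * p ^ (k - m)" by (simp flip: power_add)
    then show ?thesis using mn by (metis is_idealD(4)[OF I])
  next
    case False
    then have "m + n - k = n + (m - k)" by simp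
    then have "q ^ (m + n - k) = q ^ n * q ^ (m - k)" by (simp only: power_add)
    then show ?thesis using mn by (metis is_idealD(3,4)[OF I])
  qed
  then have "(p + q) ^ (m + n) \<in> I"
    unfolding binomial_ring by (intro ideal_sum[OF I]) (metis is_idealD(3)[OF I] mult.assoc)
  then show "p + q \<in> radical I" by (auto simp: radical_def)
next
  fix p r assume "p \<in> radical I"
  then show "r * p \<in> radical I"
    by (auto simp: radical_def power_mult_distrib intro: is_idealD(3)[OF I])
qed

text \<open>The radical of \<open>I\<close> is an ideal and contains the generators
  \<open>x_i - y_i\<close> of the maximal ideal of \<open>y\<close>, hence all of it.\<close>

lemma vanish_nilpotent:
  assumes "is_ideal I" "\<And>i. (mvar i - mconst (y $ i)) ^ L i \<in> I" "meval q y = 0"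
  shows "\<exists>n. q ^ n \<in> I"
proof -
  have "vanish y \<subseteq> radical I"
    unfolding vanish_def using assms(2)
    by (intro sys_ideal_subset is_ideal_radical assms(1)) (auto simp: radical_def)
  then show ?thesis using assms(3) by (auto simp: vanish_iff[symmetric] radical_def)
qed

text \<open>Up to the scalar \<open>u(y)\<close>, \<open>u\<close> is \<open>1 - q\<close> with
  \<open>q\<close> vanishing at \<open>y\<close>, hence nilpotent modulo \<open>I\<close>; a finite
  geometric series in \<open>q\<close> inverts it.\<close>

lemma unit_mod_nilpotent:
  fixes u :: "('n::finite) mpoly"
  assumes I: "is_ideal I" and nil: "\<And>i. (mvar i - mconst (y $ i)) ^ L i \<in> I" and u: "meval u y \<noteq> 0"
  shows "\<exists>v. 1 - v * u \<in> I"
proof -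
  define c :: "'n mpoly" where "c = mconst (inverse (meval u y))"
  define q where "q = 1 - c * u"
  have "meval q y = 0" using u by (simp add: q_def c_def)
  from vanish_nilpotent[OF I nil this] obtain n where n: "q ^ n \<in> I" by blast
  have "1 - q ^ n = (1 - q) * (\<Sum>i<n. q ^ i)" by (rule one_diff_power_eq)
  then have "1 - ((\<Sum>i<n. q ^ i) * c) * u = q ^ n" by (simp add: q_def algebra_simps)
  then show ?thesis using n by (metis)
qed

text \<open>The contraction to the polynomial ring of the ideal generated by \<open>I\<close> in the local ring at \<open>y\<close>.\<close>

definition loc :: "('n::finite) mpoly set \<Rightarrow> 'n point \<Rightarrow> 'n mpoly set" where
  "loc I y = {p. \<exists>u. meval u y \<noteq> 0 \<and> u * p \<in> I}"

lemma is_ideal_loc: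
  assumes I: "is_ideal I"
  shows "is_ideal (loc I y)"
  unfolding is_ideal_def
proof (intro conjI ballI allI)
  show "0 \<in> loc I y" using is_idealD(1)[OF I] by (auto simp: loc_def intro!: exI[of _ 1])
next
  fix p q assume "p \<in> loc I y" "q \<in> loc I y"
  then obtain u v where uv: "meval u y \<noteq> 0" "u * p \<in> I" "meval v y \<noteq> 0" "v * q \<in> I" by (auto simp: loc_def)
  then have "v * (u * p) + u * (v * q) \<in> I" by (metis is_idealD(2,3)[OF I])
  moreover have "v * (u * p) + u * (v * q) = (u * v) * (p + q)" by (simp add: algebra_simps)
  ultimately show "p + q \<in> loc I y" using uv by (auto simp: loc_def intro!: exI[of _ "u * v"])
next
  fix p r assume "p \<in> loc I y"
  then obtain u where u: "meval u y \<noteq> 0" "u * p \<in> I" by (auto simp: loc_def)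
  then have "r * (u * p) \<in> I" by (metis is_idealD(3)[OF I])
  then show "r * p \<in> loc I y" using u by (auto simp: loc_def mult.left_commute intro!: exI[of _ u])
qed

lemma loc_superset: "I \<subseteq> loc I y"
  by (auto simp: loc_def intro!: exI[of _ 1])

lemma loc_mono: "I \<subseteq> J \<Longrightarrow> loc I y \<subseteq> loc J y"
  by (auto simp: loc_def)

lemma loc_cancel:
  assumes "u * p \<in> loc I y" "meval u y \<noteq> 0"
  shows "p \<in> loc I y"
proof -
  obtain v where "meval v y \<noteq> 0" "v * (u * p) \<in> I" using assms(1) by (auto simp: loc_def)
  then show ?thesis using assms(2) by (auto simp: loc_def mult.assoc intro!: exI[of _ "v * u"])
qed

lemma loc_loc: "loc (loc I y) y = loc I y"
  using loc_superset[of "loc I y" y] by (auto simp: loc_def[of "loc I y"] intro: loc_cancel)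

text \<open>Every denominator allowed at \<open>y\<close> is already invertible modulo such an
  \<open>I\<close>, so localizing changes nothing.\<close>

lemma loc_eq_self:
  assumes "is_ideal I" "\<And>i. (mvar i - mconst (y $ i)) ^ L i \<in> I"
  shows "loc I y = I"
proof
  show "loc I y \<subseteq> I"
  proof
    fix p assume "p \<in> loc I y"
    then obtain u where u: "meval u y \<noteq> 0" "u * p \<in> I" by (auto simp: loc_def)
    obtain v where v: "1 - v * u \<in> I" using unit_mod_nilpotent[OF assms u(1)] by blast
    have "p * (1 - v * u) + v * (u * p) \<in> I" by (metis is_idealD(2,3)[OF assms(1)] v u(2))
    then show "p \<in> I" by (simp add: algebra_simps)
  qed
qed (rule loc_superset)

lemma loc_eqI:
  assumes "is_ideal I" "is_ideal J" "I \<subseteq> loc J y" "J \<subseteq> loc I y"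
  shows "loc I y = loc J y"
  using loc_mono[OF assms(3), of y] loc_mono[OF assms(4), of y] by (simp add: loc_loc)

lemma loc_sys_nonzero:
  assumes "sys_eval F y \<noteq> 0"
  shows "loc (sys_ideal F) y = UNIV"
proof -
  obtain i where "meval (F $ i) y \<noteq> 0" using assms by (auto simp: vec_eq_iff)
  then show ?thesis
    by (auto simp: loc_def intro!: exI[of _ "F $ i"] is_idealD(4)[OF is_ideal_sys_ideal] sys_ideal_gen)
qed

lemma loc_sys_zero: "sys_eval F y = 0 \<Longrightarrow> 1 \<notin> loc (sys_ideal F) y"
  by (auto simp: loc_def dest: meval_sys_ideal)

text \<open>Gaussian elimination, one coordinate at a time. The vectors are indexed by
  \<open>J\<close>, so that coinciding vectors also count as dependent.\<close>

lemma linear_dependence: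
  fixes v :: "'j \<Rightarrow> 'a \<Rightarrow> complex"
  assumes "finite A" "finite J" "card A < card J"
  shows "\<exists>c. (\<exists>j\<in>J. c j \<noteq> 0) \<and> (\<forall>a\<in>A. (\<Sum>j\<in>J. c j * v j a) = 0)"
  using assms
proof (induction A arbitrary: J v rule: finite_induct)
  case empty
  then show ?case by (intro exI[of _ "\<lambda>_. 1"]) (auto simp: card_gt_0_iff)
next
  case (insert a A)
  show ?case
  proof (cases "\<forall>j\<in>J. v j a = 0")
    case True
    obtain c where "\<exists>j\<in>J. c j \<noteq> 0" "\<forall>a\<in>A. (\<Sum>j\<in>J. c j * v j a) = 0"
      using insert.IH[OF insert.prems(1), of v] insert.prems insert.hyps by auto
    with True show ?thesis by (intro exI[of _ c]) auto
  next
    case False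
    then obtain k where k: "k \<in> J" "v k a \<noteq> 0" by blast
    \<comment> \<open>\<open>k\<close> is a pivot: \<open>w\<close> clears coordinate
      \<open>a\<close> from the other vectors, and \<open>e\<close> below gives the pivot the
      matching coefficient.\<close>
    define w where "w j b = v j b - v j a / v k a * v k b" for j b
    have "card A < card (J - {k})" using insert k by (simp add: card_Diff_singleton)
    then obtain c where c: "\<exists>j\<in>J-{k}. c j \<noteq> 0" "\<forall>a\<in>A. (\<Sum>j\<in>J-{k}. c j * w j a) = 0"
      using insert.IH[of "J - {k}" w] insert.prems by auto
    define e where "e = (\<lambda>j. if j = k then - (\<Sum>i\<in>J-{k}. c i * v i a) / v k a else c j)"
    have e: "(\<Sum>j\<in>J. e j * v j b) = (\<Sum>j\<in>J-{k}. c j * w j b)" for b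
    proof -
      have "(\<Sum>j\<in>J. e j * v j b) = e k * v k b + (\<Sum>j\<in>J-{k}. e j * v j b)"
        using k insert.prems by (simp add: sum.remove)
      also have "(\<Sum>j\<in>J-{k}. e j * v j b) = (\<Sum>j\<in>J-{k}. c j * v j b)"
        by (intro sum.cong) (auto simp: e_def)
      also have "e k * v k b = - (\<Sum>j\<in>J-{k}. c j * (v j a / v k a * v k b))"
        by (simp add: e_def sum_divide_distrib sum_distrib_right mult.assoc flip: sum_negf)
      finally show ?thesis by (simp add: w_def algebra_simps sum_subtractf)
    qed
    have "w j a = 0" for j using k by (simp add: w_def)
    then have "\<forall>b\<in>insert a A. (\<Sum>j\<in>J. e j * v j b) = 0" using c(2) by (simp add: e)
    moreover have "\<exists>j\<in>J. e j \<noteq> 0" using c(1) by (auto simp: e_def)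
    ultimately show ?thesis by blast
  qed
qed

text \<open>The dimension of the quotient by \<open>I\<close>, expressed by representatives of a
  basis. It is a relation, so infinite codimension gets no spurious value, and it has the same shape
  as \<open>has_multiplicity\<close>.\<close>

definition codim :: "'n mpoly set \<Rightarrow> nat \<Rightarrow> bool" where
  "codim I m \<longleftrightarrow> (\<exists>B. finite B \<and> card B = m \<and>
     (\<forall>p. \<exists>c. p - (\<Sum>b\<in>B. mconst (c b) * b) \<in> I) \<and>
     (\<forall>c. (\<Sum>b\<in>B. mconst (c b) * b) \<in> I \<longrightarrow> (\<forall>b\<in>B. c b = 0)))"

lemma codimE:
  assumes "codim I m"
  obtains B where "finite B" "card B = m" "\<forall>p. \<exists>c. p - (\<Sum>b\<in>B. mconst (c b) * b) \<in> I"
    "\<forall>c. (\<Sum>b\<in>B. mconst (c b) * b) \<in> I \<longrightarrow> (\<forall>b\<in>B. c b = 0)"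
proof -
  from assms obtain B where B: "finite B \<and> card B = m \<and>
     (\<forall>p. \<exists>c. p - (\<Sum>b\<in>B. mconst (c b) * b) \<in> I) \<and>
     (\<forall>c. (\<Sum>b\<in>B. mconst (c b) * b) \<in> I \<longrightarrow> (\<forall>b\<in>B. c b = 0))"
    unfolding codim_def by (rule exE)
  show ?thesis
    by (rule that[of B]) (use B in blast)+
qed

text \<open>If \<open>B\<close> had more elements than \<open>A\<close>, their coordinates with
  respect to \<open>A\<close> would be dependent, which gives a forbidden relation modulo
  \<open>I\<close> within \<open>B\<close>.\<close>

lemma codim_le:
  assumes I: "is_ideal I" and "codim I m" "codim I m'"
  shows "m \<le> m'"
proof (rule ccontr)
  assume less: "\<not> m \<le> m'"
  obtain B where B: "finite B" "card B = m" "\<forall>p. \<exists>c. p - (\<Sum>b\<in>B. mconst (c b) * b) \<in> I"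
    "\<forall>c. (\<Sum>b\<in>B. mconst (c b) * b) \<in> I \<longrightarrow> (\<forall>b\<in>B. c b = 0)"
    by (rule codimE[OF assms(2)])
  obtain A where A: "finite A" "card A = m'" "\<forall>p. \<exists>c. p - (\<Sum>b\<in>A. mconst (c b) * b) \<in> I"
    "\<forall>c. (\<Sum>b\<in>A. mconst (c b) * b) \<in> I \<longrightarrow> (\<forall>b\<in>A. c b = 0)"
    by (rule codimE[OF assms(3)])
  from choice[OF A(3)] obtain v where v: "\<forall>p. p - (\<Sum>a\<in>A. mconst (v p a) * a) \<in> I" ..
  have "card A < card B" using less A(2) B(2) by simp
  then obtain c where c: "\<exists>j\<in>B. c j \<noteq> 0" "\<forall>a\<in>A. (\<Sum>j\<in>B. c j * v j a) = 0"
    using linear_dependence[OF A(1) B(1), of v] by blast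
  have "(\<Sum>b\<in>B. mconst (c b) * (b - (\<Sum>a\<in>A. mconst (v b a) * a))) \<in> I"
    by (intro ideal_sum[OF I] is_idealD(3)[OF I] v[rule_format])
  also have "(\<Sum>b\<in>B. mconst (c b) * (b - (\<Sum>a\<in>A. mconst (v b a) * a))) =
     (\<Sum>b\<in>B. mconst (c b) * b) - (\<Sum>b\<in>B. \<Sum>a\<in>A. mconst (c b * v b a) * a)"
    by (simp only: right_diff_distrib sum_subtractf sum_distrib_left mconst_mult mult.assoc)
  also have "(\<Sum>b\<in>B. \<Sum>a\<in>A. mconst (c b * v b a) * a) = (\<Sum>a\<in>A. mconst (\<Sum>b\<in>B. c b * v b a) * a)"
    by (subst sum.swap) (simp only: mconst_sum sum_distrib_right)
  also have "\<dots> = 0" using c(2) by simp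
  finally have "(\<Sum>b\<in>B. mconst (c b) * b) \<in> I" by simp
  from B(4)[rule_format, OF this] c(1) show False by blast
qed

lemma codim_unique: "is_ideal I \<Longrightarrow> codim I m \<Longrightarrow> codim I m' \<Longrightarrow> m = m'"
  by (meson codim_le le_antisym)

lemma codim_UNIV: "codim UNIV 0"
  by (auto simp: codim_def intro!: exI[of _ "{}"])

lemma codim_0_iff: "is_ideal I \<Longrightarrow> codim I 0 \<longleftrightarrow> I = UNIV"
  by (auto simp: codim_UNIV elim!: codimE)

text \<open>Only scalar multiples of \<open>g\<close> are added, so the codimension drops by at most
  one. The result is an ideal when \<open>g\<close> is a joint eigenvector of the variables modulo
  \<open>I\<close>, see \<open>is_ideal_adjoin\<close>.\<close>

definition adjoin :: "'n mpoly set \<Rightarrow> 'n mpoly \<Rightarrow> 'n mpoly set" where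
  "adjoin I g = {q + mconst c * g | q c. q \<in> I}"

lemma codim_adjoin:
  assumes I: "is_ideal I" and g: "g \<notin> I" and m: "codim (adjoin I g) m"
  shows "codim I (Suc m)"
proof -
  obtain B where B: "finite B" "card B = m" "\<forall>p. \<exists>c. p - (\<Sum>b\<in>B. mconst (c b) * b) \<in> adjoin I g"
    "\<forall>c. (\<Sum>b\<in>B. mconst (c b) * b) \<in> adjoin I g \<longrightarrow> (\<forall>b\<in>B. c b = 0)"
    by (rule codimE[OF m])
  have "g = 0 + mconst 1 * g" by simp
  then have gI: "g \<in> adjoin I g" unfolding adjoin_def using is_idealD(1)[OF I] by blast
  have "g \<notin> B"
  proof
    assume "g \<in> B"
    then have "(\<Sum>b\<in>B. mconst (if b = g then 1 else 0) * b) = g"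
      using B(1) by (simp add: if_distrib[of mconst] if_distrib[of "\<lambda>x. x * _"] cong: if_cong)
    then have "(if g = g then 1 else 0 :: complex) = 0"
      using B(4)[rule_format, of "\<lambda>b. if b = g then 1 else 0" g] gI \<open>g \<in> B\<close> by (simp only:)
    then show False by simp
  qed
  show ?thesis
    unfolding codim_def
  proof (intro exI[of _ "insert g B"] conjI allI impI)
    fix p
    obtain c where "p - (\<Sum>b\<in>B. mconst (c b) * b) \<in> adjoin I g" using B(3) by blast
    then obtain q e where q: "p - (\<Sum>b\<in>B. mconst (c b) * b) = q + mconst e * g" "q \<in> I" by (auto simp: adjoin_def)
    have "(\<Sum>b\<in>insert g B. mconst ((c(g := e)) b) * b) = mconst e * g + (\<Sum>b\<in>B. mconst (c b) * b)"
      using B(1) \<open>g \<notin> B\<close> by (auto intro!: sum.cong)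
    then have "p - (\<Sum>b\<in>insert g B. mconst ((c(g := e)) b) * b) = q" using q(1) by (simp only: diff_diff_eq[symmetric] add.commute[of "mconst e * g"]) simp
    then show "\<exists>c. p - (\<Sum>b\<in>insert g B. mconst (c b) * b) \<in> I" using q(2) by (intro exI[of _ "c(g := e)"]) (simp only:)
  next
    fix c assume "(\<Sum>b\<in>insert g B. mconst (c b) * b) \<in> I"
    then have *: "(\<Sum>b\<in>B. mconst (c b) * b) + mconst (c g) * g \<in> I" using B(1) \<open>g \<notin> B\<close> by (simp add: add.commute)
    have "(\<Sum>b\<in>B. mconst (c b) * b) = ((\<Sum>b\<in>B. mconst (c b) * b) + mconst (c g) * g) + mconst (- c g) * g"
      by (simp only: mconst_uminus mult_minus_left add.right_inverse add.assoc add_0_right)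
    with * have "(\<Sum>b\<in>B. mconst (c b) * b) \<in> adjoin I g" unfolding adjoin_def by blast
    then have c: "\<forall>b\<in>B. c b = 0" using B(4) by blast
    then have "mconst (c g) * g \<in> I" using * by simp
    then have "mconst (inverse (c g)) * (mconst (c g) * g) \<in> I" by (rule is_idealD(3)[OF I])
    then have "mconst (inverse (c g) * c g) * g \<in> I" by (simp only: mconst_mult mult.assoc)
    then have "c g = 0" using g by (cases "c g = 0") simp_all
    with c show "\<forall>b\<in>insert g B. c b = 0" by simp
  qed (use B \<open>g \<notin> B\<close> in auto)
qed

section \<open>Composition series and traces\<close>

definition linfun :: "('n mpoly \<Rightarrow> complex) \<Rightarrow> bool" where
  "linfun f \<longleftrightarrow> (\<forall>p q. f (p + q) = f p + f q) \<and> (\<forall>c p. f (mconst c * p) = c * f p)"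

lemma linfunD:
  assumes "linfun f"
  shows "f (p + q) = f p + f q" "f (mconst c * p) = c * f p" "f 0 = 0" "f (- p) = - f p" "f (p - q) = f p - f q"
proof -
  show a: "f (p + q) = f p + f q" and b: "f (mconst c * p) = c * f p" for p q c
    using assms by (auto simp: linfun_def)
  show "f 0 = 0" using b[of 0 0] by simp
  show c: "f (- p) = - f p" for p using b[of "-1" p] by (simp add: mconst_uminus)
  show "f (p - q) = f p - f q" using a[of p "-q"] c[of q] by simp
qed

lemma linfun_sum: "linfun f \<Longrightarrow> f (\<Sum>a\<in>A. g a) = (\<Sum>a\<in>A. f (g a))"
  by (induction A rule: infinite_finite_induct) (auto simp: linfunD)

text \<open>A basis \<open>X\<close> of the quotient by \<open>I\<close> with its coordinate
  functionals. The trace of the multiplication by \<open>p\<close> is then the sum of the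
  \<open>\<phi> a (p * X a)\<close>, without quotient spaces or matrices.\<close>

definition dual :: "'n mpoly set \<Rightarrow> 'a set \<Rightarrow> ('a \<Rightarrow> 'n mpoly \<Rightarrow> complex) \<Rightarrow> ('a \<Rightarrow> 'n mpoly) \<Rightarrow> bool" where
  "dual I A \<phi> X \<longleftrightarrow> finite A \<and> (\<forall>a\<in>A. linfun (\<phi> a)) \<and> (\<forall>a\<in>A. \<forall>p\<in>I. \<phi> a p = 0) \<and>
     (\<forall>a\<in>A. \<forall>b\<in>A. \<phi> a (X b) = (if a = b then 1 else 0)) \<and>
     (\<forall>p. p - (\<Sum>a\<in>A. mconst (\<phi> a p) * X a) \<in> I)"

lemma dualD:
  assumes "dual I A \<phi> X"
  shows "finite A" "a \<in> A \<Longrightarrow> linfun (\<phi> a)" "a \<in> A \<Longrightarrow> p \<in> I \<Longrightarrow> \<phi> a p = 0"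
    "a \<in> A \<Longrightarrow> b \<in> A \<Longrightarrow> \<phi> a (X b) = (if a = b then 1 else 0)"
    "p - (\<Sum>a\<in>A. mconst (\<phi> a p) * X a) \<in> I"
  using assms unfolding dual_def by blast+

lemma dual_expand:
  assumes d: "dual I A \<phi> X" and f: "linfun f" "\<And>q. q \<in> I \<Longrightarrow> f q = 0"
  shows "f p = (\<Sum>a\<in>A. \<phi> a p * f (X a))"
proof -
  have "f (p - (\<Sum>a\<in>A. mconst (\<phi> a p) * X a)) = 0" by (rule f(2)[OF dualD(5)[OF d]])
  then show ?thesis by (simp add: linfunD[OF f(1)] linfun_sum[OF f(1)])
qed

text \<open>Both sides are the trace of the multiplication by \<open>p\<close> on the quotient ring.\<close>

lemma dual_trace_unique:
  assumes I: "is_ideal I" and d: "dual I A \<phi> X" and e: "dual I B \<psi> Y"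
  shows "(\<Sum>a\<in>A. \<phi> a (p * X a)) = (\<Sum>b\<in>B. \<psi> b (p * Y b))"
proof -
  have 1: "\<phi> a (p * X a) = (\<Sum>b\<in>B. \<psi> b (X a) * \<phi> a (p * Y b))" if "a \<in> A" for a
  proof (rule dual_expand[OF e, where f = "\<lambda>q. \<phi> a (p * q)"])
    show "linfun (\<lambda>q. \<phi> a (p * q))"
    proof -
      have "p * (mconst c * q) = mconst c * (p * q)" for c q by (simp add: mult.left_commute)
      then show ?thesis
        unfolding linfun_def by (simp only: distrib_left linfunD[OF dualD(2)[OF d that]] simp_thms)
    qed
    show "\<phi> a (p * q) = 0" if "q \<in> I" for q
      using dualD(3)[OF d \<open>a \<in> A\<close> is_idealD(3)[OF I that]] .
  qed
  have 2: "\<psi> b (p * Y b) = (\<Sum>a\<in>A. \<phi> a (p * Y b) * \<psi> b (X a))" if "b \<in> B" for b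
    by (rule dual_expand[OF d dualD(2)[OF e that] dualD(3)[OF e that]])
  have "(\<Sum>a\<in>A. \<phi> a (p * X a)) = (\<Sum>a\<in>A. \<Sum>b\<in>B. \<psi> b (X a) * \<phi> a (p * Y b))"
    by (rule sum.cong[OF refl 1])
  also have "\<dots> = (\<Sum>b\<in>B. \<Sum>a\<in>A. \<phi> a (p * Y b) * \<psi> b (X a))"
    by (subst sum.swap) (simp add: mult.commute)
  also have "\<dots> = (\<Sum>b\<in>B. \<psi> b (p * Y b))"
    by (rule sum.cong[OF refl 2[symmetric]])
  finally show ?thesis .
qed

text \<open>The list records the points at which the successive one-dimensional quotients of a composition
  series of the quotient by \<open>I\<close> are supported.\<close>

inductive comp_series :: "('n::finite) mpoly set \<Rightarrow> 'n point list \<Rightarrow> bool" where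
  top: "comp_series UNIV []"
| step: "is_ideal I \<Longrightarrow> g \<notin> I \<Longrightarrow> (\<And>i. (mvar i - mconst (y $ i)) * g \<in> I) \<Longrightarrow>
    comp_series (adjoin I g) ys \<Longrightarrow> comp_series I (y # ys)"

lemma comp_series_ideal: "comp_series I ys \<Longrightarrow> is_ideal I"
  by (induction rule: comp_series.induct) (auto simp: is_ideal_UNIV)

text \<open>The \<open>p\<close> with \<open>p * g\<close> in \<open>I\<close> form an ideal; it
  contains the generators of the maximal ideal of \<open>y\<close>, hence every
  \<open>p - p(y)\<close>.\<close>

lemma joint_eigenvector:
  fixes I :: "('n::finite) mpoly set"
  assumes I: "is_ideal I" and "\<And>i. (mvar i - mconst (y $ i)) * g \<in> I"
  shows "p * g - mconst (meval p y) * g \<in> I"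
proof -
  have "is_ideal {p. p * g \<in> I}"
    unfolding is_ideal_def by (auto simp: distrib_right mult.assoc is_idealD[OF I])
  then have "vanish y \<subseteq> {p. p * g \<in> I}"
    unfolding vanish_def by (rule sys_ideal_subset) (simp add: assms(2))
  then have "(p - mconst (meval p y)) * g \<in> I" using diff_meval_in_vanish by blast
  then show ?thesis by (simp only: left_diff_distrib)
qed

lemma adjoinI: "q \<in> I \<Longrightarrow> q + mconst c * g \<in> adjoin I g"
  by (auto simp: adjoin_def)

lemma subset_adjoin: "I \<subseteq> adjoin I g"
  using adjoinI[of _ I 0 g] by auto

lemma gen_in_adjoin: "is_ideal I \<Longrightarrow> g \<in> adjoin I g"
  using adjoinI[of 0 I 1 g] by (simp add: is_idealD)

lemma is_ideal_adjoin:
  fixes I :: "('n::finite) mpoly set"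
  assumes I: "is_ideal I" and g: "\<And>i. (mvar i - mconst (y $ i)) * g \<in> I"
  shows "is_ideal (adjoin I g)"
  unfolding is_ideal_def
proof (intro conjI ballI allI)
  show "0 \<in> adjoin I g" using subset_adjoin is_idealD(1)[OF I] by blast
next
  fix p q assume "p \<in> adjoin I g" "q \<in> adjoin I g"
  then obtain a b c d where *: "p = a + mconst c * g" "q = b + mconst d * g" "a \<in> I" "b \<in> I"
    by (auto simp: adjoin_def)
  then have "p + q = (a + b) + mconst (c + d) * g" by (simp add: mconst_add algebra_simps)
  then show "p + q \<in> adjoin I g" using adjoinI[OF is_idealD(2)[OF I *(3,4)]] by simp
next
  fix p r :: "'n mpoly" assume "p \<in> adjoin I g"
  then obtain a c where *: "p = a + mconst c * g" "a \<in> I" by (auto simp: adjoin_def)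
  define s where "s = r * mconst c"
  have "r * p = (r * a + (s * g - mconst (meval s y) * g)) + mconst (meval s y) * g"
    by (simp add: * s_def algebra_simps)
  moreover have "r * a + (s * g - mconst (meval s y) * g) \<in> I"
    by (rule is_idealD(2)[OF I is_idealD(3)[OF I *(2)] joint_eigenvector[OF I g]])
  ultimately show "r * p \<in> adjoin I g" using adjoinI by metis
qed

lemma scalar_mem_ideal:
  assumes I: "is_ideal I" and "g \<notin> I" "mconst c * g \<in> I"
  shows "c = 0"
proof (rule ccontr)
  assume c: "c \<noteq> 0"
  have "mconst (inverse c) * (mconst c * g) \<in> I" by (rule is_idealD(3)[OF I assms(3)])
  then have "mconst (inverse c * c) * g \<in> I" by (simp only: mconst_mult mult.assoc)
  then show False using c assms(2) by simp
qed

text \<open>In a basis adapted to the series, multiplication by \<open>p\<close> is triangular, and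
  the diagonal entry of each step is the value of \<open>p\<close> at the point of that
  step.\<close>

lemma comp_series_dual:
  assumes "comp_series I ys"
  shows "\<exists>\<phi> Y. dual I {..<length ys} \<phi> Y \<and> (\<forall>p. (\<Sum>k<length ys. \<phi> k (p * Y k)) = (\<Sum>y\<leftarrow>ys. meval p y))"
  using assms
proof (induction rule: comp_series.induct)
  case top
  show ?case by (rule exI[of _ "\<lambda>_ _. 0"], rule exI[of _ "\<lambda>_. 0"]) (simp add: dual_def)
next
  case (step I g y ys)
  note I = step.hyps(1)
  let ?J = "adjoin I g"
  obtain \<psi> Y where d: "dual ?J {..<length ys} \<psi> Y"
    and tr: "\<And>p. (\<Sum>k<length ys. \<psi> k (p * Y k)) = (\<Sum>y\<leftarrow>ys. meval p y)"
    using step.IH by blast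
  \<comment> \<open>\<open>r\<close> removes the component along the old basis, which leaves an
    element of \<open>adjoin I g\<close>. Its coefficient at \<open>g\<close>, unique because
    \<open>g\<close> is not in \<open>I\<close>, is the new coordinate functional
    \<open>\<gamma>\<close>.\<close>
  define r where "r p = p - (\<Sum>k<length ys. mconst (\<psi> k p) * Y k)" for p
  define P where "P p c \<longleftrightarrow> r p - mconst c * g \<in> I" for p c
  have ex: "\<exists>c. P p c" for p
  proof -
    have "r p \<in> ?J" unfolding r_def by (rule dualD(5)[OF d])
    then obtain q c where "q \<in> I" "r p = q + mconst c * g" by (auto simp: adjoin_def)
    then have "P p c" by (simp add: P_def)
    then show ?thesis ..
  qed
  have un: "c = c'" if "P p c" "P p c'" for p c c'
  proof -
    have "(r p - mconst c' * g) - (r p - mconst c * g) \<in> I"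
      by (rule is_idealD(6)[OF I]) (use that in \<open>auto simp: P_def\<close>)
    then have "mconst (c - c') * g \<in> I" by (simp add: mconst_diff left_diff_distrib)
    then show ?thesis using scalar_mem_ideal[OF I step.hyps(2)] by force
  qed
  define \<gamma> where "\<gamma> p = (SOME c. P p c)" for p
  have g: "P p (\<gamma> p)" for p unfolding \<gamma>_def by (rule someI_ex[OF ex])
  have geq: "\<gamma> p = c" if "P p c" for p c by (rule un[OF g that])
  have linr: "r (p + q) = r p + r q" "r (mconst c * p) = mconst c * r p" for p q c
  proof -
    have lin: "linfun (\<psi> k)" if "k < length ys" for k using dualD(2)[OF d] that by simp
    show "r (p + q) = r p + r q"
      by (simp add: r_def linfunD[OF lin] mconst_add distrib_right sum.distrib)
    show "r (mconst c * p) = mconst c * r p"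
      by (simp add: r_def linfunD[OF lin] mconst_mult right_diff_distrib sum_distrib_left mult.assoc)
  qed
  have ling: "linfun \<gamma>"
    unfolding linfun_def
  proof (intro conjI allI)
    fix p q
    have "r (p + q) - mconst (\<gamma> p + \<gamma> q) * g = (r p - mconst (\<gamma> p) * g) + (r q - mconst (\<gamma> q) * g)"
      by (simp add: linr mconst_add distrib_right)
    then show "\<gamma> (p + q) = \<gamma> p + \<gamma> q" using is_idealD(2)[OF I g[unfolded P_def, of p] g[unfolded P_def, of q]]
      by (intro geq) (simp add: P_def)
  next
    fix c p
    have "r (mconst c * p) - mconst (c * \<gamma> p) * g = mconst c * (r p - mconst (\<gamma> p) * g)"
      by (simp add: linr mconst_mult right_diff_distrib mult.assoc)
    then show "\<gamma> (mconst c * p) = c * \<gamma> p" using is_idealD(3)[OF I g[unfolded P_def, of p]]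
      by (intro geq) (simp add: P_def)
  qed
  have psi0: "\<psi> k p = 0" if "k < length ys" "p \<in> ?J" for k p
    using dualD(3)[OF d] that by simp
  have rJ: "r p = p" if "p \<in> ?J" for p using psi0[OF _ that] by (simp add: r_def)
  have g0: "\<gamma> p = 0" if "p \<in> I" for p
    using that subset_adjoin[of I g] by (intro geq) (auto simp: P_def rJ)
  have gg: "\<gamma> g = 1"
    using gen_in_adjoin[OF I] by (intro geq) (simp add: P_def rJ is_idealD(1)[OF I])
  have rY: "r (Y k) = 0" if "k < length ys" for k
  proof -
    have "(\<Sum>j<length ys. mconst (\<psi> j (Y k)) * Y j) = (\<Sum>j<length ys. if j = k then Y j else 0)"
      using that by (intro sum.cong) (auto simp: dualD(4)[OF d])
    then show ?thesis using that by (simp add: r_def)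
  qed
  have gY: "\<gamma> (Y k) = 0" if "k < length ys" for k
    using that by (intro geq) (simp add: P_def rY is_idealD(1)[OF I])
  define \<phi> where "\<phi> k = (case k of 0 \<Rightarrow> \<gamma> | Suc j \<Rightarrow> \<psi> j)" for k
  define Z where "Z k = (case k of 0 \<Rightarrow> g | Suc j \<Rightarrow> Y j)" for k
  have "dual I {..<length (y # ys)} \<phi> Z"
    unfolding dual_def
  proof (intro conjI ballI allI)
    fix a assume a: "a \<in> {..<length (y # ys)}"
    show "linfun (\<phi> a)" using a ling dualD(2)[OF d] by (auto simp: \<phi>_def split: nat.split)
    show "\<phi> a p = 0" if "p \<in> I" for p
      using a that g0 psi0 subset_adjoin[of I g] by (auto simp: \<phi>_def split: nat.split)
    show "\<phi> a (Z b) = (if a = b then 1 else 0)" if "b \<in> {..<length (y # ys)}" for b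
      using a that gg gY psi0[OF _ gen_in_adjoin[OF I]] dualD(4)[OF d]
      by (auto simp: \<phi>_def Z_def split: nat.split)
  next
    fix p
    have "p - (\<Sum>a<length (y # ys). mconst (\<phi> a p) * Z a) = r p - mconst (\<gamma> p) * g"
      by (simp only: list.size sum.lessThan_Suc_shift \<phi>_def Z_def nat.case r_def add_0_right add_Suc_right)
         (simp add: algebra_simps)
    then show "p - (\<Sum>a\<in>{..<length (y # ys)}. mconst (\<phi> a p) * Z a) \<in> I" using g[of p] by (simp only: P_def)
  qed auto
  moreover have "(\<Sum>k<length (y # ys). \<phi> k (p * Z k)) = (\<Sum>y\<leftarrow>y#ys. meval p y)" for p
  proof -
    have "\<gamma> (p * g - mconst (meval p y) * g) = 0"
      by (rule g0[OF joint_eigenvector[OF I step.hyps(3)]])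
    then have "\<gamma> (p * g) = meval p y" by (simp add: linfunD[OF ling] gg)
    then show ?thesis
      by (simp only: list.size sum.lessThan_Suc_shift \<phi>_def Z_def nat.case add_0_right add_Suc_right tr list.map sum_list.Cons)
  qed
  ultimately show ?case by blast
qed

text \<open>A weaker notion than \<open>dual\<close>: it only bounds the dimension from above, so no
  basis has to be carried along when the ideal grows.\<close>

definition fdim :: "'n mpoly set \<Rightarrow> 'a set \<Rightarrow> ('a \<Rightarrow> 'n mpoly \<Rightarrow> complex) \<Rightarrow> bool" where
  "fdim I A \<phi> \<longleftrightarrow> finite A \<and> (\<forall>a\<in>A. linfun (\<phi> a)) \<and> (\<forall>p. (\<forall>a\<in>A. \<phi> a p = 0) \<longrightarrow> p \<in> I)"

lemma dual_imp_fdim: 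
  assumes "dual I A \<phi> X" shows "fdim I A \<phi>"
  unfolding fdim_def
proof (intro conjI ballI allI impI dualD(1,2)[OF assms])
  fix p assume "\<forall>a\<in>A. \<phi> a p = 0"
  then show "p \<in> I" using dualD(5)[OF assms, of p] by simp
qed

definition poly_at :: "complex poly \<Rightarrow> 'n \<Rightarrow> 'n mpoly" where
  "poly_at q i = (\<Sum>k\<le>degree q. mconst (coeff q k) * mvar i ^ k)"

lemma meval_poly_at [simp]: "meval (poly_at q i) x = poly q (x $ i)"
  by (simp add: poly_at_def poly_altdef)

text \<open>Over the complex numbers \<open>q\<close> splits into linear factors. Multiplying
  \<open>g\<close> by all of them ends in \<open>K\<close>; the last product still outside
  \<open>K\<close> is an eigenvector of \<open>x_i\<close>.\<close>

lemma eigen_step: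
  fixes K :: "('n::finite) mpoly set"
  assumes K: "is_ideal K" and "q \<noteq> 0" "g \<notin> K" "poly_at q i * g \<in> K"
  shows "\<exists>\<alpha> r. r * g \<notin> K \<and> (mvar i - mconst \<alpha>) * (r * g) \<in> K"
  using assms(2-4)
proof (induction "degree q" arbitrary: q)
  case 0
  then have "poly_at q i = mconst (coeff q 0)" by (simp add: poly_at_def)
  then have "coeff q 0 = 0" using scalar_mem_ideal[OF K 0(3)] 0(4) by simp
  then show ?case using 0 by (metis leading_coeff_0_iff)
next
  case (Suc n)
  have "\<not> constant (poly q)" using Suc.hyps(2) by (simp add: constant_degree)
  then obtain \<alpha> where \<alpha>: "poly q \<alpha> = 0" using fundamental_theorem_of_algebra by blast
  then obtain q' where q': "q = [:-\<alpha>, 1:] * q'" by (auto simp: poly_eq_0_iff_dvd)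
  have q0: "q' \<noteq> 0" using Suc.prems q' by auto
  have deg: "degree q = Suc (degree q')" using q0 unfolding q' by (subst degree_mult_eq) auto
  have e: "poly_at q i = (mvar i - mconst \<alpha>) * poly_at q' i"
    by (rule mpoly_eqI) (simp add: q' algebra_simps)
  show ?case
  proof (cases "poly_at q' i * g \<in> K")
    case True
    then show ?thesis using Suc.hyps(1)[of q'] Suc.hyps(2) deg q0 Suc.prems(2) by simp
  next
    case False
    moreover have "(mvar i - mconst \<alpha>) * (poly_at q' i * g) \<in> K" using Suc.prems(3) by (simp only: e mult.assoc)
    ultimately show ?thesis by blast
  qed
qed

text \<open>The powers \<open>1, x_i, ..., x_i ^ card A\<close> outnumber the functionals, so a
  nontrivial combination is killed by all of them.\<close>

lemma poly_at_mem:
  fixes I :: "('n::finite) mpoly set"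
  assumes "fdim I A \<phi>"
  shows "\<exists>q. q \<noteq> 0 \<and> poly_at q i \<in> I"
proof -
  have A: "finite A" and lin: "\<And>a. a \<in> A \<Longrightarrow> linfun (\<phi> a)" and mem: "\<And>p. \<forall>a\<in>A. \<phi> a p = 0 \<Longrightarrow> p \<in> I"
    using assms by (auto simp: fdim_def)
  obtain c where c: "\<exists>j\<in>{..card A}. c j \<noteq> 0" "\<forall>a\<in>A. (\<Sum>j\<in>{..card A}. c j * \<phi> a (mvar i ^ j)) = 0"
    using linear_dependence[OF A, of "{..card A}" "\<lambda>j a. \<phi> a (mvar i ^ j)"] by auto
  define q where "q = (\<Sum>j\<le>card A. monom (c j) j)"
  have cq: "coeff q j = (if j \<le> card A then c j else 0)" for j
    by (auto simp: q_def coeff_sum)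
  have "q \<noteq> 0" using c(1) cq by (metis atMost_iff coeff_0)
  moreover have "poly_at q i = (\<Sum>j\<le>card A. mconst (c j) * mvar i ^ j)"
    by (rule mpoly_eqI) (simp add: q_def poly_sum poly_monom)
  moreover have "(\<Sum>j\<le>card A. mconst (c j) * mvar i ^ j) \<in> I"
    using c(2) by (intro mem) (simp add: linfun_sum[OF lin] linfunD[OF lin])
  ultimately show ?thesis by auto
qed

text \<open>Variables are treated one at a time: the new \<open>g\<close> is a multiple of the old
  one, so the relations for earlier variables persist because \<open>I\<close> is an ideal.\<close>

lemma socle:
  fixes I :: "('n::finite) mpoly set"
  assumes I: "is_ideal I" and f: "fdim I A \<phi>" and one: "1 \<notin> I"
  shows "\<exists>g y. g \<notin> I \<and> (\<forall>i. (mvar i - mconst (y $ i)) * g \<in> I)"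
proof -
  have "\<exists>g y. g \<notin> I \<and> (\<forall>i\<in>V. (mvar i - mconst (y $ i)) * g \<in> I)" if "finite V" for V :: "'n set"
    using that
  proof (induction V rule: finite_induct)
    case empty then show ?case using one by auto
  next
    case (insert i V)
    then obtain g y where g: "g \<notin> I" "\<forall>j\<in>V. (mvar j - mconst (y $ j)) * g \<in> I" by blast
    obtain q where q: "q \<noteq> 0" "poly_at q i \<in> I" using poly_at_mem[OF f] by blast
    obtain \<alpha> r where r: "r * g \<notin> I" "(mvar i - mconst \<alpha>) * (r * g) \<in> I"
      using eigen_step[OF I q(1) g(1) is_idealD(4)[OF I q(2)]] by blast
    have "(mvar j - mconst ((\<chi> k. if k = i then \<alpha> else y $ k) $ j)) * (r * g) \<in> I" if "j \<in> insert i V" for j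
    proof (cases "j = i")
      case False
      then have "(mvar j - mconst (y $ j)) * g \<in> I" using g(2) that by blast
      then have "r * ((mvar j - mconst (y $ j)) * g) \<in> I" by (rule is_idealD(3)[OF I])
      then show ?thesis using False by (simp add: mult.left_commute)
    qed (simp add: r)
    then show ?case using r(1) by blast
  qed
  from this[of UNIV] show ?thesis by simp
qed

text \<open>A functional with \<open>\<phi> a g\<close> nonzero serves to clear \<open>g\<close>
  from the others and is then dropped; this decrease drives the induction in
  \<open>comp_series_exists\<close>.\<close>

lemma fdim_adjoin:
  fixes I :: "('n::finite) mpoly set"
  assumes I: "is_ideal I" and f: "fdim I A \<phi>" and g: "g \<notin> I"
  shows "\<exists>a \<phi>'. a \<in> A \<and> fdim (adjoin I g) (A - {a}) \<phi>'"
proof -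
  obtain a where a: "a \<in> A" "\<phi> a g \<noteq> 0" using f g unfolding fdim_def by blast
  define \<phi>' where "\<phi>' b p = \<phi> b p - \<phi> b g / \<phi> a g * \<phi> a p" for b p
  have lin: "\<And>b. b \<in> A \<Longrightarrow> linfun (\<phi> b)" using f by (simp add: fdim_def)
  have "fdim (adjoin I g) (A - {a}) \<phi>'"
    unfolding fdim_def
  proof (intro conjI ballI allI impI)
    show "finite (A - {a})" using f by (simp add: fdim_def)
    show "linfun (\<phi>' b)" if "b \<in> A - {a}" for b
      unfolding linfun_def \<phi>'_def using that
      by (simp add: linfunD[OF lin] linfunD[OF lin[OF a(1)]] right_diff_distrib distrib_left add_divide_distrib)
    fix p assume p: "\<forall>b\<in>A - {a}. \<phi>' b p = 0"
    define q where "q = p - mconst (\<phi> a p / \<phi> a g) * g"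
    have "\<phi> b q = 0" if "b \<in> A" for b
    proof (cases "b = a")
      case True then show ?thesis using a by (simp add: q_def linfunD[OF lin])
    next
      case False
      then have "\<phi>' b p = 0" using p that by simp
      then show ?thesis using that by (simp add: q_def linfunD[OF lin] \<phi>'_def)
    qed
    then have "q \<in> I" using f by (simp add: fdim_def)
    then have "q + mconst (\<phi> a p / \<phi> a g) * g \<in> adjoin I g" by (rule adjoinI)
    then show "p \<in> adjoin I g" by (simp add: q_def)
  qed
  then show ?thesis using a(1) by blast
qed

lemma comp_series_exists:
  fixes I :: "('n::finite) mpoly set" and A :: "'a set"
  assumes "is_ideal I" "fdim I A \<phi>"
  shows "\<exists>ys. comp_series I ys"
  using assms
proof (induction "card A" arbitrary: I A \<phi> rule: less_induct)
  case less
  show ?case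
  proof (cases "1 \<in> I")
    case True
    then have "I = UNIV" using is_idealD(3)[OF less.prems(1) True] by auto
    then show ?thesis using comp_series.top by blast
  next
    case False
    then obtain g y where g: "g \<notin> I" "\<And>i. (mvar i - mconst (y $ i)) * g \<in> I"
      using socle[OF less.prems] by blast
    obtain a \<phi>' where a: "a \<in> A" "fdim (adjoin I g) (A - {a}) \<phi>'"
      using fdim_adjoin[OF less.prems g(1)] by blast
    have "card (A - {a}) < card A" using a(1) less.prems(2) by (intro psubset_card_mono) (auto simp: fdim_def)
    then obtain ys where "comp_series (adjoin I g) ys"
      using less.hyps is_ideal_adjoin[OF less.prems(1) g(2)] a(2) by blast
    then show ?thesis using comp_series.step[OF less.prems(1) g] by blast
  qed
qed

text \<open>Localization is exact, so the localized series keeps precisely the steps at the given point.\<close>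

lemma comp_series_loc:
  assumes "comp_series I ys"
  shows "codim (loc I y) (count_list ys y) \<and> (\<forall>i. (mvar i - mconst (y $ i)) ^ count_list ys y \<in> loc I y)"
  using assms
proof (induction rule: comp_series.induct)
  case top
  have "loc UNIV y = UNIV" using loc_superset by blast
  then show ?case by (simp add: codim_UNIV)
next
  case (step I g y0 ys)
  note I = step.hyps(1)
  let ?J = "adjoin I g"
  show ?case
  proof (cases "y0 = y")
    case True
    have eig: "p * g - mconst (meval p y) * g \<in> I" for p
      using joint_eigenvector[OF I step.hyps(3)] True by blast
    \<comment> \<open>A denominator \<open>u\<close> acts on \<open>g\<close> as the nonzero scalar
      \<open>u(y)\<close>, so it cannot move \<open>g\<close> into \<open>I\<close>.\<close>
    have gn: "g \<notin> loc I y"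
    proof
      assume "g \<in> loc I y"
      then obtain u where u: "meval u y \<noteq> 0" "u * g \<in> I" by (auto simp: loc_def)
      have "u * g - (u * g - mconst (meval u y) * g) \<in> I" by (rule is_idealD(6)[OF I u(2) eig])
      then have "mconst (meval u y) * g \<in> I" by simp
      then show False using scalar_mem_ideal[OF I step.hyps(2)] u(1) by blast
    qed
    have eq: "loc ?J y = adjoin (loc I y) g"
    proof (intro equalityI subsetI)
      fix p assume "p \<in> loc ?J y"
      then obtain u q c where u: "meval u y \<noteq> 0" "u * p = q + mconst c * g" "q \<in> I"
        by (auto simp: loc_def adjoin_def)
      \<comment> \<open>Since \<open>u\<close> acts on \<open>g\<close> as \<open>u(y)\<close>,
        subtracting \<open>e\<close> times \<open>g\<close> from \<open>p\<close> cancels the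
        component of \<open>u * p\<close> along \<open>g\<close>.\<close>
      define e where "e = c / meval u y"
      define p' where "p' = p - mconst e * g"
      have ce: "mconst c = mconst e * mconst (meval u y)" using u(1) by (simp add: e_def flip: mconst_mult)
      have "u * p' = q - mconst e * (u * g - mconst (meval u y) * g)"
        using u(2) by (simp add: p'_def ce algebra_simps)
      also have "\<dots> \<in> I" by (rule is_idealD(6)[OF I u(3) is_idealD(3)[OF I eig]])
      finally have "p' \<in> loc I y" using u(1) by (auto simp: loc_def)
      then have "p' + mconst e * g \<in> adjoin (loc I y) g" by (rule adjoinI)
      then show "p \<in> adjoin (loc I y) g" by (simp add: p'_def)
    next
      have J: "is_ideal (loc ?J y)" by (rule is_ideal_loc[OF comp_series_ideal[OF step.hyps(4)]])
      fix p assume "p \<in> adjoin (loc I y) g"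
      then obtain q c where p: "p = q + mconst c * g" "q \<in> loc I y" by (auto simp: adjoin_def)
      have "q \<in> loc ?J y" using p(2) loc_mono[OF subset_adjoin] by blast
      moreover have "g \<in> loc ?J y" using gen_in_adjoin[OF I] loc_superset by blast
      ultimately show "p \<in> loc ?J y" unfolding p by (intro is_idealD(2)[OF J] is_idealD(3)[OF J])
    qed
    have "codim (loc I y) (Suc (count_list ys y))"
      by (rule codim_adjoin[OF is_ideal_loc[OF I] gn]) (use step.IH eq in simp)
    moreover have "(mvar i - mconst (y $ i)) ^ Suc (count_list ys y) \<in> loc I y" for i
    proof -
      have L: "is_ideal (loc I y)" by (rule is_ideal_loc[OF I])
      have "(mvar i - mconst (y $ i)) ^ count_list ys y \<in> adjoin (loc I y) g" using step.IH eq by simp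
      then obtain q c where q: "(mvar i - mconst (y $ i)) ^ count_list ys y = q + mconst c * g" "q \<in> loc I y"
        by (auto simp: adjoin_def)
      have "(mvar i - mconst (y $ i)) * g \<in> loc I y" using step.hyps(3)[of i] True loc_superset by blast
      then have "(mvar i - mconst (y $ i)) * q + mconst c * ((mvar i - mconst (y $ i)) * g) \<in> loc I y"
        by (rule is_idealD(2)[OF L is_idealD(3)[OF L q(2)] is_idealD(3)[OF L]])
      moreover have "(mvar i - mconst (y $ i)) ^ Suc (count_list ys y) =
          (mvar i - mconst (y $ i)) * q + mconst c * ((mvar i - mconst (y $ i)) * g)"
        by (simp only: power_Suc q(1) distrib_left mult.left_commute)
      ultimately show ?thesis by (simp only:)
    qed
    ultimately show ?thesis using True by simp
  next
    case False
    then obtain i where i: "y0 $ i \<noteq> y $ i" by (auto simp: vec_eq_iff)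
    \<comment> \<open>\<open>x_i - y0_i\<close> is a unit at \<open>y\<close> and multiplies
      \<open>g\<close> into \<open>I\<close>, so this step of the series disappears in the
      localization.\<close>
    have "g \<in> loc I y"
    proof (rule loc_cancel[of "mvar i - mconst (y0 $ i)"])
      show "(mvar i - mconst (y0 $ i)) * g \<in> loc I y" using step.hyps(3) loc_superset by blast
    qed (use i in simp)
    then have "?J \<subseteq> loc I y"
      unfolding adjoin_def using loc_superset[of I y] is_idealD(2,3)[OF is_ideal_loc[OF I, of y]] by blast
    then have "loc ?J y = loc I y"
      by (intro loc_eqI comp_series_ideal[OF step.hyps(4)] I order_trans[OF subset_adjoin loc_superset])
    then show ?thesis using step.IH False by simp
  qed
qed

section \<open>Systems with a pure power as leading form\<close>

abbreviation xmono :: "('n \<Rightarrow>\<^sub>0 nat) \<Rightarrow> 'n mpoly" where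
  "xmono m \<equiv> Poly_Mapping.single m 1"

lemma mdeg_add: "mdeg (a + b) = mdeg a + mdeg b"
  by (simp add: mdeg_def lookup_add sum.distrib)

lemma mdeg_single [simp]: "mdeg (Poly_Mapping.single i k) = k"
  by (simp add: mdeg_def lookup_single when_def)

lemma lookup_le_mdeg: "lookup m i \<le> mdeg m"
  unfolding mdeg_def by (rule member_le_sum) auto

lemma finite_lookup_le: "finite {m::'n::finite \<Rightarrow>\<^sub>0 nat. \<forall>i. lookup m i \<le> k}"
proof (rule finite_imageD)
  show "inj_on lookup {m::'n \<Rightarrow>\<^sub>0 nat. \<forall>i. lookup m i \<le> k}"
    by (rule inj_onI, rule poly_mapping_eqI, drule fun_cong, assumption)
  have "lookup ` {m::'n \<Rightarrow>\<^sub>0 nat. \<forall>i. lookup m i \<le> k} \<subseteq> Pi\<^sub>E UNIV (\<lambda>_. {..k})" by auto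
  then show "finite (lookup ` {m::'n \<Rightarrow>\<^sub>0 nat. \<forall>i. lookup m i \<le> k})"
    by (rule finite_subset) (auto intro: finite_PiE)
qed

lemma finite_mdeg_less: "finite {m::'n::finite \<Rightarrow>\<^sub>0 nat. mdeg m < k}"
  by (rule finite_subset[OF _ finite_lookup_le[of k]]) (auto intro: order_trans[OF lookup_le_mdeg])

lemma split_single: "k \<le> lookup b i \<Longrightarrow> Poly_Mapping.single i k + (b - Poly_Mapping.single i k) = (b :: 'n \<Rightarrow>\<^sub>0 nat)"
  by (rule poly_mapping_eqI) (auto simp: lookup_add lookup_minus lookup_single when_def)

lemma mdeg_split: "k \<le> lookup b i \<Longrightarrow> mdeg b = k + mdeg (b - Poly_Mapping.single i k)"
  using mdeg_add[of "Poly_Mapping.single i k" "b - Poly_Mapping.single i k"] split_single[of k b i] by simp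

lemma xmono_add: "xmono (a + b) = xmono a * xmono b"
  by (simp add: mult_single)

lemma mvar_power: "mvar i ^ k = xmono (Poly_Mapping.single i k)"
proof (induction k)
  case (Suc k)
  have "Poly_Mapping.single i (Suc k) = Poly_Mapping.single i 1 + Poly_Mapping.single i k"
    by (simp flip: single_add)
  then show ?case using Suc by (simp only: power_Suc mvar_def mult_single) simp
qed simp

definition monic :: "nat \<Rightarrow> ('n::finite) system \<Rightarrow> 'n system" where
  "monic N R = (\<chi> i. mvar i ^ N + R $ i)"

definition lowdeg :: "nat \<Rightarrow> ('n::finite) system \<Rightarrow> bool" where
  "lowdeg N R \<longleftrightarrow> (\<forall>i. \<forall>m\<in>keys (R $ i). mdeg m < N)"

text \<open>Division by the \<open>monic\<close> system: a factor \<open>x_i ^ N\<close> is replaced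
  by \<open>- R $ i\<close>. The sum runs over all monomials of degree below \<open>N\<close> and
  not over the keys of \<open>R $ i\<close>, so the degree drops for every \<open>R\<close>, and
  \<open>R\<close> enters only through its coefficients.\<close>

function nf :: "nat \<Rightarrow> ('n::finite) system \<Rightarrow> ('n \<Rightarrow>\<^sub>0 nat) \<Rightarrow> 'n mpoly" where
  "nf N R b = (if \<exists>i. N \<le> lookup b i
     then - (\<Sum>m\<in>{m. mdeg m < N}. mconst (lookup (R $ (SOME i. N \<le> lookup b i)) m) *
        nf N R (m + (b - Poly_Mapping.single (SOME i. N \<le> lookup b i) N)))
     else xmono b)"
  by auto
termination
proof (relation "Wellfounded.measure (\<lambda>(N, R, b). mdeg b)")
  fix N R and b m :: "'n::finite \<Rightarrow>\<^sub>0 nat"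
  assume "\<exists>i. N \<le> lookup b i" and m: "m \<in> {m. mdeg m < N}"
  then have "N \<le> lookup b (SOME i. N \<le> lookup b i)" by (rule_tac someI_ex)
  from mdeg_split[OF this] m
  show "((N, R, m + (b - Poly_Mapping.single (SOME i. N \<le> lookup b i) N)), N, R, b) \<in> Wellfounded.measure (\<lambda>(N, R, b). mdeg b)"
    by (simp add: mdeg_add)
qed simp

declare nf.simps [simp del]

lemma nf_reduced: "(\<And>i. lookup b i < N) \<Longrightarrow> nf N R b = xmono b"
  by (subst nf.simps) (meson not_le)

lemma nf_reducible:
  fixes b :: "'n::finite \<Rightarrow>\<^sub>0 nat"
  assumes "N \<le> lookup b i"
  obtains j c where "b = Poly_Mapping.single j N + c"
    "nf N R b = - (\<Sum>m\<in>{m. mdeg m < N}. mconst (lookup (R $ j) m) * nf N R (m + c))"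
proof -
  define j where "j = (SOME i. N \<le> lookup b i)"
  have "\<exists>i. N \<le> lookup b i" using assms by blast
  then have "N \<le> lookup b j" and "nf N R b = - (\<Sum>m\<in>{m. mdeg m < N}. mconst (lookup (R $ j) m) *
        nf N R (m + (b - Poly_Mapping.single j N)))"
    unfolding j_def by (rule someI_ex, subst nf.simps) simp
  then show ?thesis using that[of j "b - Poly_Mapping.single j N"] split_single[of N b j] by simp
qed

text \<open>The two ways of reducing a monomial divisible by two leading monomials agree, because
  the leading monomials are coprime.\<close>

lemma nf_lead:
  fixes b :: "'n::finite \<Rightarrow>\<^sub>0 nat"
  shows "nf N R (Poly_Mapping.single i N + b) =
    - (\<Sum>m\<in>{m. mdeg m < N}. mconst (lookup (R $ i) m) * nf N R (m + b))"
proof (induction "mdeg b" arbitrary: b i rule: less_induct)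
  case less
  let ?S = "{m :: 'n \<Rightarrow>\<^sub>0 nat. mdeg m < N}"
  have "N \<le> lookup (Poly_Mapping.single i N + b) i" by (simp add: lookup_add)
  then obtain j c where c: "Poly_Mapping.single i N + b = Poly_Mapping.single j N + c"
    and nf: "nf N R (Poly_Mapping.single i N + b) = - (\<Sum>m\<in>?S. mconst (lookup (R $ j) m) * nf N R (m + c))"
    by (rule nf_reducible)
  show ?case
  proof (cases "j = i")
    case True
    then show ?thesis using nf c by simp
  next
    case False
    have "lookup (Poly_Mapping.single i N + b) j = lookup (Poly_Mapping.single j N + c) j" using c by simp
    then have "N \<le> lookup b j" using False by (simp add: lookup_add lookup_single)
    \<comment> \<open>\<open>e\<close> is the cofactor of both leading monomials. Reducing by
      \<open>i\<close> and then \<open>j\<close>, or by \<open>j\<close> and then \<open>i\<close>,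
      gives the same double sum over normal forms of \<open>k + m + e\<close>.\<close>
    define e where "e = b - Poly_Mapping.single j N"
    have b: "b = Poly_Mapping.single j N + e" using split_single[OF \<open>N \<le> lookup b j\<close>] by (simp add: e_def)
    have ce: "c = Poly_Mapping.single i N + e"
      using c unfolding b by (metis add.left_commute add_left_cancel)
    have smaller: "mdeg (m + e) < mdeg b" if "m \<in> ?S" for m
      using that by (simp add: b mdeg_add)
    have "(\<Sum>m\<in>?S. mconst (lookup (R $ j) m) * nf N R (m + c)) =
        - (\<Sum>m\<in>?S. \<Sum>k\<in>?S. mconst (lookup (R $ j) m) * (mconst (lookup (R $ i) k) * nf N R (k + (m + e))))"
    proof -
      have "nf N R (m + c) = - (\<Sum>k\<in>?S. mconst (lookup (R $ i) k) * nf N R (k + (m + e)))" if "m \<in> ?S" for m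
        using less[OF smaller[OF that], of i] by (simp add: ce add.left_commute)
      then show ?thesis by (simp add: sum_distrib_left sum_negf)
    qed
    moreover have "(\<Sum>k\<in>?S. mconst (lookup (R $ i) k) * nf N R (k + b)) =
        - (\<Sum>k\<in>?S. \<Sum>m\<in>?S. mconst (lookup (R $ i) k) * (mconst (lookup (R $ j) m) * nf N R (m + (k + e))))"
    proof -
      have "nf N R (k + b) = - (\<Sum>m\<in>?S. mconst (lookup (R $ j) m) * nf N R (m + (k + e)))" if "k \<in> ?S" for k
        using less[OF smaller[OF that], of j] by (simp add: b add.left_commute)
      then show ?thesis by (simp add: sum_distrib_left sum_negf)
    qed
    moreover have "(\<Sum>m\<in>?S. \<Sum>k\<in>?S. mconst (lookup (R $ j) m) * (mconst (lookup (R $ i) k) * nf N R (k + (m + e))))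
       = (\<Sum>k\<in>?S. \<Sum>m\<in>?S. mconst (lookup (R $ i) k) * (mconst (lookup (R $ j) m) * nf N R (m + (k + e))))"
      by (subst sum.swap) (simp add: mult.left_commute add.left_commute)
    ultimately show ?thesis using nf by simp
  qed
qed

definition box :: "nat \<Rightarrow> ('n::finite \<Rightarrow>\<^sub>0 nat) set" where
  "box N = {a. \<forall>i. lookup a i < N}"

lemma finite_box: "finite (box N)"
  unfolding box_def by (rule finite_subset[OF _ finite_lookup_le[of N]]) (auto intro: less_imp_le)

lemma keys_nf: "keys (nf N R b) \<subseteq> box N"
proof (induction "mdeg b" arbitrary: b rule: less_induct)
  case less
  show ?case
  proof (cases "\<exists>i. N \<le> lookup b i")
    case False
    then show ?thesis by (subst nf_reduced) (auto simp: box_def not_le)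
  next
    case True
    then obtain i where "N \<le> lookup b i" by blast
    then obtain j c where b: "b = Poly_Mapping.single j N + c"
      and nf: "nf N R b = - (\<Sum>m\<in>{m. mdeg m < N}. mconst (lookup (R $ j) m) * nf N R (m + c))"
      by (rule nf_reducible)
    have "keys (mconst (lookup (R $ j) m) * nf N R (m + c)) \<subseteq> box N" if "mdeg m < N" for m
      using keys_mconst_mult less[of "m + c"] that by (fastforce simp: b mdeg_add)
    then show ?thesis unfolding nf keys_minus
      by (intro order_trans[OF keys_sum]) auto
  qed
qed

section \<open>Normal forms of polynomials and their traces\<close>

definition NF :: "nat \<Rightarrow> ('n::finite) system \<Rightarrow> 'n mpoly \<Rightarrow> 'n mpoly" where
  "NF N R p = (\<Sum>m\<in>keys p. mconst (lookup p m) * nf N R m)"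

lemma NF_superset:
  assumes "finite S" "keys p \<subseteq> S"
  shows "NF N R p = (\<Sum>m\<in>S. mconst (lookup p m) * nf N R m)"
  unfolding NF_def using assms by (intro sum.mono_neutral_left) (auto simp: in_keys_iff)

lemma NF_add: "NF N R (p + q) = NF N R p + NF N R q"
proof -
  have "NF N R r = (\<Sum>m\<in>keys p \<union> keys q. mconst (lookup r m) * nf N R m)"
    if "r = p \<or> r = q \<or> r = p + q" for r
    using that Poly_Mapping.keys_add[of p q] by (intro NF_superset) auto
  then show ?thesis by (simp add: lookup_add mconst_add distrib_right sum.distrib)
qed

lemma NF_scale: "NF N R (mconst c * p) = mconst c * NF N R p"
  by (subst NF_superset[OF finite_keys keys_mconst_mult])
     (simp add: NF_def sum_distrib_left mconst_mult mult.assoc)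

lemma NF_0: "NF N R 0 = 0" by (simp add: NF_def)

lemma NF_sum: "NF N R (sum f A) = (\<Sum>a\<in>A. NF N R (f a))"
  by (induction A rule: infinite_finite_induct) (auto simp: NF_add NF_0)

lemma NF_xmono: "NF N R (xmono m) = nf N R m" by (simp add: NF_def)

lemma xmono_mult_expand:
  fixes p :: "('n::finite) mpoly"
  assumes "finite S" "keys p \<subseteq> S"
  shows "xmono b * p = (\<Sum>m\<in>S. mconst (lookup p m) * xmono (m + b))"
proof -
  have "p = (\<Sum>m\<in>S. mconst (lookup p m) * xmono m)"
    using mpoly_expand[OF assms] by (simp only: single_eq_mconst[symmetric])
  then have "xmono b * p = xmono b * (\<Sum>m\<in>S. mconst (lookup p m) * xmono m)" by (rule arg_cong)
  also have "\<dots> = (\<Sum>m\<in>S. mconst (lookup p m) * xmono (m + b))"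
    unfolding sum_distrib_left by (rule sum.cong[OF refl]) (simp only: xmono_add mult_ac)
  finally show ?thesis .
qed

lemma keys_lowdeg: "lowdeg N R \<Longrightarrow> keys (R $ i) \<subseteq> {m. mdeg m < N}"
  by (auto simp: lowdeg_def)

lemma NF_xmono_monic:
  fixes b :: "'n::finite \<Rightarrow>\<^sub>0 nat"
  assumes "lowdeg N R"
  shows "NF N R (xmono b * monic N R $ i) = 0"
proof -
  have e: "xmono b * monic N R $ i = xmono (Poly_Mapping.single i N + b) + xmono b * R $ i"
    by (simp add: monic_def mvar_power xmono_add distrib_left mult.commute)
  show ?thesis
    unfolding e by (simp add: NF_add xmono_mult_expand[OF finite_mdeg_less keys_lowdeg[OF assms]] NF_sum NF_scale NF_xmono nf_lead)
qed

lemma mpoly_expand_xmono: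
  assumes "finite S" "keys p \<subseteq> S"
  shows "(\<Sum>m\<in>S. mconst (lookup p m) * xmono m) = p"
  using mpoly_expand[OF assms] by (simp only: single_eq_mconst[symmetric])

lemma NF_ideal:
  fixes R :: "('n::finite) system"
  assumes "lowdeg N R" "p \<in> sys_ideal (monic N R)"
  shows "NF N R p = 0"
proof -
  obtain a where p: "p = (\<Sum>i\<in>UNIV. a i * monic N R $ i)" using assms(2) by (auto simp: sys_ideal_def)
  have "NF N R (a i * monic N R $ i) = 0" for i
  proof -
    have "a i * monic N R $ i = (\<Sum>m\<in>keys (a i). mconst (lookup (a i) m) * xmono m) * monic N R $ i"
      by (simp only: mpoly_expand_xmono[OF finite_keys order_refl])
    also have "\<dots> = (\<Sum>m\<in>keys (a i). mconst (lookup (a i) m) * (xmono m * monic N R $ i))"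
      by (simp only: sum_distrib_right mult.assoc)
    finally show ?thesis by (simp only: NF_sum NF_scale NF_xmono_monic[OF assms(1)] mult_zero_right sum.neutral_const)
  qed
  then show ?thesis by (simp add: p NF_sum)
qed

lemma NF_congruent:
  fixes R :: "('n::finite) system"
  assumes "lowdeg N R"
  shows "p - NF N R p \<in> sys_ideal (monic N R)"
proof -
  note I = is_ideal_sys_ideal[of "monic N R"]
  have mono: "xmono b - nf N R b \<in> sys_ideal (monic N R)" for b
  proof (induction "mdeg b" arbitrary: b rule: less_induct)
    case less
    show ?case
    proof (cases "\<exists>i. N \<le> lookup b i")
      case False
      then show ?thesis by (subst nf_reduced) (auto simp: not_le is_idealD[OF I])
    next
      case True
      then obtain i where "N \<le> lookup b i" by blast
      then obtain j c where b: "b = Poly_Mapping.single j N + c"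
        and nf: "nf N R b = - (\<Sum>m\<in>{m. mdeg m < N}. mconst (lookup (R $ j) m) * nf N R (m + c))"
        by (rule nf_reducible)
      have "xmono b = xmono c * monic N R $ j - xmono c * R $ j"
        by (simp add: b monic_def mvar_power xmono_add distrib_left mult.commute)
      also have "xmono c * R $ j = (\<Sum>m\<in>{m. mdeg m < N}. mconst (lookup (R $ j) m) * xmono (m + c))"
        by (rule xmono_mult_expand[OF finite_mdeg_less keys_lowdeg[OF assms]])
      finally have "xmono b - nf N R b = xmono c * monic N R $ j -
          (\<Sum>m\<in>{m. mdeg m < N}. mconst (lookup (R $ j) m) * (xmono (m + c) - nf N R (m + c)))"
        by (simp add: nf right_diff_distrib sum_subtractf)
      also have "\<dots> \<in> sys_ideal (monic N R)"
      proof (rule is_idealD(6)[OF I is_idealD(3)[OF I sys_ideal_gen]], rule ideal_sum[OF I], rule is_idealD(3)[OF I])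
        fix m :: "'n \<Rightarrow>\<^sub>0 nat" assume "m \<in> {m. mdeg m < N}"
        then show "xmono (m + c) - nf N R (m + c) \<in> sys_ideal (monic N R)"
          by (intro less) (simp add: b mdeg_add)
      qed
      finally show ?thesis .
    qed
  qed
  have "p - NF N R p = (\<Sum>m\<in>keys p. mconst (lookup p m) * (xmono m - nf N R m))"
    by (simp only: right_diff_distrib sum_subtractf NF_def mpoly_expand_xmono[OF finite_keys order_refl])
  also have "\<dots> \<in> sys_ideal (monic N R)"
    by (intro ideal_sum[OF I] is_idealD(3)[OF I] mono)
  finally show ?thesis .
qed

lemma keys_NF: "keys (NF N R p) \<subseteq> box N"
  unfolding NF_def using keys_mconst_mult keys_nf by (intro order_trans[OF keys_sum]) fastforce

text \<open>The basis is the same set of monomials for all \<open>R\<close> of low degree, which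
  makes traces for different \<open>R\<close> comparable.\<close>

lemma dual_monic:
  fixes R :: "('n::finite) system"
  assumes "lowdeg N R"
  shows "dual (sys_ideal (monic N R)) (box N) (\<lambda>a p. lookup (NF N R p) a) xmono"
  unfolding dual_def
proof (intro conjI ballI allI)
  show "finite (box N)" by (rule finite_box)
  show "linfun (\<lambda>p. lookup (NF N R p) a)" for a
    by (simp add: linfun_def NF_add NF_scale lookup_add)
  show "lookup (NF N R p) a = 0" if "p \<in> sys_ideal (monic N R)" for a p
    by (simp add: NF_ideal[OF assms that])
  show "lookup (NF N R (xmono b)) a = (if a = b then 1 else 0)" if "b \<in> box N" for a b
  proof -
    have "nf N R b = xmono b" using that by (intro nf_reduced) (simp add: box_def)
    then show ?thesis by (simp add: NF_xmono lookup_single when_def)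
  qed
  show "p - (\<Sum>a\<in>box N. mconst (lookup (NF N R p) a) * xmono a) \<in> sys_ideal (monic N R)" for p
    using NF_congruent[OF assms] by (simp only: mpoly_expand_xmono[OF finite_box keys_NF])
qed

definition tr :: "nat \<Rightarrow> ('n::finite) system \<Rightarrow> 'n mpoly \<Rightarrow> complex" where
  "tr N R p = (\<Sum>a\<in>box N. lookup (NF N R (p * xmono a)) a)"

text \<open>By the recursion, the coefficients of a normal form are polynomials in the coefficients
  of \<open>R\<close>.\<close>

lemma continuous_nf:
  fixes R :: "'a::topological_space \<Rightarrow> ('n::finite) system"
  assumes "\<And>i m. continuous_on S (\<lambda>t. lookup (R t $ i) m)"
  shows "continuous_on S (\<lambda>t. lookup (nf N (R t) b) a)"
proof (induction "mdeg b" arbitrary: b rule: less_induct)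
  case less
  show ?case
  proof (cases "\<exists>i. N \<le> lookup b i")
    case False
    then show ?thesis by (subst nf_reduced) (auto simp: not_le intro: continuous_intros)
  next
    case True
    define i where "i = (SOME i. N \<le> lookup b i)"
    have i: "N \<le> lookup b i" unfolding i_def by (rule someI_ex[OF True])
    have "lookup (nf N (R t) b) a = - (\<Sum>m\<in>{m. mdeg m < N}. lookup (R t $ i) m *
        lookup (nf N (R t) (m + (b - Poly_Mapping.single i N))) a)" for t
      using True by (subst nf.simps) (simp add: i_def lookup_sum)
    moreover have "mdeg (m + (b - Poly_Mapping.single i N)) < mdeg b" if "m \<in> {m. mdeg m < N}" for m
      using mdeg_split[OF i] that by (simp add: mdeg_add)
    then have "continuous_on S (\<lambda>t. - (\<Sum>m\<in>{m. mdeg m < N}. lookup (R t $ i) m *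
        lookup (nf N (R t) (m + (b - Poly_Mapping.single i N))) a))"
      by (intro continuous_on_minus continuous_on_sum continuous_on_mult assms less)
    ultimately show ?thesis by presburger
  qed
qed

lemma continuous_tr:
  fixes R :: "'a::topological_space \<Rightarrow> ('n::finite) system"
  assumes "\<And>i m. continuous_on S (\<lambda>t. lookup (R t $ i) m)"
  shows "continuous_on S (\<lambda>t. tr N (R t) p)"
  by (simp add: tr_def NF_def lookup_sum continuous_nf[OF assms] continuous_intros)

text \<open>All zeros of \<open>G\<close>, repeated according to multiplicity.\<close>

definition zero_list :: "('n::finite) system \<Rightarrow> 'n point list \<Rightarrow> bool" where
  "zero_list G ys \<longleftrightarrow> (\<forall>y. codim (loc (sys_ideal G) y) (count_list ys y) \<and>
     (\<forall>i. (mvar i - mconst (y $ i)) ^ count_list ys y \<in> loc (sys_ideal G) y))"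

text \<open>Count 0 means codimension 0, so the localized ideal is everything, which happens exactly
  at the points that are not zeros.\<close>

lemma set_zero_list:
  assumes "zero_list G ys"
  shows "set ys = {y. sys_eval G y = 0}"
proof -
  have "y \<in> set ys \<longleftrightarrow> sys_eval G y = 0" for y
  proof -
    have c: "codim (loc (sys_ideal G) y) (count_list ys y)" using assms by (simp add: zero_list_def)
    have i: "is_ideal (loc (sys_ideal G) y)" by (rule is_ideal_loc[OF is_ideal_sys_ideal])
    have "y \<notin> set ys \<longleftrightarrow> count_list ys y = 0" by (simp add: count_list_0_iff)
    also have "\<dots> \<longleftrightarrow> loc (sys_ideal G) y = UNIV"
      using c i by (metis codim_0_iff codim_UNIV codim_unique)
    also have "\<dots> \<longleftrightarrow> sys_eval G y \<noteq> 0"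
      using loc_sys_nonzero loc_sys_zero by (metis UNIV_I)
    finally show ?thesis by blast
  qed
  then show ?thesis by blast
qed

text \<open>One trace, two bases: the monomial basis makes it continuous in \<open>R\<close>, the
  basis of the composition series makes it a sum of values at the zeros.\<close>

theorem monic_zero_list:
  fixes R :: "('n::finite) system"
  assumes "lowdeg N R"
  shows "\<exists>ys. zero_list (monic N R) ys \<and> (\<forall>p. tr N R p = (\<Sum>y\<leftarrow>ys. meval p y))"
proof -
  let ?I = "sys_ideal (monic N R)"
  note d = dual_monic[OF assms]
  obtain ys where ys: "comp_series ?I ys"
    using comp_series_exists[OF is_ideal_sys_ideal dual_imp_fdim[OF d]] by blast
  obtain \<phi> Y where e: "dual ?I {..<length ys} \<phi> Y" and
    t: "\<And>p. (\<Sum>k<length ys. \<phi> k (p * Y k)) = (\<Sum>y\<leftarrow>ys. meval p y)"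
    using comp_series_dual[OF ys] by blast
  have "tr N R p = (\<Sum>y\<leftarrow>ys. meval p y)" for p
    unfolding tr_def using dual_trace_unique[OF is_ideal_sys_ideal d e, of p] t[of p] by simp
  then show ?thesis using comp_series_loc[OF ys] unfolding zero_list_def by blast
qed

lemma zero_list_unique_count:
  assumes "zero_list G ys" "zero_list G zs"
  shows "count_list ys y = count_list zs y"
  using assms codim_unique[OF is_ideal_loc[OF is_ideal_sys_ideal]] unfolding zero_list_def by blast

section \<open>Conservation of the number of zeros\<close>

lemma sys_eval_add: "sys_eval (F + G) x = sys_eval F x + sys_eval G x"
  by (simp add: vec_eq_iff)

definition cscale :: "complex \<Rightarrow> 'n system \<Rightarrow> ('n::finite) system" where
  "cscale c F = (\<chi> i. mconst c * F $ i)"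

lemma sys_eval_cscale_real: "sys_eval (cscale (complex_of_real t) F) x = t *\<^sub>R sys_eval F x"
  by (simp only: vec_eq_iff sys_eval_nth cscale_def vec_lambda_beta meval_mult meval_mconst vector_scaleR_component)
    (simp add: scaleR_conv_of_real)

lemma lookup_cscale [simp]: "lookup (cscale c F $ i) m = c * lookup (F $ i) m"
  by (simp add: cscale_def)

lemma lowdeg_add: "lowdeg N F \<Longrightarrow> lowdeg N G \<Longrightarrow> lowdeg N (F + G)"
  unfolding lowdeg_def using keys_add by fastforce

lemma lowdeg_cscale: "lowdeg N F \<Longrightarrow> lowdeg N (cscale c F)"
  unfolding lowdeg_def cscale_def using keys_mconst_mult by fastforce

lemma length_filter_zero_list:
  assumes "zero_list G ys" "zero_list G zs"
  shows "length (filter P ys) = length (filter P zs)"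
proof -
  have "mset ys = mset zs"
    by (rule multiset_eqI) (simp add: count_mset zero_list_unique_count[OF assms])
  then have "size (filter_mset P (mset ys)) = size (filter_mset P (mset zs))" by simp
  then show ?thesis by (simp flip: mset_filter)
qed

lemma norm_le_sum_vec:
  fixes x :: "complex^'n::finite"
  shows "norm x \<le> (\<Sum>i\<in>UNIV. norm (x $ i))"
  by (simp add: norm_vec_def L2_set_le_sum)

text \<open>At a coordinate of maximal modulus \<open>r > 1\<close>, \<open>r ^ N\<close> is the
  modulus of \<open>R $ i\<close> at \<open>y\<close>, hence at most a constant times
  \<open>r ^ (N - 1)\<close>. The bound depends on \<open>R\<close> only through \<open>C\<close>,
  so it is uniform along a homotopy.\<close>

lemma monic_zeros_bounded:
  fixes R :: "('n::finite) system"
  assumes N: "0 < N" and low: "lowdeg N R"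
    and C: "\<And>i m. norm (lookup (R $ i) m) \<le> C"
    and zero: "sys_eval (monic N R) y = 0"
  shows "norm y \<le> real CARD('n) * max 1 (C * real (card {m :: 'n \<Rightarrow>\<^sub>0 nat. mdeg m < N}))"
proof -
  let ?S = "{m :: 'n \<Rightarrow>\<^sub>0 nat. mdeg m < N}"
  define r where "r = Max (range (\<lambda>i. norm (y $ i)))"
  have le: "norm (y $ i) \<le> r" for i unfolding r_def by (rule Max_ge) auto
  have "r \<in> range (\<lambda>i. norm (y $ i))" unfolding r_def by (rule Max_in) auto
  then obtain i where i: "r = norm (y $ i)" by blast
  have "r \<le> max 1 (C * real (card ?S))"
  proof (cases "r \<le> 1")
    case False
    then have r1: "1 \<le> r" by simp
    have "y $ i ^ N + meval (R $ i) y = 0" using zero by (simp add: vec_eq_iff monic_def)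
    then have "y $ i ^ N = - meval (R $ i) y" by (simp add: eq_neg_iff_add_eq_0)
    then have "r ^ N = norm (meval (R $ i) y)" unfolding i by (metis norm_power norm_minus_cancel)
    also have "meval (R $ i) y = (\<Sum>m\<in>?S. lookup (R $ i) m * (\<Prod>j\<in>UNIV. (y $ j) ^ lookup m j))"
      by (rule meval_superset[OF finite_mdeg_less keys_lowdeg[OF low]])
    also have "norm \<dots> \<le> (\<Sum>m\<in>?S. C * r ^ (N - 1))"
    proof (rule order_trans[OF norm_sum sum_mono])
      fix m assume m: "m \<in> ?S"
      have "norm (\<Prod>j\<in>UNIV. (y $ j) ^ lookup m j) = (\<Prod>j\<in>UNIV. norm (y $ j) ^ lookup m j)"
        by (simp add: norm_power flip: prod_norm)
      also have "\<dots> \<le> (\<Prod>j\<in>UNIV. r ^ lookup m j)"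
        by (intro prod_mono conjI power_mono le) auto
      also have "\<dots> = r ^ mdeg m" by (simp add: mdeg_def power_sum)
      also have "\<dots> \<le> r ^ (N - 1)" using m r1 by (intro power_increasing) auto
      finally have "norm (\<Prod>j\<in>UNIV. (y $ j) ^ lookup m j) \<le> r ^ (N - 1)" .
      then show "norm (lookup (R $ i) m * (\<Prod>j\<in>UNIV. (y $ j) ^ lookup m j)) \<le> C * r ^ (N - 1)"
        unfolding norm_mult using C[of i m] by (intro mult_mono) (auto intro: order_trans[OF norm_ge_zero])
    qed
    also have "\<dots> = (C * real (card ?S)) * r ^ (N - 1)" by simp
    finally have "r * r ^ (N - 1) \<le> (C * real (card ?S)) * r ^ (N - 1)"
      using N by (simp add: power_eq_if)
    then show ?thesis using r1 by (simp add: mult_le_cancel_right)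
  qed simp
  then have "norm (y $ j) \<le> max 1 (C * real (card ?S))" for j using le[of j] by linarith
  then have "(\<Sum>j\<in>UNIV. norm (y $ j)) \<le> (\<Sum>j\<in>(UNIV::'n set). max 1 (C * real (card ?S)))"
    by (intro sum_mono)
  then show ?thesis using norm_le_sum_vec[of y] by simp
qed

lemma separating_poly:
  fixes a b :: "('n::finite) point"
  assumes "a \<noteq> b"
  shows "\<exists>p. meval p a = 1 \<and> meval p b = 0"
proof -
  obtain i where "a $ i \<noteq> b $ i" using assms by (auto simp: vec_eq_iff)
  then show ?thesis
    by (intro exI[of _ "mconst (inverse (a $ i - b $ i)) * (mvar i - mconst (b $ i))"]) auto
qed

text \<open>Lagrange interpolation: \<open>l a b\<close> is 1 at \<open>a\<close> and 0 at
  \<open>b\<close>.\<close>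

lemma interpolation:
  fixes Z :: "('n::finite) point set"
  assumes Z: "finite Z"
  shows "\<exists>p. \<forall>y\<in>Z. meval p y = (if y \<in> W then 1 else 0)"
proof -
  have "\<forall>a b :: 'n point. \<exists>p. a \<noteq> b \<longrightarrow> meval p a = 1 \<and> meval p b = 0"
    using separating_poly by blast
  then obtain l :: "'n point \<Rightarrow> 'n point \<Rightarrow> 'n mpoly"
    where l: "\<And>a b. a \<noteq> b \<Longrightarrow> meval (l a b) a = 1 \<and> meval (l a b) b = 0" by metis
  define p where "p = (\<Sum>a\<in>Z \<inter> W. \<Prod>b\<in>Z - {a}. l a b)"
  have "meval p y = (if y \<in> W then 1 else 0)" if "y \<in> Z" for y
  proof -
    have "(\<Prod>b\<in>Z - {a}. meval (l a b) y) = (if a = y then 1 else 0)" if "a \<in> Z" for a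
    proof (cases "a = y")
      case True
      have "meval (l y b) y = 1" if "b \<in> Z - {y}" for b using l[of y b] that by blast
      then show ?thesis using True by simp
    next
      case False
      then have "y \<in> Z - {a}" "meval (l a y) y = 0" using \<open>y \<in> Z\<close> l by auto
      then show ?thesis using False Z by (auto intro!: prod_zero)
    qed
    then have "meval p y = (\<Sum>a\<in>Z \<inter> W. if a = y then 1 else 0)" by (simp add: p_def)
    then show ?thesis using that Z by auto
  qed
  then show ?thesis by blast
qed

text \<open>The trace of the identity is the dimension, so all these systems with \<open>R\<close>
  of low degree have equally many zeros with multiplicity.\<close>

lemma tr_1:
  fixes R :: "('n::finite) system"
  shows "tr N R 1 = of_nat (card (box N :: ('n \<Rightarrow>\<^sub>0 nat) set))"
proof -
  have "lookup (NF N R (1 * xmono a)) a = 1" if "a \<in> box N" for a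
    using that by (simp add: NF_xmono nf_reduced box_def)
  then show ?thesis by (simp add: tr_def)
qed

text \<open>The number of zeros in \<open>W\<close> is locally constant in \<open>t\<close>: close
  to \<open>t0\<close>, the zeros stay close to those at \<open>t0\<close>, none of which is on the
  frontier, so a polynomial that interpolates the indicator of \<open>W\<close> at \<open>t0\<close>
  nearly does so at \<open>t\<close>. Its trace is continuous and close to the count.\<close>

theorem homotopy_count:
  fixes R :: "real \<Rightarrow> ('n::finite) system"
  assumes N: "0 < N" and low: "\<And>t. t \<in> {0..1} \<Longrightarrow> lowdeg N (R t)"
    and cont: "\<And>i m. continuous_on {0..1} (\<lambda>t. lookup (R t $ i) m)"
    and W: "open W" and nz: "\<And>t x. t \<in> {0..1} \<Longrightarrow> x \<in> frontier W \<Longrightarrow> sys_eval (monic N (R t)) x \<noteq> 0"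
    and ys: "zero_list (monic N (R 0)) ys" and zs: "zero_list (monic N (R 1)) zs"
  shows "length (filter (\<lambda>y. y \<in> W) ys) = length (filter (\<lambda>y. y \<in> W) zs)"
proof -
  let ?S = "{m :: 'n \<Rightarrow>\<^sub>0 nat. mdeg m < N}"
  have "\<forall>t\<in>{0..1}. \<exists>l. zero_list (monic N (R t)) l \<and> (\<forall>p. tr N (R t) p = (\<Sum>y\<leftarrow>l. meval p y))"
    using monic_zero_list[OF low] by blast
  from bchoice[OF this] obtain Y where Y: "\<forall>t\<in>{0..1}. zero_list (monic N (R t)) (Y t) \<and>
      (\<forall>p. tr N (R t) p = (\<Sum>y\<leftarrow>Y t. meval p y))" by (rule exE)
  have Yz: "zero_list (monic N (R t)) (Y t)" and Yt: "tr N (R t) p = (\<Sum>y\<leftarrow>Y t. meval p y)" if "t \<in> {0..1}" for t p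
    using Y that by blast+
  have Yset: "set (Y t) = {y. sys_eval (monic N (R t)) y = 0}" if "t \<in> {0..1}" for t
    by (rule set_zero_list[OF Yz[OF that]])
  define L where "L = card (box N :: ('n \<Rightarrow>\<^sub>0 nat) set)"
  have len: "length (Y t) = L" if "t \<in> {0..1}" for t
  proof -
    have "complex_of_nat L = of_nat (length (Y t))"
      using Yt[OF that, of 1] by (simp add: tr_1 L_def sum_list_triv)
    then show ?thesis using of_nat_eq_iff by metis
  qed
  define n where "n t = length (filter (\<lambda>y. y \<in> W) (Y t))" for t
  have "\<exists>C. \<forall>t\<in>{0..1}. \<forall>i m. norm (lookup (R t $ i) m) \<le> C"
  proof -
    have "\<exists>C. \<forall>t\<in>{0..1}. norm (lookup (R t $ i) m) \<le> C" for i m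
    proof -
      have "bounded ((\<lambda>t. lookup (R t $ i) m) ` {0..1})"
        by (intro compact_imp_bounded compact_continuous_image cont) auto
      then show ?thesis by (auto simp: bounded_iff)
    qed
    then obtain C where C: "\<And>i m t. t \<in> {0..1} \<Longrightarrow> norm (lookup (R t $ i) m) \<le> C i m" by metis
    define D where "D = (\<Sum>i\<in>UNIV. \<Sum>m\<in>?S. \<bar>C i m\<bar>)"
    have "norm (lookup (R t $ i) m) \<le> D" if t: "t \<in> {0..1}" for t i m
    proof (cases "m \<in> ?S")
      case True
      have "norm (lookup (R t $ i) m) \<le> \<bar>C i m\<bar>" using C[OF t, of i m] by linarith
      also have "\<dots> \<le> (\<Sum>m\<in>?S. \<bar>C i m\<bar>)" using True by (intro member_le_sum finite_mdeg_less) auto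
      also have "\<dots> \<le> D" unfolding D_def by (rule member_le_sum) (auto intro: sum_nonneg)
      finally show ?thesis .
    next
      case False
      then have "lookup (R t $ i) m = 0" using keys_lowdeg[OF low[OF t], of i] by (auto simp: in_keys_iff)
      then show ?thesis by (simp add: D_def sum_nonneg)
    qed
    then show ?thesis by blast
  qed
  then obtain C where C: "\<And>t i m. t \<in> {0..1} \<Longrightarrow> norm (lookup (R t $ i) m) \<le> C" by blast
  define B where "B = real CARD('n) * max 1 (C * real (card ?S))"
  have bd: "norm y \<le> B" if "t \<in> {0..1}" "y \<in> set (Y t)" for t y
    unfolding B_def using that Yset by (intro monic_zeros_bounded[OF N low C]) auto
  have ev: "meval (monic N (R t) $ i) y = (y $ i) ^ N + (\<Sum>m\<in>?S. lookup (R t $ i) m * (\<Prod>j\<in>UNIV. (y $ j) ^ lookup m j))"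
    if "t \<in> {0..1}" for t i y
    using meval_superset[OF finite_mdeg_less keys_lowdeg[OF low[OF that]], of i y] by (simp add: monic_def)

  \<comment> \<open>Otherwise there are bad zeros \<open>y k\<close> at parameters tending to
    \<open>t0\<close>. A subsequence converges to a zero at \<open>t0\<close>, which is off the
    frontier; there membership in \<open>W\<close> is eventually constant and \<open>p\<close> is
    continuous.\<close>
  have near: "\<exists>\<delta>>0. \<forall>t\<in>{0..1}. \<bar>t - t0\<bar> < \<delta> \<longrightarrow> (\<forall>y\<in>set (Y t). norm (meval p y - (if y \<in> W then 1 else 0)) < \<eta>)"
    if t0: "t0 \<in> {0..1}" and p: "\<And>y. y \<in> set (Y t0) \<Longrightarrow> meval p y = (if y \<in> W then 1 else 0)" and \<eta>: "\<eta> > 0"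
    for t0 p and \<eta> :: real
  proof (rule ccontr)
    assume neg: "\<not> ?thesis"
    have "\<exists>t y. t \<in> {0..1} \<and> \<bar>t - t0\<bar> < inverse (real (Suc k)) \<and> y \<in> set (Y t) \<and>
        \<eta> \<le> norm (meval p y - (if y \<in> W then 1 else 0))" for k
    proof -
      have "inverse (real (Suc k)) > 0" by simp
      then show ?thesis using neg by (meson not_less)
    qed
    then obtain s y where s: "\<And>k. s k \<in> {0..1}" "\<And>k. \<bar>s k - t0\<bar> < inverse (real (Suc k))"
      and y: "\<And>k. y k \<in> set (Y (s k))" "\<And>k. \<eta> \<le> norm (meval p (y k) - (if y k \<in> W then 1 else 0))"
      by metis
    have "y k \<in> cball 0 B" for k using bd[OF s(1) y(1)] by simp
    then obtain y0 r where r: "strict_mono r" "(y \<circ> r) \<longlonglongrightarrow> y0"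
      using compact_cball[of "0 :: 'n point" B] unfolding compact_def by metis
    have "(\<lambda>k. s k - t0) \<longlonglongrightarrow> 0"
      by (rule Lim_null_comparison[OF _ LIMSEQ_inverse_real_of_nat]) (use s(2) in \<open>auto intro!: always_eventually less_imp_le simp del: of_nat_Suc\<close>)
    then have "s \<longlonglongrightarrow> t0" by (rule LIM_zero_cancel)
    then have sr: "(s \<circ> r) \<longlonglongrightarrow> t0" by (rule LIMSEQ_subseq_LIMSEQ[OF _ r(1)])
    have lim: "(\<lambda>k. lookup (R ((s \<circ> r) k) $ i) m) \<longlonglongrightarrow> lookup (R t0 $ i) m" for i m
      by (rule continuous_on_tendsto_compose[OF cont sr t0]) (use s(1) in \<open>simp add: eventually_sequentially\<close>)
    have ylim: "(\<lambda>k. (y \<circ> r) k $ i) \<longlonglongrightarrow> y0 $ i" for i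
      by (rule tendsto_vec_nth[OF r(2)])
    have "sys_eval (monic N (R t0)) y0 = 0"
    proof -
      have "meval (monic N (R t0) $ i) y0 = 0" for i
      proof -
        have "(\<lambda>k. ((y \<circ> r) k $ i) ^ N + (\<Sum>m\<in>?S. lookup (R ((s \<circ> r) k) $ i) m * (\<Prod>j\<in>UNIV. ((y \<circ> r) k $ j) ^ lookup m j)))
          \<longlonglongrightarrow> (y0 $ i) ^ N + (\<Sum>m\<in>?S. lookup (R t0 $ i) m * (\<Prod>j\<in>UNIV. (y0 $ j) ^ lookup m j))"
          by (intro tendsto_add tendsto_power tendsto_sum tendsto_mult tendsto_prod lim ylim)
        moreover have "((y \<circ> r) k $ i) ^ N + (\<Sum>m\<in>?S. lookup (R ((s \<circ> r) k) $ i) m * (\<Prod>j\<in>UNIV. ((y \<circ> r) k $ j) ^ lookup m j)) = 0" for k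
        proof -
          have "sys_eval (monic N (R (s (r k)))) (y (r k)) = 0" using y(1)[of "r k"] Yset[OF s(1)] by blast
          then have "meval (monic N (R (s (r k))) $ i) (y (r k)) = 0" by (simp add: vec_eq_iff)
          then show ?thesis using ev[OF s(1)] by simp
        qed
        ultimately have "(\<lambda>k::nat. 0) \<longlonglongrightarrow> (y0 $ i) ^ N + (\<Sum>m\<in>?S. lookup (R t0 $ i) m * (\<Prod>j\<in>UNIV. (y0 $ j) ^ lookup m j))"
          by simp
        from LIMSEQ_unique[OF this tendsto_const] show ?thesis using ev[OF t0] by simp
      qed
      then show ?thesis by (simp add: vec_eq_iff)
    qed
    then have y0: "y0 \<in> set (Y t0)" using Yset[OF t0] by blast
    have "\<forall>\<^sub>F k in sequentially. ((y \<circ> r) k \<in> W) = (y0 \<in> W)"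
    proof (cases "y0 \<in> W")
      case True
      then show ?thesis using topological_tendstoD[OF r(2) W True] by simp
    next
      case False
      have "y0 \<notin> frontier W" using nz[OF t0] Yset[OF t0] y0 by blast
      then have "y0 \<in> - closure W" using False W by (simp add: frontier_def interior_open)
      then have "\<forall>\<^sub>F k in sequentially. (y \<circ> r) k \<in> - closure W"
        by (rule topological_tendstoD[OF r(2) open_Compl[OF closed_closure]])
      then show ?thesis by (rule eventually_mono) (use False closure_subset[of W] in blast)
    qed
    then have "\<forall>\<^sub>F k in sequentially. \<eta> \<le> norm (meval p ((y \<circ> r) k) - (if y0 \<in> W then 1 else 0))"
    proof (rule eventually_mono)
      fix k assume "((y \<circ> r) k \<in> W) = (y0 \<in> W)"
      then show "\<eta> \<le> norm (meval p ((y \<circ> r) k) - (if y0 \<in> W then 1 else 0))"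
        using y(2)[of "r k"] by simp
    qed
    moreover have "(\<lambda>k. norm (meval p ((y \<circ> r) k) - (if y0 \<in> W then 1 else 0))) \<longlonglongrightarrow> norm (meval p y0 - (if y0 \<in> W then 1 else 0))"
      by (intro tendsto_intros continuous_on_tendsto_compose[OF continuous_on_meval[of UNIV] r(2)]) auto
    ultimately have "\<eta> \<le> norm (meval p y0 - (if y0 \<in> W then 1 else 0))"
      by (intro tendsto_lowerbound) auto
    then show False using p[OF y0] \<eta> by simp
  qed

  have ntr: "norm (tr N (R t) p - of_nat (n t)) \<le> real L * \<eta>"
    if t: "t \<in> {0..1}" and "\<forall>y\<in>set (Y t). norm (meval p y - (if y \<in> W then 1 else 0)) < \<eta>" for t p \<eta>
  proof -
    have "norm ((\<Sum>y\<leftarrow>l. meval p y) - of_nat (length (filter (\<lambda>y. y \<in> W) l))) \<le> real (length l) * \<eta>"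
      if "\<forall>y\<in>set l. norm (meval p y - (if y \<in> W then 1 else 0)) < \<eta>" for l
      using that
    proof (induction l)
      case (Cons a l)
      let ?e = "meval p a - (if a \<in> W then 1 else 0)" and ?s = "(\<Sum>y\<leftarrow>l. meval p y) - of_nat (length (filter (\<lambda>y. y \<in> W) l))"
      have eq: "(\<Sum>y\<leftarrow>a#l. meval p y) - of_nat (length (filter (\<lambda>y. y \<in> W) (a#l))) = ?e + ?s" by simp
      have "norm ?e \<le> \<eta>" "norm ?s \<le> real (length l) * \<eta>" using Cons by (simp_all add: less_imp_le)
      then have "norm (?e + ?s) \<le> \<eta> + real (length l) * \<eta>" by (intro norm_triangle_le add_mono)
      then show ?case unfolding eq by (simp add: distrib_right)
    qed simp
    from this[OF that(2)] show ?thesis by (simp add: Yt[OF t] len[OF t] n_def)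
  qed

  have loc: "\<forall>\<^sub>F t in at t0 within {0..1}. n t0 = n t" if t0: "t0 \<in> {0..1}" for t0
  proof -
    obtain p where p: "\<forall>y\<in>set (Y t0). meval p y = (if y \<in> W then 1 else 0)"
      using interpolation[of "set (Y t0)" W] by blast
    \<comment> \<open>The errors of \<open>L\<close> zeros then add up to at most 1/4. Three errors
      of this size stay below 1, and natural numbers at distance below 1 coincide.\<close>
    define \<eta> where "\<eta> = 1 / (4 * (real L + 1))"
    have \<eta>: "\<eta> > 0" "real L * \<eta> \<le> 1/4" by (auto simp: \<eta>_def field_simps)
    obtain \<delta> where \<delta>: "\<delta> > 0" "\<And>t. t \<in> {0..1} \<Longrightarrow> \<bar>t - t0\<bar> < \<delta> \<Longrightarrow> \<forall>y\<in>set (Y t). norm (meval p y - (if y \<in> W then 1 else 0)) < \<eta>"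
      using near[OF t0 _ \<eta>(1), of p] p by blast
    have "((\<lambda>t. tr N (R t) p) \<longlongrightarrow> tr N (R t0) p) (at t0 within {0..1})"
      using continuous_tr[OF cont, where p = p and N = N] t0 by (simp add: continuous_on_def)
    then have "\<forall>\<^sub>F t in at t0 within {0..1}. dist (tr N (R t) p) (tr N (R t0) p) < 1/4"
      by (rule tendstoD) simp
    moreover have "\<forall>\<^sub>F t in at t0 within {0..1}. t \<in> {0..1} \<and> \<bar>t - t0\<bar> < \<delta>"
      using \<delta>(1) by (auto simp: eventually_at dist_real_def)
    ultimately show ?thesis
    proof eventually_elim
      case (elim t)
      have "norm (tr N (R t) p - of_nat (n t)) \<le> 1/4"
        using ntr[OF _ \<delta>(2)] elim \<eta>(2) by force
      moreover have "norm (tr N (R t0) p - of_nat (n t0)) \<le> 1/4"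
        using ntr[OF t0 \<delta>(2)[OF t0]] \<delta>(1) \<eta>(2) by force
      moreover have "norm (tr N (R t) p - tr N (R t0) p) < 1/4" using elim by (simp add: dist_norm)
      ultimately have "norm (complex_of_nat (n t) - of_nat (n t0)) < 1"
        using norm_triangle_ineq4[of "tr N (R t) p - of_nat (n t0)" "tr N (R t) p - of_nat (n t)"]
          norm_triangle_ineq[of "tr N (R t) p - tr N (R t0) p" "tr N (R t0) p - of_nat (n t0)"] by simp
      then have "\<bar>real (n t) - real (n t0)\<bar> < 1"
        by (metis norm_of_real of_real_diff of_real_of_nat_eq real_norm_def)
      then show ?case by linarith
    qed
  qed
  have "n 0 = n 1"
    by (rule connected_local_const[of "{0..1::real}"]) (auto intro: loc)
  then show ?thesis
    using length_filter_zero_list[OF ys Yz] length_filter_zero_list[OF zs Yz] by (simp add: n_def)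
qed

lemma positive_lower_bound:
  fixes f :: "'a::topological_space \<Rightarrow> real"
  assumes "compact K" "continuous_on K f" "\<And>x. x \<in> K \<Longrightarrow> 0 < f x"
  shows "\<exists>\<delta>>0. \<forall>x\<in>K. \<delta> \<le> f x"
proof (cases "K = {}")
  case False
  then obtain x where "x \<in> K" "\<forall>y\<in>K. f x \<le> f y"
    using continuous_attains_inf[OF assms(1) _ assms(2)] by blast
  then show ?thesis using assms(3) by blast
qed (auto intro: exI[of _ 1])

lemma upper_bound:
  fixes f :: "'a::topological_space \<Rightarrow> real"
  assumes "compact K" "continuous_on K f"
  shows "\<exists>C\<ge>0. \<forall>x\<in>K. f x \<le> C"
proof (cases "K = {}")
  case False
  then obtain x where "x \<in> K" "\<forall>y\<in>K. f y \<le> f x"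
    using continuous_attains_sup[OF assms(1) _ assms(2)] by blast
  then have "\<forall>y\<in>K. f y \<le> \<bar>f x\<bar>" by fastforce
  then show ?thesis by (intro exI[of _ "\<bar>f x\<bar>"]) simp
qed auto

lemma sys_eval_monic: "sys_eval (monic N R) x = (\<chi> i. (x $ i) ^ N) + sys_eval R x"
  by (simp add: vec_eq_iff monic_def)

text \<open>On the frontier the combination \<open>E\<close> of \<open>F0\<close> and
  \<open>F1\<close> is bounded away from 0, while the leading powers and the terms from
  \<open>P0\<close> and \<open>P1\<close>, collected in \<open>Q\<close>, are bounded; a large
  \<open>\<beta>\<close> lets \<open>E\<close> win for all \<open>t\<close> at once.\<close>

theorem perturbed_count:
  fixes F0 F1 P0 P1 :: "('n::finite) system"
  assumes N: "0 < N" and low: "lowdeg N F0" "lowdeg N F1" "lowdeg N P0" "lowdeg N P1"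
    and W: "open W" "bounded W"
    and nz: "\<And>t x. t \<in> {0..1} \<Longrightarrow> x \<in> frontier W \<Longrightarrow> (1 - t) *\<^sub>R sys_eval F0 x + t *\<^sub>R sys_eval F1 x \<noteq> 0"
  shows "\<exists>\<beta>0. \<forall>\<beta>\<ge>\<beta>0. \<forall>ys zs. zero_list (monic N (P0 + cscale (complex_of_real \<beta>) F0)) ys \<longrightarrow>
     zero_list (monic N (P1 + cscale (complex_of_real \<beta>) F1)) zs \<longrightarrow>
     length (filter (\<lambda>y. y \<in> W) ys) = length (filter (\<lambda>y. y \<in> W) zs)"
proof -
  let ?K = "{0..1::real} \<times> frontier W"
  have K: "compact ?K" using W by (intro compact_Times compact_frontier_bounded) auto
  have c1: "continuous_on ?K (\<lambda>(t, x). sys_eval G x)" for G :: "'n system"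
    using continuous_on_compose2[OF continuous_on_sys_eval[of UNIV G] continuous_on_snd[OF continuous_on_id], of ?K]
    by (simp add: case_prod_beta)
  have c1': "continuous_on ?K (\<lambda>z. sys_eval G (snd z))" for G :: "'n system" using c1[of G] by (simp add: case_prod_beta)
  define E where "E z = (1 - fst z) *\<^sub>R sys_eval F0 (snd z) + fst z *\<^sub>R sys_eval F1 (snd z)" for z
  define Q where "Q z = (\<chi> i. (snd z $ i) ^ N) + (1 - fst z) *\<^sub>R sys_eval P0 (snd z) + fst z *\<^sub>R sys_eval P1 (snd z)" for z :: "real \<times> 'n point"
  have "continuous_on ?K (\<lambda>z. norm (E z))" unfolding E_def by (intro continuous_intros c1')
  moreover have "0 < norm (E z)" if "z \<in> ?K" for z using that nz unfolding E_def by (cases z) auto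
  ultimately obtain \<delta> where \<delta>: "\<delta> > 0" "\<forall>z\<in>?K. \<delta> \<le> norm (E z)"
    using positive_lower_bound[OF K] by blast
  have "continuous_on ?K (\<lambda>z. norm (Q z))" unfolding Q_def by (intro continuous_intros c1')
  from upper_bound[OF K this] obtain C where C: "C \<ge> 0" "\<forall>z\<in>?K. norm (Q z) \<le> C" by blast
  show ?thesis
  \<comment> \<open>This makes \<open>\<beta> * \<delta>\<close> at least \<open>C + 1\<close>, more
    than the bound \<open>C\<close> for \<open>Q\<close>.\<close>
  proof (intro exI[of _ "(C + 1) / \<delta>"] allI impI)
    fix \<beta> ys zs assume \<beta>: "(C + 1) / \<delta> \<le> \<beta>"
      and ys: "zero_list (monic N (P0 + cscale (complex_of_real \<beta>) F0)) ys"
      and zs: "zero_list (monic N (P1 + cscale (complex_of_real \<beta>) F1)) zs"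
    define R where "R t = (cscale (complex_of_real (1 - t)) P0 + cscale (complex_of_real t) P1) +
       (cscale (complex_of_real (\<beta> * (1 - t))) F0 + cscale (complex_of_real (\<beta> * t)) F1)" for t
    have cs: "cscale 1 G = G" "cscale 0 G = 0" for G :: "'n system" by (simp_all add: cscale_def vec_eq_iff)
    have R01: "R 0 = P0 + cscale (complex_of_real \<beta>) F0" "R 1 = P1 + cscale (complex_of_real \<beta>) F1"
      by (simp_all add: R_def cs)
    show "length (filter (\<lambda>y. y \<in> W) ys) = length (filter (\<lambda>y. y \<in> W) zs)"
    proof (rule homotopy_count[OF N, of R])
      show "lowdeg N (R t)" for t unfolding R_def by (intro lowdeg_add lowdeg_cscale low)
      show "continuous_on {0..1} (\<lambda>t. lookup (R t $ i) m)" for i m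
        unfolding R_def by (simp add: lookup_add) (intro continuous_intros)
      show "sys_eval (monic N (R t)) x \<noteq> 0" if "t \<in> {0..1}" "x \<in> frontier W" for t x
      proof
        assume "sys_eval (monic N (R t)) x = 0"
        then have "Q (t, x) + \<beta> *\<^sub>R E (t, x) = 0"
          by (simp only: sys_eval_monic R_def sys_eval_add sys_eval_cscale_real Q_def E_def fst_conv snd_conv
             scaleR_add_right scaleR_scaleR add.assoc)
        then have "\<beta> *\<^sub>R E (t, x) = - Q (t, x)" by (simp add: eq_neg_iff_add_eq_0 add.commute)
        then have "\<bar>\<beta>\<bar> * norm (E (t, x)) = norm (Q (t, x))" by (metis norm_minus_cancel norm_scaleR)
        moreover have "norm (Q (t, x)) \<le> C" "\<delta> \<le> norm (E (t, x))" using C \<delta> that by auto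
        moreover have "C + 1 \<le> \<beta> * \<delta>" using \<beta> \<delta>(1) by (simp add: field_simps)
        moreover have "0 \<le> \<beta>" using \<beta> C(1) \<delta>(1) by (meson add_nonneg_nonneg divide_nonneg_pos order_trans zero_le_one)
        ultimately show False using mult_left_mono[of \<delta> "norm (E (t, x))" \<beta>] by simp
      qed
    qed (use W ys zs R01 in auto)
  qed
qed

section \<open>Zeros of an arbitrary system in a bounded open set\<close>

lemma keys_poly_at_low:
  assumes "\<And>k. N \<le> k \<Longrightarrow> coeff q k = 0" "m \<in> keys (poly_at q i)"
  shows "mdeg m < (N :: nat)"
proof -
  obtain k where k: "m \<in> keys (mconst (coeff q k) * mvar i ^ k)"
    using assms(2) keys_sum[of "\<lambda>k. mconst (coeff q k) * mvar i ^ k" "{..degree q}"]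
    unfolding poly_at_def by blast
  then have "coeff q k \<noteq> 0" by (auto simp: in_keys_iff)
  then have "k < N" using assms(1) by (meson not_le)
  moreover have "m = Poly_Mapping.single i k"
    using k keys_mconst_mult[of "coeff q k" "mvar i ^ k"] by (auto simp: mvar_power)
  ultimately show ?thesis by simp
qed

text \<open>The \<open>i\<close>-th product is a monic polynomial in \<open>x_i\<close> alone, of
  degree \<open>K * card Y\<close>, so systems built from it have the form to which traces
  apply.\<close>

lemma monic_prod:
  fixes Y :: "('n::finite) point set"
  assumes "finite Y"
  shows "\<exists>P. lowdeg (K * card Y) P \<and>
    (\<forall>i. monic (K * card Y) P $ i = (\<Prod>y\<in>Y. (mvar i - mconst (y $ i)) ^ K))"
proof -
  let ?N = "K * card Y"
  define q where "q i = (\<Prod>y\<in>Y. [:- (y $ i), 1:] ^ K)" for i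
  have deg: "degree (q i) = ?N" for i
    unfolding q_def by (subst degree_prod_eq_sum_degree) (auto simp: degree_power_eq)
  have lead: "coeff (q i) ?N = 1" for i
    using lead_coeff_prod[of "\<lambda>y. [:- (y $ i), 1:] ^ K" Y] deg[of i] unfolding q_def by (simp add: lead_coeff_power)
  define r where "r i = q i - monom 1 ?N" for i
  define P where "P = (\<chi> i. poly_at (r i) i)"
  have "coeff (r i) k = 0" if "?N \<le> k" for i k
    using that lead[of i] coeff_eq_0[of "q i" k] deg[of i] by (cases "k = ?N") (auto simp: r_def)
  then have "lowdeg ?N P"
    unfolding lowdeg_def P_def using keys_poly_at_low by (metis vec_lambda_beta)
  moreover have "monic ?N P $ i = (\<Prod>y\<in>Y. (mvar i - mconst (y $ i)) ^ K)" for i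
    by (rule mpoly_eqI) (simp add: monic_def P_def r_def poly_monom q_def poly_prod)
  ultimately show ?thesis by blast
qed

text \<open>Elimination over the local ring at \<open>y\<close>: \<open>u - h k\<close> is a unit
  there, so \<open>s k\<close> can be solved for and substituted in the other relations, which keep
  their shape.\<close>

lemma nakayama:
  assumes J: "is_ideal J" and cancel: "\<And>u p. u * p \<in> J \<Longrightarrow> meval u y \<noteq> 0 \<Longrightarrow> p \<in> J"
    and V: "finite V"
    and rel: "\<And>i. i \<in> V \<Longrightarrow> \<exists>u h. meval u y \<noteq> 0 \<and> (\<forall>j\<in>V. meval (h j) y = 0) \<and> u * s i - (\<Sum>j\<in>V. h j * s j) \<in> J"
  shows "\<forall>i\<in>V. s i \<in> J"
  using V rel
proof (induction V rule: finite_induct)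
  case (insert k V)
  obtain u h where u: "meval u y \<noteq> 0" "\<forall>j\<in>insert k V. meval (h j) y = 0" "u * s k - (\<Sum>j\<in>insert k V. h j * s j) \<in> J"
    using insert.prems[of k] by blast
  define w where "w = u - h k"
  have w: "meval w y \<noteq> 0" using u by (simp add: w_def)
  define e where "e = w * s k - (\<Sum>j\<in>V. h j * s j)"
  have "u * s k - (\<Sum>j\<in>insert k V. h j * s j) = e" using insert.hyps by (simp add: e_def w_def algebra_simps)
  with u(3) have eJ: "e \<in> J" by (simp only:)
  have "\<forall>i\<in>V. s i \<in> J"
  proof (rule insert.IH)
    fix i assume i: "i \<in> V"
    obtain v g where v: "meval v y \<noteq> 0" "\<forall>j\<in>insert k V. meval (g j) y = 0" "v * s i - (\<Sum>j\<in>insert k V. g j * s j) \<in> J"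
      using insert.prems[of i] i by blast
    have "(w * v) * s i - (\<Sum>j\<in>V. (g k * h j + w * g j) * s j) = w * (v * s i - (\<Sum>j\<in>insert k V. g j * s j)) + g k * e"
      using insert.hyps by (simp add: e_def algebra_simps sum_distrib_left sum.distrib)
    also have "\<dots> \<in> J" by (rule is_idealD(2)[OF J is_idealD(3)[OF J v(3)] is_idealD(3)[OF J eJ]])
    finally have "(w * v) * s i - (\<Sum>j\<in>V. (g k * h j + w * g j) * s j) \<in> J" .
    moreover have "\<forall>j\<in>V. meval (g k * h j + w * g j) y = 0" using u(2) v(2) by simp
    moreover have "meval (w * v) y \<noteq> 0" using w v(1) by simp
    ultimately show "\<exists>u h. meval u y \<noteq> 0 \<and> (\<forall>j\<in>V. meval (h j) y = 0) \<and> u * s i - (\<Sum>j\<in>V. h j * s j) \<in> J"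
      by (intro exI[of _ "w * v"] exI[of _ "\<lambda>j. g k * h j + w * g j"]) blast
  qed
  moreover have "s k \<in> J"
  proof (rule cancel[OF _ w])
    have "(\<Sum>j\<in>V. h j * s j) \<in> J" using calculation by (intro ideal_sum[OF J] is_idealD(3)[OF J]) blast
    from is_idealD(2)[OF J eJ this] show "w * s k \<in> J" by (simp add: e_def)
  qed
  ultimately show ?case by blast
qed simp

lemma ideal_power_le:
  assumes "is_ideal I" "p ^ k \<in> I" "k \<le> l"
  shows "p ^ l \<in> I"
proof -
  have "p ^ l = p ^ (l - k) * p ^ k" using assms(3) by (simp flip: power_add)
  then show ?thesis using is_idealD(3)[OF assms(1,2)] by simp
qed

lemma loc_sys_idealD:
  assumes "p \<in> loc (sys_ideal F) y"
  shows "\<exists>u a. meval u y \<noteq> 0 \<and> u * p = (\<Sum>j\<in>UNIV. a j * F $ j)"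
  using assms by (auto simp: loc_def sys_ideal_def)

lemma count_list_filter: "P y \<Longrightarrow> count_list (filter P ys) y = count_list ys y"
  by (induction ys) auto

text \<open>The count \<open>cnt\<close> is required for every \<open>P\<close> because
  \<open>P\<close> is built from the zeros of \<open>F\<close>, twice: from an arbitrary finite set
  of them to bound their number, then from all of them.\<close>

theorem zeros_in_open_set:
  fixes F :: "('n::finite) system"
  assumes N0: "0 < N0" "lowdeg N0 F" and W: "open W" "bounded W"
    and fr: "\<And>x. x \<in> frontier W \<Longrightarrow> sys_eval F x \<noteq> 0"
    and cnt: "\<And>N P. N0 \<le> N \<Longrightarrow> lowdeg N P \<Longrightarrow>
      \<exists>\<beta>0. \<forall>\<beta>\<ge>\<beta>0. \<forall>ys. zero_list (monic N (P + cscale (complex_of_real \<beta>) F)) ys \<longrightarrow> length (filter (\<lambda>y. y \<in> W) ys) = D"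
  defines "Z \<equiv> {x \<in> W. sys_eval F x = 0}"
  shows "finite Z \<and> (\<exists>\<mu>. (\<forall>y\<in>Z. codim (loc (sys_ideal F) y) (\<mu> y) \<and>
      (\<forall>i. (mvar i - mconst (y $ i)) ^ D \<in> loc (sys_ideal F) y)) \<and> (\<Sum>y\<in>Z. \<mu> y) = D)"
proof -
  have lowN: "lowdeg N F" if "N0 \<le> N" for N using N0(2) that by (fastforce simp: lowdeg_def)
  have G_nth: "monic N (P + cscale b F) $ i = monic N P $ i + mconst b * F $ i" for N P b i
    by (simp add: monic_def cscale_def)
  have small: "card Y \<le> D" if Y: "finite Y" "Y \<subseteq> Z" for Y
  proof (cases "Y = {}")
    case False
    let ?N = "N0 * card Y"
    have le: "N0 \<le> ?N" using False Y(1) N0(1) by (cases "card Y") auto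
    obtain P where P: "lowdeg ?N P" "\<And>i. monic ?N P $ i = (\<Prod>y\<in>Y. (mvar i - mconst (y $ i)) ^ N0)"
      using monic_prod[OF Y(1)] by blast
    obtain \<beta> where \<beta>: "\<And>ys. zero_list (monic ?N (P + cscale (complex_of_real \<beta>) F)) ys \<Longrightarrow> length (filter (\<lambda>y. y \<in> W) ys) = D"
      using cnt[OF le P(1)] by blast
    obtain ys where ys: "zero_list (monic ?N (P + cscale (complex_of_real \<beta>) F)) ys"
      using monic_zero_list[OF lowdeg_add[OF P(1) lowdeg_cscale[OF lowN[OF le]]]] by blast
    have "Y \<subseteq> set (filter (\<lambda>y. y \<in> W) ys)"
    proof
      fix y assume y: "y \<in> Y"
      have "meval (monic ?N (P + cscale (complex_of_real \<beta>) F) $ i) y = 0" for i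
      proof -
        have "(\<Prod>x\<in>Y. (y $ i - x $ i) ^ N0) = 0" using y Y(1) N0(1) by (intro prod_zero) (auto intro!: bexI[of _ y])
        moreover have "meval (F $ i) y = 0" using y Y(2) by (auto simp: Z_def vec_eq_iff)
        ultimately show ?thesis by (simp add: G_nth P(2))
      qed
      then have "sys_eval (monic ?N (P + cscale (complex_of_real \<beta>) F)) y = 0" by (simp add: vec_eq_iff)
      then show "y \<in> set (filter (\<lambda>y. y \<in> W) ys)" using set_zero_list[OF ys] y Y(2) by (auto simp: Z_def)
    qed
    then have "card Y \<le> card (set (filter (\<lambda>y. y \<in> W) ys))" by (intro card_mono) auto
    also have "\<dots> \<le> length (filter (\<lambda>y. y \<in> W) ys)" by (rule card_length)
    finally show ?thesis using \<beta>[OF ys] by simp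
  qed simp
  have fin: "finite Z"
  proof (rule ccontr)
    assume "infinite Z"
    then obtain Y where "finite Y" "card Y = Suc D" "Y \<subseteq> Z" using infinite_arbitrarily_large by metis
    then show False using small by fastforce
  qed

  \<comment> \<open>The point 0 keeps \<open>Y\<close> nonempty, and thus \<open>N\<close> at least
    \<open>N0\<close>, even if \<open>F\<close> has no zero in \<open>W\<close>.\<close>
  define Y where "Y = insert 0 Z"
  have Y: "finite Y" "card Y > 0" using fin by (auto simp: Y_def card_gt_0_iff)
  \<comment> \<open>\<open>D\<close> factors form \<open>s\<close>; the other \<open>Suc N0\<close>
    ones make \<open>\<rho>\<close> vanish at \<open>y\<close>. The summand \<open>N0\<close>
    ensures \<open>N0 \<le> N\<close>.\<close>
  define K where "K = Suc D + N0"
  define N where "N = K * card Y"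
  have le: "N0 \<le> N" using Y(2) by (cases "card Y") (auto simp: N_def K_def)
  obtain P where P: "lowdeg N P" "\<And>i. monic N P $ i = (\<Prod>y\<in>Y. (mvar i - mconst (y $ i)) ^ K)"
    using monic_prod[OF Y(1), of K] unfolding N_def by blast
  define \<Xi> where "\<Xi> = monic N P"
  define G where "G \<beta> = monic N (P + cscale (complex_of_real \<beta>) F)" for \<beta>
  have G: "G \<beta> $ i = \<Xi> $ i + mconst (complex_of_real \<beta>) * F $ i" for \<beta> i
    by (simp add: G_def \<Xi>_def G_nth)
  obtain \<beta>0 where \<beta>0: "\<And>\<beta> ys. \<beta>0 \<le> \<beta> \<Longrightarrow> zero_list (G \<beta>) ys \<Longrightarrow> length (filter (\<lambda>y. y \<in> W) ys) = D"
    using cnt[OF le P(1)] unfolding G_def by blast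
  have exG: "\<exists>ys. zero_list (G \<beta>) ys" for \<beta>
    unfolding G_def using monic_zero_list[OF lowdeg_add[OF P(1) lowdeg_cscale[OF lowN[OF le]]]] by blast
  define s where "s y i = (mvar i - mconst (y $ i)) ^ D" for y :: "'n point" and i
  define \<rho> where "\<rho> y i = (\<Prod>x\<in>Y - {y}. (mvar i - mconst (x $ i)) ^ K) * (mvar i - mconst (y $ i)) ^ Suc N0" for y :: "'n point" and i
  have \<Xi>: "\<Xi> $ i = \<rho> y i * s y i" if "y \<in> Z" for y i
  proof -
    have "\<Xi> $ i = (mvar i - mconst (y $ i)) ^ K * (\<Prod>x\<in>Y - {y}. (mvar i - mconst (x $ i)) ^ K)"
      using that Y(1) unfolding \<Xi>_def P(2) by (subst prod.remove[of Y y]) (auto simp: Y_def)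
    also have "(mvar i - mconst (y $ i)) ^ K = (mvar i - mconst (y $ i)) ^ Suc N0 * s y i"
      unfolding s_def K_def by (simp only: power_add[symmetric]) (simp add: ac_simps)
    finally show ?thesis by (simp add: \<rho>_def ac_simps)
  qed
  have \<rho>0: "meval (\<rho> y i) y = 0" for y i by (simp add: \<rho>_def)
  \<comment> \<open>The multiplicities of \<open>G \<beta>\<close> in \<open>W\<close> add up to
    \<open>D\<close>, so the one at \<open>y\<close> is at most \<open>D\<close>, and the exponent
    \<open>D\<close> suffices.\<close>
  have sG: "s y i \<in> loc (sys_ideal (G \<beta>)) y" if "\<beta>0 \<le> \<beta>" "y \<in> Z" for \<beta> y i
  proof -
    obtain ys where ys: "zero_list (G \<beta>) ys" using exG by blast
    have "count_list ys y = count_list (filter (\<lambda>y. y \<in> W) ys) y" using that(2) by (simp add: count_list_filter Z_def)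
    also have "\<dots> \<le> length (filter (\<lambda>y. y \<in> W) ys)" by (rule count_le_length)
    also have "\<dots> = D" by (rule \<beta>0[OF that(1) ys])
    finally show ?thesis
      unfolding s_def using ys ideal_power_le[OF is_ideal_loc[OF is_ideal_sys_ideal]] unfolding zero_list_def by blast
  qed
  \<comment> \<open>The local relation for \<open>G\<close> reads
    \<open>u * s = \<Sum> a * (\<rho> * s + \<beta>0 * F)\<close>. Modulo \<open>F\<close> only
    terms with \<open>\<rho>\<close> remain, which vanishes at \<open>y\<close>, so Nakayama's lemma
    applies.\<close>
  have sF: "s y i \<in> loc (sys_ideal F) y" if y: "y \<in> Z" for y i
  proof -
    let ?J = "loc (sys_ideal F) y"
    have J: "is_ideal ?J" by (rule is_ideal_loc[OF is_ideal_sys_ideal])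
    have "\<forall>i\<in>UNIV. s y i \<in> ?J"
    proof (rule nakayama[OF J loc_cancel finite])
      fix i
      obtain u a where u: "meval u y \<noteq> 0" "u * s y i = (\<Sum>j\<in>UNIV. a j * G \<beta>0 $ j)"
        using loc_sys_idealD[OF sG[OF order_refl y, of i]] by blast
      have "u * s y i - (\<Sum>j\<in>UNIV. (a j * \<rho> y j) * s y j) = (\<Sum>j\<in>UNIV. (a j * mconst (complex_of_real \<beta>0)) * F $ j)"
      proof -
        have "a j * G \<beta>0 $ j = (a j * \<rho> y j) * s y j + (a j * mconst (complex_of_real \<beta>0)) * F $ j" for j
          unfolding G \<Xi>[OF y] by (simp only: distrib_left mult.assoc)
        then show ?thesis unfolding u(2) by (simp only: sum.distrib add_diff_cancel_left')
      qed
      also have "\<dots> \<in> ?J" by (rule subsetD[OF loc_superset sys_idealI])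
      finally show "\<exists>u h. meval u y \<noteq> 0 \<and> (\<forall>j\<in>UNIV. meval (h j) y = 0) \<and> u * s y i - (\<Sum>j\<in>UNIV. h j * s y j) \<in> ?J"
        using u(1) \<rho>0 by (intro exI[of _ u] exI[of _ "\<lambda>j. a j * \<rho> y j"]) simp
    qed auto
    then show ?thesis by blast
  qed

  \<comment> \<open>Close to \<open>y\<close> the \<open>\<Xi> $ i\<close> are combinations of the
    \<open>F $ j\<close> with small coefficients \<open>e / v\<close>, so
    \<open>\<Xi> = - \<beta> F\<close> with \<open>\<beta> \<ge> 1\<close> forces
    \<open>F = 0\<close>. The neighbourhood is independent of \<open>\<beta>\<close>, which is
    chosen later.\<close>
  have nbhd: "\<exists>U. open U \<and> y \<in> U \<and> (\<forall>x\<in>U. \<forall>\<beta>\<ge>1. sys_eval (G \<beta>) x = 0 \<longrightarrow> sys_eval F x = 0)" if y: "y \<in> Z" for y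
  proof -
    have "\<forall>i. \<exists>v c. meval v y \<noteq> 0 \<and> v * s y i = (\<Sum>j\<in>UNIV. c j * F $ j)"
      using loc_sys_idealD[OF sF[OF y]] by blast
    then obtain v c where v: "\<And>i. meval (v i) y \<noteq> 0" "\<And>i. v i * s y i = (\<Sum>j\<in>UNIV. c i j * F $ j)" by metis
    define e where "e i j = \<rho> y i * c i j" for i j
    have ve: "v i * \<Xi> $ i = (\<Sum>j\<in>UNIV. e i j * F $ j)" for i
    proof -
      have "v i * \<Xi> $ i = \<rho> y i * (v i * s y i)" by (simp add: \<Xi>[OF y] ac_simps)
      then show ?thesis by (simp add: v(2) e_def sum_distrib_left mult.assoc)
    qed
    define g where "g i x = norm (meval (v i) x) - (\<Sum>j\<in>UNIV. norm (meval (e i j) x))" for i x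
    define U where "U = (\<Inter>i. {x. 0 < g i x})"
    have "continuous_on UNIV (g i)" for i unfolding g_def by (intro continuous_intros continuous_on_meval)
    then have "open {x. 0 < g i x}" for i by (intro open_Collect_less continuous_on_const) auto
    then have "open U" unfolding U_def by (intro open_INT) auto
    moreover have "y \<in> U" using v(1) by (auto simp: U_def g_def e_def \<rho>0)
    moreover have "sys_eval F x = 0" if x: "x \<in> U" and \<beta>: "1 \<le> \<beta>" and z: "sys_eval (G \<beta>) x = 0" for x \<beta>
    proof -
      define r where "r = Max (range (\<lambda>i. norm (meval (F $ i) x)))"
      have ler: "norm (meval (F $ i) x) \<le> r" for i unfolding r_def by (rule Max_ge) auto
      have "r \<in> range (\<lambda>i. norm (meval (F $ i) x))" unfolding r_def by (rule Max_in) auto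
      then obtain i where i: "r = norm (meval (F $ i) x)" by blast
      have "r \<le> 0"
      proof (rule ccontr)
        assume "\<not> r \<le> 0"
        then have r: "r > 0" by simp
        have "meval (\<Xi> $ i) x = - (of_real \<beta> * meval (F $ i) x)"
          using z by (simp add: vec_eq_iff G eq_neg_iff_add_eq_0)
        moreover have "meval (v i) x * meval (\<Xi> $ i) x = (\<Sum>j\<in>UNIV. meval (e i j) x * meval (F $ j) x)"
          using arg_cong[OF ve[of i], of "\<lambda>p. meval p x"] by simp
        ultimately have "norm (meval (v i) x) * (\<beta> * r) = norm (\<Sum>j\<in>UNIV. meval (e i j) x * meval (F $ j) x)"
          unfolding i using \<beta> by (metis norm_minus_cancel norm_mult norm_of_real abs_of_nonneg order_trans zero_le_one)
        also have "\<dots> \<le> (\<Sum>j\<in>UNIV. norm (meval (e i j) x) * r)"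
          by (rule order_trans[OF norm_sum sum_mono]) (simp add: norm_mult mult_left_mono ler)
        also have "\<dots> = (\<Sum>j\<in>UNIV. norm (meval (e i j) x)) * r" by (simp add: sum_distrib_right)
        also have "\<dots> < norm (meval (v i) x) * r" using x r by (auto simp: U_def g_def)
        also have "\<dots> \<le> norm (meval (v i) x) * (\<beta> * r)" using \<beta> r by (intro mult_left_mono) auto
        finally show False by simp
      qed
      then have "meval (F $ j) x = 0" for j using ler[of j] by (meson norm_le_zero_iff order_trans)
      then show ?thesis by (simp add: vec_eq_iff)
    qed
    ultimately show ?thesis by blast
  qed
  then obtain U where U: "\<And>y. y \<in> Z \<Longrightarrow> open (U y)" "\<And>y. y \<in> Z \<Longrightarrow> y \<in> U y"
    "\<And>y x \<beta>. y \<in> Z \<Longrightarrow> x \<in> U y \<Longrightarrow> 1 \<le> \<beta> \<Longrightarrow> sys_eval (G \<beta>) x = 0 \<Longrightarrow> sys_eval F x = 0"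
    by metis
  have clW: "compact (closure W)" using W(2) by (simp add: compact_closure)
  \<comment> \<open>Away from the neighbourhoods \<open>F\<close> has no zero in
    \<open>closure W\<close>. Compactness gives a lower bound for \<open>F\<close> there, which a
    large \<open>\<beta>\<close> raises above the bound for \<open>\<Xi>\<close>.\<close>
  define Q where "Q = closure W - (\<Union>y\<in>Z. U y)"
  have Q: "compact Q" unfolding Q_def by (intro compact_diff clW open_UN ballI U(1))
  have FQ: "0 < norm (sys_eval F x)" if "x \<in> Q" for x
  proof -
    have "sys_eval F x \<noteq> 0"
    proof
      assume z: "sys_eval F x = 0"
      then have "x \<notin> frontier W" using fr by blast
      then have "x \<in> W" using that W(1) by (auto simp: Q_def frontier_def interior_open)
      then have "x \<in> Z" using z by (simp add: Z_def)
      then show False using that U(2) by (auto simp: Q_def)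
    qed
    then show ?thesis by simp
  qed
  obtain \<delta> where \<delta>: "\<delta> > 0" "\<forall>x\<in>Q. \<delta> \<le> norm (sys_eval F x)"
    using positive_lower_bound[OF Q continuous_on_norm[OF continuous_on_sys_eval] FQ] by blast
  obtain C where C: "C \<ge> 0" "\<forall>x\<in>Q. norm (sys_eval \<Xi> x) \<le> C"
    using upper_bound[OF Q continuous_on_norm[OF continuous_on_sys_eval]] by blast
  define \<beta> where "\<beta> = max (max \<beta>0 1) ((C + 1) / \<delta>)"
  have \<beta>: "\<beta>0 \<le> \<beta>" "1 \<le> \<beta>" "C + 1 \<le> \<beta> * \<delta>"
  proof -
    have "(C + 1) / \<delta> \<le> \<beta>" by (simp add: \<beta>_def)
    then show "C + 1 \<le> \<beta> * \<delta>" using \<delta>(1) by (simp add: field_simps)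
  qed (auto simp: \<beta>_def)
  have sysG: "sys_eval (G \<beta>) x = sys_eval \<Xi> x + \<beta> *\<^sub>R sys_eval F x" for x
    unfolding G_def \<Xi>_def by (simp add: sys_eval_monic sys_eval_add sys_eval_cscale_real)
  obtain ys where ys: "zero_list (G \<beta>) ys" using exG by blast
  have zG: "sys_eval (G \<beta>) x = 0 \<longleftrightarrow> sys_eval F x = 0" if x: "x \<in> W" for x
  proof
    assume z: "sys_eval (G \<beta>) x = 0"
    show "sys_eval F x = 0"
    proof (cases "x \<in> (\<Union>y\<in>Z. U y)")
      case True then show ?thesis using U(3) \<beta>(2) z by blast
    next
      case False
      then have q: "x \<in> Q" using x closure_subset[of W] by (auto simp: Q_def)
      have "\<beta> *\<^sub>R sys_eval F x = - sys_eval \<Xi> x" using z sysG[of x] by (simp add: eq_neg_iff_add_eq_0 add.commute)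
      then have "\<bar>\<beta>\<bar> * norm (sys_eval F x) = norm (sys_eval \<Xi> x)" by (metis norm_minus_cancel norm_scaleR)
      moreover have "\<beta> * \<delta> \<le> \<bar>\<beta>\<bar> * norm (sys_eval F x)" using \<beta>(2) \<delta> q by (intro mult_mono) auto
      ultimately show ?thesis using C(2) q \<beta>(3) by force
    qed
  next
    assume "sys_eval F x = 0"
    then have xZ: "x \<in> Z" using x by (simp add: Z_def)
    have "meval (\<Xi> $ i) x = 0" for i using \<rho>0[of x i] by (simp add: \<Xi>[OF xZ])
    then have "sys_eval \<Xi> x = 0" by (simp add: vec_eq_iff)
    then show "sys_eval (G \<beta>) x = 0" using \<open>sys_eval F x = 0\<close> by (simp add: sysG)
  qed
  have setW: "set (filter (\<lambda>y. y \<in> W) ys) = Z"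
    using set_zero_list[OF ys] zG by (auto simp: Z_def)
  have sum: "(\<Sum>y\<in>Z. count_list ys y) = D"
  proof -
    have "(\<Sum>y\<in>Z. count_list ys y) = (\<Sum>y\<in>Z. count_list (filter (\<lambda>y. y \<in> W) ys) y)"
      by (intro sum.cong) (auto simp: count_list_filter Z_def)
    also have "\<dots> = length (filter (\<lambda>y. y \<in> W) ys)" using setW fin by (intro sum_count_set) auto
    finally show ?thesis using \<beta>0[OF \<beta>(1) ys] by simp
  qed
  \<comment> \<open>Both local ideals contain the \<open>s y i\<close>, and
    \<open>G \<beta> $ i\<close> differs from \<open>\<beta>\<close> times \<open>F $ i\<close> by a
    multiple of \<open>s y i\<close>.\<close>
  have locs: "loc (sys_ideal (G \<beta>)) y = loc (sys_ideal F) y" if y: "y \<in> Z" for y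
  proof (intro loc_eqI is_ideal_sys_ideal sys_ideal_subset is_ideal_loc)
    note L = is_ideal_loc[OF is_ideal_sys_ideal]
    have F: "F $ i \<in> loc (sys_ideal F) y" "G \<beta> $ i \<in> loc (sys_ideal (G \<beta>)) y" for i
      by (rule subsetD[OF loc_superset sys_ideal_gen])+
    show "G \<beta> $ i \<in> loc (sys_ideal F) y" for i
      unfolding G \<Xi>[OF y] by (rule is_idealD(2)[OF L is_idealD(3)[OF L sF[OF y]] is_idealD(3)[OF L F(1)]])
    have b: "mconst (inverse (complex_of_real \<beta>)) * (G \<beta> $ i - \<rho> y i * s y i) = F $ i" for i
    proof -
      have "mconst (inverse (complex_of_real \<beta>)) * (mconst (complex_of_real \<beta>) * F $ i) = mconst (inverse (complex_of_real \<beta>) * complex_of_real \<beta>) * F $ i"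
        by (simp only: mconst_mult mult.assoc)
      also have "inverse (complex_of_real \<beta>) * complex_of_real \<beta> = 1" using \<beta>(2) by simp
      finally show ?thesis unfolding G \<Xi>[OF y] by simp
    qed
    show "F $ i \<in> loc (sys_ideal (G \<beta>)) y" for i
      using is_idealD(3)[OF L is_idealD(6)[OF L F(2) is_idealD(3)[OF L sG[OF \<beta>(1) y]]], of "mconst (inverse (complex_of_real \<beta>))" i "\<rho> y i" i]
      unfolding b .
  qed
  have "codim (loc (sys_ideal F) y) (count_list ys y)" if "y \<in> Z" for y
    using ys locs[OF that] unfolding zero_list_def by metis
  then show ?thesis using fin sum sF unfolding s_def by blast
qed

section \<open>Comparing a homogeneous system with pure powers\<close>

text \<open>If \<open>Q(x) = l (x\<^sub>1\<^sup>d, \<dots>, x\<^sub>n\<^sup>d)\<close> with \<open>x \<noteq> 0\<close>, then the vector of all monomials of degree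
  \<open>n(d - 1) + 1\<close> at \<open>x\<close> is an eigenvector for \<open>l\<close> of a fixed matrix of Macaulay type.\<close>

lemma finite_homogeneous_ratios:
  fixes Q :: "('n::finite) system"
  assumes d: "0 < d" and hom: "\<And>i m. m \<in> keys (Q $ i) \<Longrightarrow> mdeg m = d"
  shows "finite {l. \<exists>x. x \<noteq> 0 \<and> (\<forall>i. meval (Q $ i) x = l * (x $ i) ^ d)}" (is "finite ?\<Lambda>")
proof (rule ccontr)
  assume inf: "infinite ?\<Lambda>"
  \<comment> \<open>The smallest degree in which every monomial has an exponent of at least
    \<open>d\<close>.\<close>
  define N where "N = CARD('n) * (d - 1) + 1"
  define S where "S = {m :: 'n \<Rightarrow>\<^sub>0 nat. mdeg m = N}"
  have S: "finite S" unfolding S_def by (rule finite_subset[OF _ finite_mdeg_less[of "Suc N"]]) auto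
  have "\<forall>a\<in>S. \<exists>i. d \<le> lookup a i"
  proof (rule ccontr)
    assume "\<not> ?thesis"
    then obtain a where a: "a \<in> S" "\<And>i. lookup a i < d" by (auto simp: not_le)
    have "mdeg a \<le> (\<Sum>i\<in>(UNIV::'n set). d - 1)"
      unfolding mdeg_def using a(2) d by (intro sum_mono) (simp add: less_Suc_eq_le[symmetric])
    then show False using a(1) by (simp add: S_def N_def)
  qed
  then obtain h where h: "\<And>a. a \<in> S \<Longrightarrow> d \<le> lookup a (h a)" by metis
  define b where "b a = a - Poly_Mapping.single (h a) d" for a
  \<comment> \<open>Row \<open>a\<close> comes from multiplying equation \<open>h a\<close> by the
    complementary monomial \<open>b a\<close>; it involves neither \<open>x\<close> nor
    \<open>l\<close>.\<close>
  define M where "M a a' = lookup (xmono (b a) * Q $ h a) a'" for a a'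
  define v where "v x a = meval (xmono a) x" for x :: "'n point" and a
  have eigen: "(\<Sum>a'\<in>S. M a a' * v x a') = l * v x a"
    if x: "\<And>i. meval (Q $ i) x = l * (x $ i) ^ d" and a: "a \<in> S" for x l a
  proof -
    have ba: "a = Poly_Mapping.single (h a) d + b a" using split_single[OF h[OF a]] by (simp add: b_def)
    have "keys (xmono (b a) * Q $ h a) \<subseteq> S"
    proof
      fix m assume "m \<in> keys (xmono (b a) * Q $ h a)"
      then obtain k where k: "k \<in> keys (Q $ h a)" "m = b a + k"
        using keys_mult[of "xmono (b a)" "Q $ h a"] by auto
      have "mdeg a = d + mdeg (b a)" by (subst ba) (simp add: mdeg_add)
      then show "m \<in> S" using hom[OF k(1)] k(2) a by (simp add: S_def mdeg_add)
    qed
    then have "(\<Sum>a'\<in>S. M a a' * v x a') = meval (xmono (b a) * Q $ h a) x"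
      using meval_superset[OF S] by (simp add: M_def v_def meval_single del: meval_mult)
    also have "\<dots> = l * (meval (mvar (h a) ^ d) x * meval (xmono (b a)) x)" by (simp add: x)
    also have "meval (mvar (h a) ^ d) x * meval (xmono (b a)) x = v x a"
    proof -
      have "v x a = meval (xmono (Poly_Mapping.single (h a) d + b a)) x" unfolding v_def by (simp only: ba[symmetric])
      then show ?thesis by (simp only: xmono_add meval_mult mvar_power)
    qed
    finally show ?thesis .
  qed
  obtain L where L: "L \<subseteq> ?\<Lambda>" "finite L" "card L = Suc (card S)"
    using infinite_arbitrarily_large[OF inf, of "Suc (card S)"] by blast
  have "\<forall>l\<in>L. \<exists>x. x \<noteq> 0 \<and> (\<forall>i. meval (Q $ i) x = l * (x $ i) ^ d)" using L(1) by blast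
  from bchoice[OF this] obtain X where "\<forall>l\<in>L. X l \<noteq> 0 \<and> (\<forall>i. meval (Q $ i) (X l) = l * (X l $ i) ^ d)" by (rule exE)
  then have X: "\<And>l. l \<in> L \<Longrightarrow> X l \<noteq> 0" "\<And>l i. l \<in> L \<Longrightarrow> meval (Q $ i) (X l) = l * (X l $ i) ^ d"
    by blast+
  have "card S < card L" using L(3) by simp
  then obtain c where c: "\<exists>l\<in>L. c l \<noteq> 0" "\<forall>a\<in>S. (\<Sum>l\<in>L. c l * v (X l) a) = 0"
    using linear_dependence[OF S L(2), of "\<lambda>l. v (X l)"] by blast
  \<comment> \<open>Applying \<open>M\<close> to the dependence multiplies each coefficient by its
    eigenvalue, so any polynomial in \<open>l\<close> may be inserted. Below, one that vanishes on
    \<open>L\<close> except at \<open>\<mu>\<close> isolates a single eigenvector, which is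
    nonzero.\<close>
  have pw: "\<forall>a\<in>S. (\<Sum>l\<in>L. c l * l ^ k * v (X l) a) = 0" for k
  proof (induction k)
    case (Suc k)
    show ?case
    proof
      fix a assume a: "a \<in> S"
      have "(\<Sum>l\<in>L. c l * l ^ Suc k * v (X l) a) = (\<Sum>l\<in>L. c l * l ^ k * (l * v (X l) a))"
        by (simp add: mult.commute mult.left_commute)
      also have "\<dots> = (\<Sum>l\<in>L. c l * l ^ k * (\<Sum>a'\<in>S. M a a' * v (X l) a'))"
        by (intro sum.cong refl) (simp add: eigen[OF X(2) a])
      also have "\<dots> = (\<Sum>a'\<in>S. M a a' * (\<Sum>l\<in>L. c l * l ^ k * v (X l) a'))"
        unfolding sum_distrib_left by (subst sum.swap) (simp add: mult.left_commute)
      also have "\<dots> = 0" using Suc by simp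
      finally show "(\<Sum>l\<in>L. c l * l ^ Suc k * v (X l) a) = 0" .
    qed
  qed (use c(2) in simp)
  have pol: "(\<Sum>l\<in>L. c l * poly f l * v (X l) a) = 0" if a: "a \<in> S" for f a
  proof -
    have "(\<Sum>l\<in>L. c l * poly f l * v (X l) a) = (\<Sum>l\<in>L. \<Sum>k\<le>degree f. coeff f k * (c l * l ^ k * v (X l) a))"
      by (simp add: poly_altdef sum_distrib_left sum_distrib_right ac_simps)
    also have "\<dots> = (\<Sum>k\<le>degree f. coeff f k * (\<Sum>l\<in>L. c l * l ^ k * v (X l) a))"
      by (subst sum.swap) (simp add: sum_distrib_left)
    also have "\<dots> = 0" using pw a by simp
    finally show ?thesis .
  qed
  obtain \<mu> where \<mu>: "\<mu> \<in> L" "c \<mu> \<noteq> 0" using c(1) by blast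
  define f where "f = (\<Prod>l\<in>L - {\<mu>}. [:- l, 1:])"
  have f: "poly f l = 0" if "l \<in> L" "l \<noteq> \<mu>" for l
    using that L(2) unfolding f_def poly_prod by (intro prod_zero) (auto intro!: bexI[of _ l])
  have f\<mu>: "poly f \<mu> \<noteq> 0" using L(2) by (simp add: f_def poly_prod)
  obtain j where j: "X \<mu> $ j \<noteq> 0" using X(1)[OF \<mu>(1)] by (auto simp: vec_eq_iff)
  define a :: "'n \<Rightarrow>\<^sub>0 nat" where "a = Poly_Mapping.single j N"
  have a: "a \<in> S" by (simp add: a_def S_def)
  have "v (X \<mu>) a = X \<mu> $ j ^ N" unfolding v_def a_def by (simp flip: mvar_power)
  then have va: "v (X \<mu>) a \<noteq> 0" using j by simp
  have "(\<Sum>l\<in>L. c l * poly f l * v (X l) a) = (\<Sum>l\<in>L. if l = \<mu> then c \<mu> * poly f \<mu> * v (X \<mu>) a else 0)"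
    using f by (intro sum.cong) auto
  also have "\<dots> = c \<mu> * poly f \<mu> * v (X \<mu>) a" using \<mu>(1) L(2) by simp
  finally show False using pol[OF a, of f] \<mu>(2) f\<mu> va by simp
qed

text \<open>All points of the ray have the same slope \<open>Im / Re\<close>, and the given set has
  only finitely many slopes. The choice \<open>Re c = 1\<close> makes the slope of the ray a genuine
  quotient; members of the set with real part 0 merely exclude slope 0.\<close>

lemma avoiding_ray:
  assumes "finite (\<Lambda> :: complex set)"
  shows "\<exists>c. c \<noteq> 0 \<and> (\<forall>\<tau>>0. - (complex_of_real \<tau> * c) \<notin> \<Lambda>)"
proof -
  have "finite ((\<lambda>l. Im l / Re l) ` \<Lambda>)" using assms by (rule finite_imageI)
  then have "\<exists>t. t \<notin> (\<lambda>l. Im l / Re l) ` \<Lambda>" by (rule ex_new_if_finite[OF infinite_UNIV_char_0])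
  then obtain t where t: "t \<notin> (\<lambda>l. Im l / Re l) ` \<Lambda>" ..
  have "- (complex_of_real \<tau> * Complex 1 t) \<notin> \<Lambda>" if "\<tau> > 0" for \<tau>
  proof
    assume m: "- (complex_of_real \<tau> * Complex 1 t) \<in> \<Lambda>"
    have "Im (- (complex_of_real \<tau> * Complex 1 t)) / Re (- (complex_of_real \<tau> * Complex 1 t)) = t"
      using that by simp
    then show False using t imageI[OF m, of "\<lambda>l. Im l / Re l"] by simp
  qed
  moreover have "Complex 1 t \<noteq> 0" by (simp add: complex_eq_iff)
  ultimately show ?thesis by blast
qed

text \<open>The ideal generated by the powers \<open>x_i ^ \<delta> i\<close>, described by its
  monomials, so that a basis of the quotient can be read off.\<close>

definition mono_ideal :: "('n::finite \<Rightarrow> nat) \<Rightarrow> 'n mpoly set" where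
  "mono_ideal \<delta> = {p. \<forall>m\<in>keys p. \<exists>i. \<delta> i \<le> lookup m i}"

lemma is_ideal_mono_ideal: "is_ideal (mono_ideal \<delta>)"
  unfolding is_ideal_def
proof (intro conjI ballI allI)
  show "0 \<in> mono_ideal \<delta>" by (simp add: mono_ideal_def)
  show "p + q \<in> mono_ideal \<delta>" if "p \<in> mono_ideal \<delta>" "q \<in> mono_ideal \<delta>" for p q
    using that keys_add[of p q] unfolding mono_ideal_def by blast
  show "r * p \<in> mono_ideal \<delta>" if "p \<in> mono_ideal \<delta>" for p r
  proof -
    have "\<exists>i. \<delta> i \<le> lookup m i" if m: "m \<in> keys (r * p)" for m
    proof -
      obtain a b where ab: "m = a + b" "b \<in> keys p" using m keys_mult[of r p] by blast
      then obtain i where "\<delta> i \<le> lookup b i" using \<open>p \<in> mono_ideal \<delta>\<close> by (auto simp: mono_ideal_def)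
      then show ?thesis using ab by (intro exI[of _ i]) (simp add: lookup_add)
    qed
    then show ?thesis by (simp add: mono_ideal_def)
  qed
qed

lemma lookup_Abs_finite [simp]: "lookup (Abs_poly_mapping f) = f" for f :: "'n::finite \<Rightarrow> nat"
  by (rule lookup_Abs_poly_mapping) simp

lemma codim_mono_ideal: "codim (mono_ideal \<delta>) (\<Prod>i\<in>UNIV. \<delta> i)" for \<delta> :: "'n::finite \<Rightarrow> nat"
proof -
  define A where "A = {a :: 'n \<Rightarrow>\<^sub>0 nat. \<forall>i. lookup a i < \<delta> i}"
  have bij: "bij_betw lookup A (Pi\<^sub>E UNIV (\<lambda>i. {..<\<delta> i}))"
    by (rule bij_betw_byWitness[where f' = Abs_poly_mapping]) (auto simp: A_def PiE_iff)
  have finA: "finite A" using bij_betw_finite[OF bij] by (simp add: finite_PiE)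
  have cardA: "card A = (\<Prod>i\<in>UNIV. \<delta> i)" using bij_betw_same_card[OF bij] by (simp add: card_PiE)
  have inj: "inj_on xmono A" by (rule inj_onI, drule arg_cong[where f = keys]) simp
  have sumx: "(\<Sum>b\<in>xmono ` A. mconst (c b) * b) = (\<Sum>a\<in>A. mconst (c (xmono a)) * xmono a)" for c
    by (simp add: sum.reindex[OF inj])
  have lk: "lookup (\<Sum>a\<in>A. mconst (e a) * xmono a) m = (if m \<in> A then e m else 0)" for e m
  proof -
    have "lookup (\<Sum>a\<in>A. mconst (e a) * xmono a) m = (\<Sum>a\<in>A. if a = m then e a else 0)"
      unfolding lookup_sum by (intro sum.cong) (auto simp: lookup_single when_def)
    then show ?thesis using finA by simp
  qed
  show ?thesis
    unfolding codim_def
  proof (intro exI[of _ "xmono ` A"] conjI allI impI)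
    show "finite (xmono ` A)" using finA by simp
    show "card (xmono ` A) = (\<Prod>i\<in>UNIV. \<delta> i)" using card_image[OF inj] cardA by simp
  next
    fix p :: "'n mpoly"
    define c where "c b = lookup p (inv_into A xmono b)" for b
    have "(\<Sum>b\<in>xmono ` A. mconst (c b) * b) = (\<Sum>a\<in>A. mconst (lookup p a) * xmono a)"
      unfolding sumx by (intro sum.cong) (auto simp: c_def inv_into_f_f[OF inj])
    then have lp: "lookup (p - (\<Sum>b\<in>xmono ` A. mconst (c b) * b)) m = (if m \<in> A then 0 else lookup p m)" for m
      by (simp add: lookup_minus lk)
    have "\<exists>i. \<delta> i \<le> lookup m i" if "m \<notin> A" for m using that by (auto simp: A_def not_less)
    then have "p - (\<Sum>b\<in>xmono ` A. mconst (c b) * b) \<in> mono_ideal \<delta>"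
      unfolding mono_ideal_def by (auto simp only: mem_Collect_eq in_keys_iff lp split: if_splits)
    then show "\<exists>c. p - (\<Sum>b\<in>xmono ` A. mconst (c b) * b) \<in> mono_ideal \<delta>" by blast
  next
    fix c assume "(\<Sum>b\<in>xmono ` A. mconst (c b) * b) \<in> mono_ideal \<delta>"
    then have "m \<in> A \<Longrightarrow> c (xmono m) \<noteq> 0 \<Longrightarrow> \<exists>i. \<delta> i \<le> lookup m i" for m
      unfolding sumx by (auto simp: mono_ideal_def in_keys_iff lk)
    then show "\<forall>b\<in>xmono ` A. c b = 0" by (auto simp: A_def not_le[symmetric])
  qed
qed

lemma sub_ideal_mono:
  assumes I: "is_ideal I" and x: "\<And>i. mvar i ^ \<delta> i \<in> I"
  shows "mono_ideal \<delta> \<subseteq> I"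
proof
  fix p assume p: "p \<in> mono_ideal \<delta>"
  have "mconst (lookup p m) * xmono m \<in> I" if m: "m \<in> keys p" for m
  proof -
    obtain i where "\<delta> i \<le> lookup m i" using p m by (auto simp: mono_ideal_def)
    from split_single[OF this] have "xmono m = mvar i ^ \<delta> i * xmono (m - Poly_Mapping.single i (\<delta> i))"
      by (metis xmono_add mvar_power)
    then show ?thesis using is_idealD(3)[OF I is_idealD(4)[OF I x]] by metis
  qed
  then have "(\<Sum>m\<in>keys p. mconst (lookup p m) * xmono m) \<in> I" by (rule ideal_sum[OF I])
  then show "p \<in> I" by (simp only: mpoly_expand_xmono[OF finite_keys order_refl])
qed

definition powers :: "complex \<Rightarrow> ('n \<Rightarrow> nat) \<Rightarrow> ('n::finite) system" where
  "powers c \<delta> = (\<chi> i. mconst c * mvar i ^ \<delta> i)"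

lemma lowdeg_powers: "(\<And>i. \<delta> i < N) \<Longrightarrow> lowdeg N (powers c \<delta>)"
  unfolding lowdeg_def powers_def using keys_mconst_mult[of c] by (fastforce simp: mvar_power)

text \<open>Equation \<open>i\<close> factors as \<open>x_i ^ \<delta> i\<close> times
  \<open>x_i ^ (N - \<delta> i) + \<beta> c\<close>. For large \<open>\<beta>\<close> the second
  factor has no zero in \<open>W\<close>, and it is a unit at 0, so the local ideal at 0 is the
  monomial ideal.\<close>

lemma powers_count:
  fixes W :: "('n::finite) point set"
  assumes c: "c \<noteq> 0" and \<delta>: "\<And>i. 0 < \<delta> i" "\<And>i. \<delta> i < N" and W: "bounded W" "0 \<in> W"
  shows "\<exists>\<beta>0. \<forall>\<beta>\<ge>\<beta>0. \<forall>ys. zero_list (monic N (0 + cscale (complex_of_real \<beta>) (powers c \<delta>))) ys \<longrightarrow>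
    length (filter (\<lambda>y. y \<in> W) ys) = (\<Prod>i\<in>UNIV. \<delta> i)"
proof -
  obtain r0 where r0: "\<And>x. x \<in> W \<Longrightarrow> norm x \<le> r0" using W(1) by (auto simp: bounded_iff)
  define r where "r = max 1 r0"
  have r: "norm (x $ i) \<le> r" "1 \<le> r" if "x \<in> W" for x i
    using r0[OF that] Finite_Cartesian_Product.norm_nth_le[of x i] by (auto simp: r_def)
  show ?thesis
  \<comment> \<open>As \<open>r \<ge> 1\<close>, \<open>r ^ N\<close> bounds all powers
    \<open>x_i ^ (N - \<delta> i)\<close> on \<open>W\<close>, and the modulus of
    \<open>\<beta> c\<close> exceeds it.\<close>
  proof (intro exI[of _ "(r ^ N + 1) / norm c"] allI impI)
    fix \<beta> ys assume b: "(r ^ N + 1) / norm c \<le> \<beta>"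
      and ys: "zero_list (monic N (0 + cscale (complex_of_real \<beta>) (powers c \<delta>))) ys"
    define e where "e = complex_of_real \<beta> * c"
    define G where "G = monic N (0 + cscale (complex_of_real \<beta>) (powers c \<delta>))"
    have bn: "r ^ N + 1 \<le> \<beta> * norm c" using b c by (simp add: field_simps)
    have ne: "norm e = \<bar>\<beta>\<bar> * norm c" by (simp add: e_def norm_mult)
    have big: "r ^ N < norm e"
      using bn mult_right_mono[OF abs_ge_self[of \<beta>] norm_ge_zero[of c]] ne by linarith
    have e0: "e \<noteq> 0" using big W(2) r(2) zero_le_power[of r N] by auto
    have G: "G $ i = mvar i ^ N + mconst e * mvar i ^ \<delta> i" for i
      by (simp add: G_def monic_def cscale_def powers_def e_def mconst_mult mult.assoc)
    have G': "G $ i = (mvar i ^ (N - \<delta> i) + mconst e) * mvar i ^ \<delta> i" for i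
    proof -
      have "mvar i ^ N = mvar i ^ (N - \<delta> i) * (mvar i ^ \<delta> i :: 'n mpoly)"
        using \<delta>(2)[of i] by (simp flip: power_add)
      then show ?thesis by (simp add: G distrib_right)
    qed
    have only0: "y = 0" if y: "y \<in> W" "sys_eval G y = 0" for y
    proof -
      have "y $ i = 0" for i
      proof (rule ccontr)
        assume yi: "y $ i \<noteq> 0"
        have "meval (G $ i) y = 0" using y(2) by (simp add: vec_eq_iff)
        then have "(y $ i) ^ (N - \<delta> i) + e = 0" using yi by (simp add: G')
        then have "e = - ((y $ i) ^ (N - \<delta> i))" by (simp add: eq_neg_iff_add_eq_0 add.commute)
        then have "norm e = norm (y $ i) ^ (N - \<delta> i)" by (metis norm_minus_cancel norm_power)
        also have "\<dots> \<le> r ^ (N - \<delta> i)" using r(1)[OF y(1)] by (intro power_mono) auto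
        also have "\<dots> \<le> r ^ N" using r(2)[OF y(1)] by (intro power_increasing) auto
        finally show False using big by simp
      qed
      then show ?thesis by (simp add: vec_eq_iff)
    qed
    have J: "is_ideal (mono_ideal \<delta>)" by (rule is_ideal_mono_ideal)
    have mvJ: "mvar i ^ \<delta> i \<in> mono_ideal \<delta>" for i
      by (simp add: mono_ideal_def mvar_power) (metis lookup_single_eq order_refl)
    have L: "is_ideal (loc (sys_ideal G) 0)" by (rule is_ideal_loc[OF is_ideal_sys_ideal])
    have "loc (sys_ideal G) 0 = loc (mono_ideal \<delta>) 0"
    proof (intro loc_eqI is_ideal_sys_ideal J sys_ideal_subset is_ideal_loc sub_ideal_mono)
      show "G $ i \<in> loc (mono_ideal \<delta>) 0" for i
        unfolding G' by (rule subsetD[OF loc_superset is_idealD(3)[OF J mvJ]])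
      show "mvar i ^ \<delta> i \<in> loc (sys_ideal G) 0" for i
      proof (rule loc_cancel)
        show "(mvar i ^ (N - \<delta> i) + mconst e) * mvar i ^ \<delta> i \<in> loc (sys_ideal G) 0"
          unfolding G'[symmetric] by (rule subsetD[OF loc_superset sys_ideal_gen])
        show "meval (mvar i ^ (N - \<delta> i) + mconst e) 0 \<noteq> 0" using e0 \<delta>(2)[of i] by (simp add: power_0_left)
      qed
    qed
    also have "\<dots> = mono_ideal \<delta>"
      by (rule loc_eq_self[OF J, where L = \<delta>]) (simp add: mvJ)
    finally have "codim (loc (sys_ideal G) 0) (\<Prod>i\<in>UNIV. \<delta> i)" using codim_mono_ideal by simp
    moreover have "codim (loc (sys_ideal G) 0) (count_list ys 0)" using ys by (simp add: zero_list_def G_def)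
    ultimately have cnt: "count_list ys 0 = (\<Prod>i\<in>UNIV. \<delta> i)" using codim_unique[OF L] by blast
    have zs: "set ys = {y. sys_eval G y = 0}" using set_zero_list[OF ys] by (simp add: G_def)
    have "filter (\<lambda>y. y \<in> W) ys = filter ((=) 0) ys"
      using zs only0 W(2) by (intro filter_cong) auto
    then show "length (filter (\<lambda>y. y \<in> W) ys) = (\<Prod>i\<in>UNIV. \<delta> i)"
      using cnt by (simp add: count_list_eq_length_filter)
  qed
qed

section \<open>Weighted balls\<close>

lemma complex_root_exists:
  assumes "0 < d"
  shows "\<exists>z::complex. z ^ d = y"
proof -
  have "degree (monom 1 d + [:- y:]) = d"
    using assms by (subst degree_add_eq_left) (auto simp: degree_monom_eq)
  then have "\<not> constant (poly (monom 1 d + [:- y:]))" using assms by (simp add: constant_degree)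
  then obtain z where "poly (monom 1 d + [:- y:]) z = 0" using fundamental_theorem_of_algebra by blast
  then show ?thesis by (auto simp: poly_monom)
qed

definition power_map :: "('n \<Rightarrow> nat) \<Rightarrow> ('n::finite) system" where
  "power_map w = (\<chi> i. mvar i ^ w i)"

lemma power_map_eval [simp]: "meval (power_map w $ i) x = (x $ i) ^ w i"
  by (simp add: power_map_def)

lemma power_map_surj:
  assumes "\<And>i. 0 < w i"
  shows "\<exists>x. sys_eval (power_map w) x = y"
proof -
  have "\<forall>i. \<exists>z. z ^ w i = y $ i" using complex_root_exists[OF assms] by blast
  then obtain z where "\<And>i. z i ^ w i = y $ i" by metis
  then show ?thesis by (intro exI[of _ "\<chi> i. z i"]) (simp add: vec_eq_iff)
qed

text \<open>For positive exponents, the norm of any preimage under \<open>power_map w\<close>: all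
  preimages have the same coordinate moduli. Images of balls become sublevel sets of this continuous
  function.\<close>

definition wnorm :: "('n \<Rightarrow> nat) \<Rightarrow> ('n::finite) point \<Rightarrow> real" where
  "wnorm w y = norm (\<chi> i. complex_of_real (root (w i) (norm (y $ i))))"

lemma wnorm_power_map: "(\<And>i. 0 < w i) \<Longrightarrow> wnorm w (sys_eval (power_map w) x) = norm x"
  by (simp add: wnorm_def norm_vec_def norm_power real_root_power_cancel)

lemma continuous_on_wnorm: "continuous_on UNIV (wnorm w)"
  unfolding wnorm_def by (intro continuous_intros)

lemma power_map_ball:
  assumes "\<And>i. 0 < w i"
  shows "sys_eval (power_map w) ` ball 0 r = {y. wnorm w y < r}"
    "sys_eval (power_map w) ` cball 0 r = {y. wnorm w y \<le> r}"
proof -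
  have s: "\<exists>x. y = sys_eval (power_map w) x \<and> norm x = wnorm w y" for y
    using power_map_surj[of w y, OF assms] wnorm_power_map[of w, OF assms] by metis
  show "sys_eval (power_map w) ` ball 0 r = {y. wnorm w y < r}"
  proof (intro equalityI subsetI)
    fix y assume "y \<in> {y. wnorm w y < r}"
    moreover obtain x where "y = sys_eval (power_map w) x" "norm x = wnorm w y" using s by blast
    ultimately show "y \<in> sys_eval (power_map w) ` ball 0 r" by (intro image_eqI[of _ _ x]) auto
  qed (auto simp: wnorm_power_map[of w, OF assms])
  show "sys_eval (power_map w) ` cball 0 r = {y. wnorm w y \<le> r}"
  proof (intro equalityI subsetI)
    fix y assume "y \<in> {y. wnorm w y \<le> r}"
    moreover obtain x where "y = sys_eval (power_map w) x" "norm x = wnorm w y" using s by blast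
    ultimately show "y \<in> sys_eval (power_map w) ` cball 0 r" by (intro image_eqI[of _ _ x]) auto
  qed (auto simp: wnorm_power_map[of w, OF assms])
qed

lemma open_wball: "open {y. wnorm w y < r}"
  by (intro open_Collect_less continuous_on_wnorm continuous_on_const)

lemma closed_wball: "closed {y. wnorm w y \<le> r}"
  by (intro closed_Collect_le continuous_on_wnorm continuous_on_const)

lemma frontier_wball: "frontier {y. wnorm w y < r} \<subseteq> {y. wnorm w y = r}"
proof -
  have "closure {y. wnorm w y < r} \<subseteq> {y. wnorm w y \<le> r}"
    by (rule closure_minimal[OF _ closed_wball]) auto
  then show ?thesis by (auto simp: frontier_def interior_open[OF open_wball])
qed

lemma bounded_wball:
  assumes "\<And>i. 0 < w i"
  shows "bounded {y. wnorm w y < r}"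
proof (rule bounded_subset)
  have "compact (sys_eval (power_map w) ` cball 0 r)"
    by (intro compact_continuous_image continuous_on_sys_eval compact_cball)
  then show "bounded {y. wnorm w y \<le> r}" unfolding power_map_ball(2)[of w, OF assms] by (rule compact_imp_bounded)
qed auto

section \<open>Homogeneous and weighted homogeneous parts\<close>

lemma lookup_deg_part: "lookup (deg_part Q p) m = (if Q (mdeg m) then lookup p m else 0)"
proof -
  have "lookup (deg_part Q p) m = (\<Sum>k\<in>{k \<in> keys p. Q (mdeg k)}. if k = m then lookup p m else 0)"
    unfolding deg_part_def lookup_sum by (intro sum.cong) (auto simp: lookup_single when_def)
  then show ?thesis by (simp add: in_keys_iff)
qed

lemma deg_part_sum: "deg_part Q (sum f A) = (\<Sum>a\<in>A. deg_part Q (f a))"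
  by (rule poly_mapping_eqI) (simp add: lookup_deg_part lookup_sum)

lemma deg_part_single: "deg_part Q (Poly_Mapping.single m c) = (if Q (mdeg m) then Poly_Mapping.single m c else 0)"
  by (rule poly_mapping_eqI) (auto simp: lookup_deg_part lookup_single when_def)

lemma deg_part_split: "deg_part (\<lambda>e. e = d) p + deg_part (\<lambda>e. e < d) p + deg_part (\<lambda>e. d < e) p = p"
  by (rule poly_mapping_eqI) (auto simp: lookup_deg_part lookup_add)

lemma sys_part_split:
  "sys_eval F x = sys_eval (sys_part (\<lambda>e. e = d) F) x + sys_eval (sys_part (\<lambda>e. e < d) F) x + sys_eval (sys_part (\<lambda>e. d < e) F) x"
proof -
  have "meval (F $ i) x = meval (deg_part (\<lambda>e. e = d) (F $ i) + deg_part (\<lambda>e. e < d) (F $ i) + deg_part (\<lambda>e. d < e) (F $ i)) x" for i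
    by (simp only: deg_part_split)
  then show ?thesis by (simp add: vec_eq_iff sys_part_def)
qed

definition weight :: "('n \<Rightarrow> nat) \<Rightarrow> ('n::finite \<Rightarrow>\<^sub>0 nat) \<Rightarrow> nat" where
  "weight w m = (\<Sum>i\<in>UNIV. w i * lookup m i)"

definition wpart :: "('n \<Rightarrow> nat) \<Rightarrow> nat \<Rightarrow> ('n::finite) system \<Rightarrow> 'n system" where
  "wpart w d F = (\<chi> i. \<Sum>m\<in>{m \<in> keys (F $ i). weight w m = d}. Poly_Mapping.single m (lookup (F $ i) m))"

lemma lowdeg_wpart:
  assumes "lowdeg N F"
  shows "lowdeg N (wpart w d F)"
  unfolding lowdeg_def
proof (intro allI ballI)
  fix i m assume "m \<in> keys (wpart w d F $ i)"
  then have "m \<in> keys (\<Sum>m\<in>{m \<in> keys (F $ i). weight w m = d}. Poly_Mapping.single m (lookup (F $ i) m))"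
    by (simp only: wpart_def vec_lambda_beta)
  then obtain k where "k \<in> keys (F $ i)" "m \<in> keys (Poly_Mapping.single k (lookup (F $ i) k))"
    using keys_sum[of "\<lambda>m. Poly_Mapping.single m (lookup (F $ i) m)" "{m \<in> keys (F $ i). weight w m = d}"]
    by blast
  then show "mdeg m < N" using assms by (auto simp: lowdeg_def split: if_splits)
qed

text \<open>Substituting powers turns the monomial \<open>m\<close> into \<open>wm m\<close>, whose
  ordinary degree is the weight of \<open>m\<close>.\<close>

lemma wpart_power_map:
  "sys_eval (wpart w d F) (sys_eval (power_map w) x) = sys_eval (sys_part (\<lambda>e. e = d) (sys_comp F (power_map w))) x"
proof -
  define wm where "wm m = Abs_poly_mapping (\<lambda>i. w i * lookup m i)" for m
  have mw: "mdeg (wm m) = weight w m" for m by (simp add: wm_def mdeg_def weight_def)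
  have ev: "(\<Prod>i\<in>UNIV. (x $ i) ^ lookup (wm m) i) = (\<Prod>i\<in>UNIV. ((x $ i) ^ w i) ^ lookup m i)" for x :: "'a point" and m
    by (simp add: wm_def power_mult)
  have sub: "msubst p (power_map w) = (\<Sum>m\<in>keys p. Poly_Mapping.single (wm m) (lookup p m))" for p
    by (rule mpoly_eqI) (simp add: meval_msubst meval_single ev meval_def[of p])
  have "meval (wpart w d F $ i) (sys_eval (power_map w) x) = meval (deg_part (\<lambda>e. e = d) (msubst (F $ i) (power_map w))) x" for i
  proof -
    have "meval (deg_part (\<lambda>e. e = d) (msubst (F $ i) (power_map w))) x =
        (\<Sum>m\<in>keys (F $ i). if weight w m = d then lookup (F $ i) m * (\<Prod>j\<in>UNIV. ((x $ j) ^ w j) ^ lookup m j) else 0)"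
      unfolding sub deg_part_sum deg_part_single mw meval_sum by (intro sum.cong) (auto simp: meval_single ev)
    also have "\<dots> = (\<Sum>m\<in>{m \<in> keys (F $ i). weight w m = d}. lookup (F $ i) m * (\<Prod>j\<in>UNIV. ((x $ j) ^ w j) ^ lookup m j))"
      by (subst sum.inter_filter) auto
    finally show ?thesis by (simp add: wpart_def meval_single)
  qed
  then show ?thesis by (simp add: vec_eq_iff sys_part_def sys_comp_def)
qed

lemma lowdeg_exists: "\<exists>N. lowdeg N F" for F :: "('n::finite) system"
proof -
  define K where "K = (\<Union>i. mdeg ` keys (F $ i))"
  have "finite K" by (simp add: K_def)
  then have "\<forall>k\<in>K. k < Suc (Max K)" by (simp add: less_Suc_eq_le)
  then show ?thesis by (intro exI[of _ "Suc (Max K)"]) (auto simp: lowdeg_def K_def)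
qed

lemma lowdeg_mono: "lowdeg N F \<Longrightarrow> N \<le> N' \<Longrightarrow> lowdeg N' F"
  by (fastforce simp: lowdeg_def)

text \<open>Counting in the coordinates before the substitution keeps the local rings of
  \<open>F\<close>. The bounds, given for \<open>H\<close>, are transferred by writing each boundary
  point as the image of a point of norm \<open>r\<close>.\<close>

theorem weighted_ball_zeros:
  fixes F :: "('n::finite) system" and w \<delta> :: "'n \<Rightarrow> nat"
  defines "H \<equiv> sys_comp F (power_map w)"
  assumes d: "0 < d" and w\<delta>: "\<And>i. w i * \<delta> i = d" and r: "0 < r"
    and nz: "\<And>x. x \<noteq> 0 \<Longrightarrow> sys_eval (sys_part (\<lambda>e. e = d) H) x \<noteq> 0"
    and dom: "\<And>x. norm x = r \<Longrightarrow> norm (sys_eval (sys_part (\<lambda>e. e < d) H) x) + norm (sys_eval (sys_part (\<lambda>e. d < e) H) x)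
        < norm (sys_eval (sys_part (\<lambda>e. e = d) H) x)"
  defines "Z \<equiv> {y \<in> {y. wnorm w y < r}. sys_eval F y = 0}"
  shows "finite Z \<and> (\<exists>\<mu>. (\<forall>y\<in>Z. codim (loc (sys_ideal F) y) (\<mu> y) \<and>
      (\<forall>i. (mvar i - mconst (y $ i)) ^ (\<Prod>i\<in>UNIV. \<delta> i) \<in> loc (sys_ideal F) y)) \<and> (\<Sum>y\<in>Z. \<mu> y) = (\<Prod>i\<in>UNIV. \<delta> i))"
proof -
  let ?W = "{y. wnorm w y < r}"
  let ?Hd = "sys_part (\<lambda>e. e = d) H" and ?Hl = "sys_part (\<lambda>e. e < d) H" and ?Hg = "sys_part (\<lambda>e. d < e) H"
  let ?Fw = "wpart w d F"
  have w: "0 < w i" and \<delta>: "0 < \<delta> i" for i using w\<delta>[of i] d by (metis mult_0 mult_0_right neq0_conv)+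
  have \<delta>d: "\<delta> i \<le> d" for i using w[of i] w\<delta>[of i] by (metis Suc_leI mult_1 mult_le_mono1 One_nat_def)
  have W: "open ?W" "bounded ?W" by (rule open_wball, rule bounded_wball[of w, OF w])
  have "0 \<in> ?W" using r by (simp add: wnorm_def vec_eq_iff flip: zero_vec_def)
  have Hd: "sys_eval ?Fw (sys_eval (power_map w) x) = sys_eval ?Hd x" for x
    unfolding H_def by (rule wpart_power_map)
  have HF: "sys_eval F (sys_eval (power_map w) x) = sys_eval ?Hd x + (sys_eval ?Hl x + sys_eval ?Hg x)" for x
    unfolding H_def sys_eval_comp[symmetric] add.assoc[symmetric] by (rule sys_part_split)
  have fr: "\<exists>x. y = sys_eval (power_map w) x \<and> norm x = r" if "y \<in> frontier ?W" for y
  proof -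
    have "wnorm w y = r" using frontier_wball that by blast
    moreover obtain x where "sys_eval (power_map w) x = y" using power_map_surj[of w y, OF w] by blast
    ultimately show ?thesis using wnorm_power_map[of w x, OF w] by auto
  qed
  let ?\<Lambda> = "{l. \<exists>x. x \<noteq> 0 \<and> (\<forall>i. meval (?Hd $ i) x = l * (x $ i) ^ d)}"
  have "finite ?\<Lambda>"
    by (rule finite_homogeneous_ratios[OF d]) (simp add: sys_part_def in_keys_iff lookup_deg_part split: if_splits)
  from avoiding_ray[OF this] obtain c where c: "c \<noteq> 0" "\<And>\<tau>. \<tau> > 0 \<Longrightarrow> - (complex_of_real \<tau> * c) \<notin> ?\<Lambda>" by blast
  \<comment> \<open>Along the segment the part of degree \<open>d\<close> stays fixed while the
    others are scaled by \<open>1 - t\<close>, so \<open>dom\<close> persists.\<close>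
  have n1: "(1 - t) *\<^sub>R sys_eval F y + t *\<^sub>R sys_eval ?Fw y \<noteq> 0" if t: "t \<in> {0..1}" and y: "y \<in> frontier ?W" for t y
  proof
    assume z: "(1 - t) *\<^sub>R sys_eval F y + t *\<^sub>R sys_eval ?Fw y = 0"
    obtain x where x: "y = sys_eval (power_map w) x" "norm x = r" using fr[OF y] by blast
    have "sys_eval ?Hd x + (1 - t) *\<^sub>R (sys_eval ?Hl x + sys_eval ?Hg x) = 0"
      using z unfolding x(1) HF Hd by (simp add: algebra_simps)
    then have "sys_eval ?Hd x = - ((1 - t) *\<^sub>R (sys_eval ?Hl x + sys_eval ?Hg x))" by (simp add: eq_neg_iff_add_eq_0)
    then have "norm (sys_eval ?Hd x) = \<bar>1 - t\<bar> * norm (sys_eval ?Hl x + sys_eval ?Hg x)" by (metis norm_minus_cancel norm_scaleR)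
    also have "\<dots> \<le> 1 * (norm (sys_eval ?Hl x) + norm (sys_eval ?Hg x))"
      using t by (intro mult_mono norm_triangle_ineq) auto
    finally show False using dom[OF x(2)] by simp
  qed
  \<comment> \<open>A zero with \<open>0 < t < 1\<close> gives the ratio \<open>- \<tau> c\<close>
    with \<open>\<tau> = t / (1 - t)\<close>, which \<open>c\<close> was chosen to avoid;
    \<open>t = 0\<close> contradicts \<open>nz\<close>, and \<open>t = 1\<close> contradicts
    \<open>c \<noteq> 0\<close>.\<close>
  have n2: "(1 - t) *\<^sub>R sys_eval ?Fw y + t *\<^sub>R sys_eval (powers c \<delta>) y \<noteq> 0" if t: "t \<in> {0..1}" and y: "y \<in> frontier ?W" for t y
  proof
    assume z: "(1 - t) *\<^sub>R sys_eval ?Fw y + t *\<^sub>R sys_eval (powers c \<delta>) y = 0"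
    obtain x where x: "y = sys_eval (power_map w) x" "norm x = r" using fr[OF y] by blast
    have x0: "x \<noteq> 0" using x(2) r by auto
    have zi: "complex_of_real (1 - t) * meval (?Hd $ i) x + complex_of_real t * (c * (x $ i) ^ d) = 0" for i
    proof -
      have "((1 - t) *\<^sub>R sys_eval ?Fw y) $ i + (t *\<^sub>R sys_eval (powers c \<delta>) y) $ i = 0"
        using z by (metis vector_add_component zero_index)
      moreover have "sys_eval ?Fw y $ i = meval (?Hd $ i) x" unfolding x(1) Hd by simp
      moreover have "sys_eval (powers c \<delta>) y $ i = c * (x $ i) ^ d"
        using w\<delta>[of i] by (simp add: x(1) powers_def flip: power_mult)
      ultimately show ?thesis unfolding vector_scaleR_component by (simp only: scaleR_conv_of_real)
    qed
    show False
    proof (cases "t = 1")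
      case True
      then have "x $ i = 0" for i using zi[of i] c(1) d by simp
      then show False using x0 by (simp add: vec_eq_iff)
    next
      case False
      then have t1: "1 - t > 0" using t by simp
      define \<tau> where "\<tau> = t / (1 - t)"
      have H\<tau>: "meval (?Hd $ i) x = - (complex_of_real \<tau> * c) * (x $ i) ^ d" for i
      proof -
        have t2: "complex_of_real (1 - t) \<noteq> 0" using t1 by (simp only: of_real_eq_0_iff)
        have "complex_of_real (1 - t) * meval (?Hd $ i) x = - (complex_of_real t * (c * (x $ i) ^ d))"
          using zi[of i] by (simp only: eq_neg_iff_add_eq_0)
        then have "meval (?Hd $ i) x = - (complex_of_real t * (c * (x $ i) ^ d)) / complex_of_real (1 - t)"
          using t2 by (metis nonzero_mult_div_cancel_left)
        then show ?thesis by (simp only: \<tau>_def of_real_divide) (simp add: ac_simps)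
      qed
      show False
      proof (cases "t = 0")
        case True
        then have "sys_eval ?Hd x = 0" using H\<tau> by (simp add: vec_eq_iff \<tau>_def)
        then show False using nz[OF x0] by simp
      next
        case False
        then have "\<tau> > 0" using t t1 by (simp add: \<tau>_def)
        moreover have "- (complex_of_real \<tau> * c) \<in> ?\<Lambda>" using x0 H\<tau> by blast
        ultimately show False using c(2) by blast
      qed
    qed
  qed
  obtain N1 where N1: "lowdeg N1 F" using lowdeg_exists by blast
  \<comment> \<open>Above \<open>d\<close>, so that the pure powers, of degree at most
    \<open>d\<close>, also count as low-degree terms.\<close>
  define N0 where "N0 = max N1 (Suc d)"
  have N0: "0 < N0" "lowdeg N0 F" using N1 by (auto simp: N0_def intro: lowdeg_mono)
  show ?thesis
    unfolding Z_def
  proof (rule zeros_in_open_set[OF N0 W])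
    fix x assume "x \<in> frontier ?W"
    then show "sys_eval F x \<noteq> 0" using n1[of 0 x] by simp
  next
    fix N and P :: "'n system" assume N: "N0 \<le> N" and P: "lowdeg N P"
    have lows: "0 < N" "lowdeg N F" "lowdeg N ?Fw" "lowdeg N (powers c \<delta>)" "lowdeg N (0 :: 'n system)" "\<And>i. \<delta> i < N"
    proof -
      show "0 < N" using N N0(1) by simp
      show "lowdeg N F" using lowdeg_mono[OF N0(2) N] .
      then show "lowdeg N ?Fw" by (rule lowdeg_wpart)
      have dN: "d < N" using N by (simp add: N0_def)
      then show "\<delta> i < N" for i using \<delta>d[of i] by simp
      then show "lowdeg N (powers c \<delta>)" by (rule lowdeg_powers)
      show "lowdeg N (0 :: 'n system)" by (simp add: lowdeg_def)
    qed
    obtain b1 where b1: "\<And>\<beta> ys zs. b1 \<le> \<beta> \<Longrightarrow> zero_list (monic N (P + cscale (complex_of_real \<beta>) F)) ys \<Longrightarrow>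
       zero_list (monic N (P + cscale (complex_of_real \<beta>) ?Fw)) zs \<Longrightarrow>
       length (filter (\<lambda>y. y \<in> ?W) ys) = length (filter (\<lambda>y. y \<in> ?W) zs)"
      using perturbed_count[OF lows(1,2,3) P P W n1] by blast
    \<comment> \<open>The second homotopy also moves \<open>P\<close> to 0, where the zeros of the
      pure powers can be counted directly.\<close>
    obtain b2 where b2: "\<And>\<beta> ys zs. b2 \<le> \<beta> \<Longrightarrow> zero_list (monic N (P + cscale (complex_of_real \<beta>) ?Fw)) ys \<Longrightarrow>
       zero_list (monic N (0 + cscale (complex_of_real \<beta>) (powers c \<delta>))) zs \<Longrightarrow>
       length (filter (\<lambda>y. y \<in> ?W) ys) = length (filter (\<lambda>y. y \<in> ?W) zs)"
      using perturbed_count[OF lows(1,3,4) P lows(5) W n2] by blast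
    obtain b3 where b3: "\<And>\<beta> ys. b3 \<le> \<beta> \<Longrightarrow> zero_list (monic N (0 + cscale (complex_of_real \<beta>) (powers c \<delta>))) ys \<Longrightarrow>
       length (filter (\<lambda>y. y \<in> ?W) ys) = (\<Prod>i\<in>UNIV. \<delta> i)"
      using powers_count[of c \<delta>, OF c(1) \<delta> lows(6) W(2) \<open>0 \<in> ?W\<close>] by blast
    show "\<exists>\<beta>0. \<forall>\<beta>\<ge>\<beta>0. \<forall>ys. zero_list (monic N (P + cscale (complex_of_real \<beta>) F)) ys \<longrightarrow>
        length (filter (\<lambda>y. y \<in> ?W) ys) = (\<Prod>i\<in>UNIV. \<delta> i)"
    proof (intro exI[of _ "max b1 (max b2 b3)"] allI impI)
      fix \<beta> ys assume \<beta>: "max b1 (max b2 b3) \<le> \<beta>" and ys: "zero_list (monic N (P + cscale (complex_of_real \<beta>) F)) ys"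
      obtain zs where zs: "zero_list (monic N (P + cscale (complex_of_real \<beta>) ?Fw)) zs"
        using monic_zero_list[OF lowdeg_add[OF P lowdeg_cscale[OF lows(3)]]] by blast
      obtain us where us: "zero_list (monic N (0 + cscale (complex_of_real \<beta>) (powers c \<delta>))) us"
        using monic_zero_list[OF lowdeg_add[OF lows(5) lowdeg_cscale[OF lows(4)]]] by blast
      show "length (filter (\<lambda>y. y \<in> ?W) ys) = (\<Prod>i\<in>UNIV. \<delta> i)"
        using b1[OF _ ys zs] b2[OF _ zs us] b3[OF _ us] \<beta> by simp
    qed
  qed
qed

section \<open>Invariance under pre-inflation\<close>

lemma sys_ideal_matrix_subset: "sys_ideal (M *v X) \<subseteq> sys_ideal X"
  for M :: "('n::finite) poly_matrix"
  using sys_idealI[of "\<lambda>j. M $ _ $ j" X]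
  by (intro sys_ideal_subset is_ideal_sys_ideal) (simp add: matrix_vector_mult_def)

lemma sys_ideal_matrix:
  fixes M V :: "('n::finite) poly_matrix"
  assumes "V ** M = mat 1"
  shows "sys_ideal (M *v X) = sys_ideal X"
proof
  have "X = V *v (M *v X)" by (simp add: matrix_vector_mul_assoc assms)
  then show "sys_ideal X \<subseteq> sys_ideal (M *v X)" using sys_ideal_matrix_subset by metis
qed (rule sys_ideal_matrix_subset)

lemma sys_zero_iff: "sys_eval F x = 0 \<longleftrightarrow> (\<forall>p\<in>sys_ideal F. meval p x = 0)"
  using meval_sys_ideal[of _ F x] sys_ideal_gen by (fastforce simp: vec_eq_iff)

lemma msubst_sum: "msubst (\<Sum>a\<in>A. f a) T = (\<Sum>a\<in>A. msubst (f a) T)"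
  and msubst_mult: "msubst (p * q) T = msubst p T * msubst q T"
  and msubst_diff: "msubst (p - q) T = msubst p T - msubst q T"
  and msubst_power: "msubst (p ^ k) T = msubst p T ^ k"
  and msubst_mconst: "msubst (mconst c) T = mconst c"
  by (rule mpoly_eqI; simp add: meval_msubst)+

text \<open>\<open>T\<close> is a polynomial automorphism with inverse \<open>T'\<close>, so
  denominators and relations can be carried both ways.\<close>

lemma loc_comp_iff:
  fixes F T T' :: "('n::finite) system"
  assumes inv: "\<And>x. sys_eval T' (sys_eval T x) = x" "\<And>x. sys_eval T (sys_eval T' x) = x"
  shows "msubst p T \<in> loc (sys_ideal (sys_comp F T)) y \<longleftrightarrow> p \<in> loc (sys_ideal F) (sys_eval T y)"
proof
  assume "p \<in> loc (sys_ideal F) (sys_eval T y)"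
  then obtain u a where u: "meval u (sys_eval T y) \<noteq> 0" "u * p = (\<Sum>j\<in>UNIV. a j * F $ j)"
    using loc_sys_idealD by blast
  have "msubst u T * msubst p T = (\<Sum>j\<in>UNIV. msubst (a j) T * sys_comp F T $ j)"
    using arg_cong[OF u(2), of "\<lambda>p. msubst p T"] by (simp add: msubst_mult msubst_sum sys_comp_def)
  then have "msubst u T * msubst p T \<in> sys_ideal (sys_comp F T)" by (simp only: sys_idealI)
  then show "msubst p T \<in> loc (sys_ideal (sys_comp F T)) y"
    using u(1) unfolding loc_def by (auto simp: meval_msubst intro!: exI[of _ "msubst u T"])
next
  have inv': "msubst (msubst p T) T' = p" for p by (rule mpoly_eqI) (simp add: meval_msubst inv)
  assume "msubst p T \<in> loc (sys_ideal (sys_comp F T)) y"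
  then obtain u a where u: "meval u y \<noteq> 0" "u * msubst p T = (\<Sum>j\<in>UNIV. a j * sys_comp F T $ j)"
    using loc_sys_idealD by blast
  have "msubst u T' * p = (\<Sum>j\<in>UNIV. msubst (a j) T' * F $ j)"
    using arg_cong[OF u(2), of "\<lambda>p. msubst p T'"] by (simp add: msubst_mult msubst_sum sys_comp_def inv')
  then have "msubst u T' * p \<in> sys_ideal F" by (simp only: sys_idealI)
  then show "p \<in> loc (sys_ideal F) (sys_eval T y)"
    using u(1) unfolding loc_def by (auto simp: meval_msubst inv intro!: exI[of _ "msubst u T'"])
qed

lemma codim_comp:
  fixes F T T' :: "('n::finite) system"
  assumes inv: "\<And>x. sys_eval T' (sys_eval T x) = x" "\<And>x. sys_eval T (sys_eval T' x) = x"
    and m: "codim (loc (sys_ideal (sys_comp F T)) y) m"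
  shows "codim (loc (sys_ideal F) (sys_eval T y)) m"
proof -
  let ?I = "loc (sys_ideal F) (sys_eval T y)" and ?J = "loc (sys_ideal (sys_comp F T)) y"
  have inv1: "msubst (msubst p T) T' = p" and inv2: "msubst (msubst p T') T = p" for p
    by (rule mpoly_eqI; simp add: meval_msubst inv)+
  note iff = loc_comp_iff[OF inv, of _ F y]
  obtain B where B: "finite B" "card B = m" "\<forall>p. \<exists>c. p - (\<Sum>b\<in>B. mconst (c b) * b) \<in> ?J"
    "\<forall>c. (\<Sum>b\<in>B. mconst (c b) * b) \<in> ?J \<longrightarrow> (\<forall>b\<in>B. c b = 0)"
    by (rule codimE[OF m])
  have inj: "inj_on (\<lambda>b. msubst b T') B" by (rule inj_on_inverseI[where g = "\<lambda>b. msubst b T"]) (rule inv2)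
  have sum: "(\<Sum>b\<in>(\<lambda>b. msubst b T') ` B. mconst (c b) * b) = (\<Sum>b\<in>B. mconst (c (msubst b T')) * msubst b T')" for c
    by (simp add: sum.reindex[OF inj])
  have sumT: "msubst (\<Sum>b\<in>B. mconst (c b) * msubst b T') T = (\<Sum>b\<in>B. mconst (c b) * b)" for c
    by (simp add: msubst_sum msubst_mult msubst_mconst inv2)
  show ?thesis
    unfolding codim_def
  proof (intro exI[of _ "(\<lambda>b. msubst b T') ` B"] conjI allI impI)
    show "finite ((\<lambda>b. msubst b T') ` B)" using B(1) by simp
    show "card ((\<lambda>b. msubst b T') ` B) = m" using card_image[OF inj] B(2) by simp
  next
    fix p
    obtain c where "msubst p T - (\<Sum>b\<in>B. mconst (c b) * b) \<in> ?J" using B(3) by blast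
    then have "msubst (p - (\<Sum>b\<in>B. mconst (c b) * msubst b T')) T \<in> ?J" by (simp only: msubst_diff sumT)
    then have "p - (\<Sum>b\<in>B. mconst (c b) * msubst b T') \<in> ?I" by (simp only: iff)
    then have "p - (\<Sum>b\<in>(\<lambda>b. msubst b T') ` B. mconst ((c \<circ> (\<lambda>b. msubst b T)) b) * b) \<in> ?I"
      unfolding sum by (simp add: inv2)
    then show "\<exists>c. p - (\<Sum>b\<in>(\<lambda>b. msubst b T') ` B. mconst (c b) * b) \<in> ?I" by blast
  next
    fix c assume "(\<Sum>b\<in>(\<lambda>b. msubst b T') ` B. mconst (c b) * b) \<in> ?I"
    then have "msubst (\<Sum>b\<in>B. mconst (c (msubst b T')) * msubst b T') T \<in> ?J" by (simp only: sum iff)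
    then have "\<forall>b\<in>B. c (msubst b T') = 0" using B(4)[rule_format, of "\<lambda>b. c (msubst b T')"] by (simp only: sumT) blast
    then show "\<forall>b\<in>(\<lambda>b. msubst b T') ` B. c b = 0" by blast
  qed
qed

text \<open>Pulled back along \<open>T\<close>, the coordinate difference is a general polynomial
  that vanishes at \<open>y\<close>; it is still nilpotent, but the exponent may change.\<close>

lemma nilpotent_comp:
  fixes F T T' :: "('n::finite) system"
  assumes inv: "\<And>x. sys_eval T' (sys_eval T x) = x" "\<And>x. sys_eval T (sys_eval T' x) = x"
    and nil: "\<And>i. (mvar i - mconst (y $ i)) ^ L \<in> loc (sys_ideal (sys_comp F T)) y"
  shows "\<exists>n. (mvar i - mconst (sys_eval T y $ i)) ^ n \<in> loc (sys_ideal F) (sys_eval T y)"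
proof -
  have "meval (msubst (mvar i - mconst (sys_eval T y $ i)) T) y = 0" by (simp add: meval_msubst)
  from vanish_nilpotent[OF is_ideal_loc[OF is_ideal_sys_ideal] nil this]
  show ?thesis by (simp only: msubst_power[symmetric] loc_comp_iff[OF inv])
qed

section \<open>Multiplicity\<close>

abbreviation emb :: "('n::{finite,linorder}) mpoly \<Rightarrow> 'n mpoly fract" where
  "emb p \<equiv> Fract p 1"

lemma emb_add: "emb (p + q) = emb p + emb q"
  by simp

lemma emb_sum: "emb (\<Sum>a\<in>A. f a) = (\<Sum>a\<in>A. emb (f a))"
  by (induction A rule: infinite_finite_induct) (simp_all add: Zero_fract_def emb_add del: add_fract)

lemma Fract_in_local_ring: "meval q z \<noteq> 0 \<Longrightarrow> Fract p q \<in> local_ring z"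
  unfolding local_ring_def by blast

lemma Fract_in_local_ideal:
  fixes F :: "('n::{finite,linorder}) system"
  assumes q: "meval q z \<noteq> 0" and p: "p \<in> loc (sys_ideal F) z"
  shows "Fract p q \<in> local_ideal F z"
proof -
  obtain u a where u: "meval u z \<noteq> 0" "u * p = (\<Sum>j\<in>UNIV. a j * F $ j)"
    using loc_sys_idealD[OF p] by blast
  have nz: "u \<noteq> 0" "q \<noteq> 0" using u(1) q by auto
  have "Fract p q = Fract 1 (u * q) * emb (u * p)"
    using nz by (simp add: eq_fract)
  also have "\<dots> = (\<Sum>j\<in>UNIV. Fract (a j) (u * q) * emb (F $ j))"
    unfolding u(2) emb_sum by (simp add: sum_distrib_left)
  finally have "Fract p q = (\<Sum>j\<in>UNIV. Fract (a j) (u * q) * emb (F $ j))" .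
  moreover have "\<forall>j. Fract (a j) (u * q) \<in> local_ring z"
    using u(1) q by (intro allI Fract_in_local_ring) simp
  ultimately show ?thesis
    unfolding local_ideal_def by (intro CollectI exI[of _ "\<lambda>j. Fract (a j) (u * q)"] conjI)
qed

text \<open>Clearing denominators: their product does not vanish at \<open>z\<close>, so a relation
  over the local ring becomes one over the polynomials.\<close>

lemma local_idealD:
  fixes F :: "('n::{finite,linorder}) system"
  assumes "emb g \<in> local_ideal F z"
  shows "g \<in> loc (sys_ideal F) z"
proof -
  obtain a where a: "emb g = (\<Sum>i\<in>UNIV. a i * emb (F $ i))" "\<And>i. a i \<in> local_ring z"
    using assms by (auto simp: local_ideal_def)
  have "\<forall>i. \<exists>p q. a i = Fract p q \<and> meval q z \<noteq> 0" using a(2) by (auto simp: local_ring_def)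
  then obtain p q where pq: "\<And>i. a i = Fract (p i) (q i)" "\<And>i. meval (q i) z \<noteq> 0" by metis
  have q0: "q i \<noteq> 0" for i using pq(2)[of i] by auto
  define u where "u = (\<Prod>i\<in>UNIV. q i)"
  have ui: "u = q i * (\<Prod>j\<in>UNIV - {i}. q j)" for i unfolding u_def by (rule prod.remove) auto
  have "emb (u * g) = emb u * (\<Sum>i\<in>UNIV. a i * emb (F $ i))" unfolding a(1)[symmetric] by simp
  also have "\<dots> = (\<Sum>i\<in>UNIV. emb (((\<Prod>j\<in>UNIV - {i}. q j) * p i) * F $ i))"
    unfolding sum_distrib_left
  proof (rule sum.cong[OF refl])
    fix i
    show "emb u * (a i * emb (F $ i)) = emb (((\<Prod>j\<in>UNIV - {i}. q j) * p i) * F $ i)"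
      unfolding pq(1) using q0[of i] by (simp add: eq_fract ui[of i] ac_simps)
  qed
  also have "\<dots> = emb (\<Sum>i\<in>UNIV. ((\<Prod>j\<in>UNIV - {i}. q j) * p i) * F $ i)" by (rule emb_sum[symmetric])
  finally have "u * g = (\<Sum>i\<in>UNIV. ((\<Prod>j\<in>UNIV - {i}. q j) * p i) * F $ i)" by (simp add: eq_fract)
  then have "u * g \<in> sys_ideal F" by (simp only: sys_idealI)
  moreover have "meval u z \<noteq> 0" using pq(2) by (simp add: u_def)
  ultimately show ?thesis by (auto simp: loc_def)
qed

text \<open>By \<open>nil\<close> every denominator \<open>q\<close> has an inverse \<open>v\<close>
  modulo the contracted ideal, so \<open>p / q\<close> may be represented by the polynomial
  \<open>p * v\<close>, and a polynomial basis also serves for the local ring.\<close>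

lemma has_multiplicity_codim:
  fixes F :: "('n::{finite,linorder}) system"
  assumes m: "codim (loc (sys_ideal F) z) m"
    and nil: "\<And>i. \<exists>n. (mvar i - mconst (z $ i)) ^ n \<in> loc (sys_ideal F) z"
  shows "has_multiplicity F z m"
proof -
  let ?I = "loc (sys_ideal F) z"
  have I: "is_ideal ?I" by (rule is_ideal_loc[OF is_ideal_sys_ideal])
  obtain L where L: "\<And>i. (mvar i - mconst (z $ i)) ^ L i \<in> ?I" using nil by metis
  obtain B where B: "finite B" "card B = m" "\<forall>p. \<exists>c. p - (\<Sum>b\<in>B. mconst (c b) * b) \<in> ?I"
    "\<forall>c. (\<Sum>b\<in>B. mconst (c b) * b) \<in> ?I \<longrightarrow> (\<forall>b\<in>B. c b = 0)"
    by (rule codimE[OF m])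
  have inj: "inj_on emb B" by (rule inj_onI) (simp add: eq_fract)
  have sum: "(\<Sum>b\<in>emb ` B. emb (mconst (c b)) * b) = emb (\<Sum>b\<in>B. mconst (c (emb b)) * b)" for c
    by (simp add: sum.reindex[OF inj] emb_sum)
  show ?thesis
    unfolding has_multiplicity_def
  proof (intro exI[of _ "emb ` B"] conjI ballI allI impI)
    show "emb ` B \<subseteq> local_ring z" by (auto intro: Fract_in_local_ring)
    show "finite (emb ` B)" using B(1) by simp
    show "card (emb ` B) = m" using card_image[OF inj] B(2) by simp
  next
    fix f assume "f \<in> local_ring z"
    then obtain p q where f: "f = Fract p q" "meval q z \<noteq> 0" by (auto simp: local_ring_def)
    have q0: "q \<noteq> 0" using f(2) by auto
    obtain v where v: "1 - v * q \<in> ?I" using unit_mod_nilpotent[OF I L f(2)] by blast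
    obtain c where c: "p * v - (\<Sum>b\<in>B. mconst (c b) * b) \<in> ?I" using B(3) by blast
    define s where "s = (\<Sum>b\<in>B. mconst (c b) * b)"
    have "p * (1 - v * q) + q * (p * v - s) \<in> ?I"
      unfolding s_def by (rule is_idealD(2)[OF I is_idealD(3)[OF I v] is_idealD(3)[OF I c]])
    also have "p * (1 - v * q) + q * (p * v - s) = p - s * q" by (simp add: algebra_simps)
    finally have "Fract (p - s * q) q \<in> local_ideal F z" by (rule Fract_in_local_ideal[OF f(2)])
    also have "Fract (p - s * q) q = f - emb s" using q0 by (simp add: f(1) algebra_simps)
    also have "emb s = (\<Sum>b\<in>emb ` B. emb (mconst ((c \<circ> inv_into B emb) b)) * b)"
      unfolding sum s_def by (intro arg_cong[where f = emb] sum.cong) (auto simp: inv_into_f_f[OF inj])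
    finally show "\<exists>c. f - (\<Sum>b\<in>emb ` B. emb (mconst (c b)) * b) \<in> local_ideal F z" by blast
  next
    fix c b assume l: "(\<Sum>b\<in>emb ` B. emb (mconst (c b)) * b) \<in> local_ideal F z" and b: "b \<in> emb ` B"
    have "(\<Sum>b\<in>B. mconst (c (emb b)) * b) \<in> ?I" by (rule local_idealD[OF l[unfolded sum]])
    then have "\<forall>b\<in>B. c (emb b) = 0" using B(4)[rule_format, of "\<lambda>b. c (emb b)"] by blast
    then show "c b = 0" using b by blast
  qed
qed

section \<open>Cluster inflation\<close>

text \<open>The rank \<open>f\<close> is a bijection from the variables to the numbers below their
  count.\<close>

lemma card_first_vars:
  assumes "k \<le> CARD('n)"
  shows "card (first_vars k :: ('n::{finite,linorder}) set) = k"
proof -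
  define f where "f i = card {j::'n. j < i}" for i
  have less: "f i < f j" if "i < j" for i j
    unfolding f_def using that by (intro psubset_card_mono) auto
  have inj: "inj f"
    by (rule injI) (metis less less_irrefl linorder_neqE)
  have "f i < CARD('n)" for i unfolding f_def by (intro psubset_card_mono) auto
  then have "range f = {..<CARD('n)}"
    by (intro card_subset_eq) (auto simp: card_image[OF inj])
  moreover have "first_vars k = f -` {..<k}" by (auto simp: first_vars_def f_def)
  ultimately have "f ` first_vars k = {..<k}" using assms by (auto simp: image_vimage_eq)
  then have "card (f ` first_vars k) = k" by simp
  then show ?thesis using card_image[OF inj_on_subset[OF inj subset_UNIV]] by metis
qed

lemma invertible_affine_inverse:
  assumes "invertible_affine A"
  shows "\<exists>A'. (\<forall>x. sys_eval A' (sys_eval A x) = x) \<and> (\<forall>x. sys_eval A (sys_eval A' x) = x)"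
proof -
  obtain L b where L: "invertible L" and A: "A = (\<chi> i. mconst (b $ i) + (\<Sum>j\<in>UNIV. mconst (L $ i $ j) * mvar j))"
    using assms by (auto simp: invertible_affine_def)
  obtain L' where L': "L ** L' = mat 1" "L' ** L = mat 1" using L by (auto simp: invertible_def)
  define A' where "A' = (\<chi> i. \<Sum>j\<in>UNIV. mconst (L' $ i $ j) * (mvar j - mconst (b $ j)))"
  have e: "sys_eval A x = b + L *v x" for x by (simp add: A vec_eq_iff matrix_vector_mult_def)
  have e': "sys_eval A' x = L' *v (x - b)" for x by (simp add: A'_def vec_eq_iff matrix_vector_mult_def)
  show ?thesis
    by (intro exI[of _ A'] conjI allI) (simp_all add: e e' matrix_vector_mul_assoc L')
qed

lemma left_inverse_subst:
  fixes C C' :: "('n::finite) poly_matrix"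
  assumes "C' ** C = mat 1"
  shows "matrix_subst C' D ** matrix_subst C D = mat 1"
proof -
  have "(matrix_subst C' D ** matrix_subst C D) $ i $ j = mat 1 $ i $ j" for i j
  proof -
    have "(\<Sum>k\<in>UNIV. C' $ i $ k * C $ k $ j) = (if i = j then 1 else 0)"
      using assms by (simp add: vec_eq_iff matrix_matrix_mult_def mat_def)
    then have "msubst (\<Sum>k\<in>UNIV. C' $ i $ k * C $ k $ j) D = msubst (if i = j then 1 else 0) D" by simp
    moreover have "msubst (if i = j then 1 else 0) D = (if i = j then 1 else 0)"
      using msubst_mconst[of 1 D] msubst_mconst[of 0 D] by simp
    ultimately show ?thesis by (simp add: matrix_matrix_mult_def matrix_subst_def mat_def msubst_sum msubst_mult)
  qed
  then show ?thesis by (simp add: vec_eq_iff)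
qed

lemma left_inverse_const:
  assumes "B' ** B = mat 1"
  shows "const_matrix B' ** const_matrix B = mat 1"
proof -
  have "(const_matrix B' ** const_matrix B) $ i $ j = mat 1 $ i $ j" for i j
  proof -
    have "(\<Sum>k\<in>UNIV. B' $ i $ k * B $ k $ j) = (if i = j then 1 else 0)"
      using assms by (simp add: vec_eq_iff matrix_matrix_mult_def mat_def)
    then have "mconst (\<Sum>k\<in>UNIV. B' $ i $ k * B $ k $ j) = mconst (if i = j then 1 else 0)" by simp
    then show ?thesis by (simp add: matrix_matrix_mult_def const_matrix_def mat_def mconst_sum mconst_mult split: if_splits)
  qed
  then show ?thesis by (simp add: vec_eq_iff)
qed

text \<open>The shift \<open>D\<close> is undone by subtracting the same \<open>q i\<close>, because
  these depend only on the first variables, which \<open>D\<close> fixes.\<close>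

lemma preinflation_inverse:
  fixes G T :: "('n::{finite,linorder}) system"
  assumes "preinflation k l G z U T"
  shows "\<exists>T' V. (\<forall>x. sys_eval T' (sys_eval T x) = x) \<and> (\<forall>x. sys_eval T (sys_eval T' x) = x) \<and>
    sys_eval T 0 = z \<and> V ** U = mat 1"
proof -
  define fv where "fv = (first_vars (breadth G z) :: 'n set)"
  obtain A B C D q where A: "invertible_affine A" "sys_eval A 0 = z" and B: "invertible B" and C: "invertible C"
    and D: "D = (\<chi> i. if i \<in> fv then mvar i else mvar i + q i)"
    and q: "\<forall>i. i \<notin> fv \<longrightarrow> (\<forall>m\<in>keys (q i). 2 \<le> mdeg m \<and> (\<forall>j. j \<notin> fv \<longrightarrow> lookup m j = 0))"
    and T: "T = sys_comp A D" and U: "U = matrix_subst C D ** const_matrix B"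
    using assms unfolding preinflation_def Let_def fv_def[symmetric] by (elim exE conjE) (rule that)
  obtain A' where A': "\<And>x. sys_eval A' (sys_eval A x) = x" "\<And>x. sys_eval A (sys_eval A' x) = x"
    using invertible_affine_inverse[OF A(1)] by blast
  define D' where "D' = (\<chi> i. if i \<in> fv then mvar i else mvar i - q i)"
  have qcong: "meval (q i) x = meval (q i) y" if "i \<notin> fv" "\<And>j. j \<in> fv \<Longrightarrow> x $ j = y $ j" for i x y
    unfolding meval_def
  proof (intro sum.cong refl arg_cong[where f = "\<lambda>t. _ * t"] prod.cong)
    fix m j assume "m \<in> keys (q i)"
    then show "x $ j ^ lookup m j = y $ j ^ lookup m j"
      using q that by (cases "j \<in> fv") auto
  qed
  have Dn: "sys_eval D x $ i = (if i \<in> fv then x $ i else x $ i + meval (q i) x)" for x i by (simp add: D)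
  have D'n: "sys_eval D' x $ i = (if i \<in> fv then x $ i else x $ i - meval (q i) x)" for x i by (simp add: D'_def)
  have DD': "sys_eval D (sys_eval D' x) = x" for x
  proof -
    have "meval (q i) (sys_eval D' x) = meval (q i) x" if "i \<notin> fv" for i
      by (rule qcong[OF that]) (simp only: D'n if_True)
    then show ?thesis unfolding vec_eq_iff Dn D'n by simp
  qed
  have D'D: "sys_eval D' (sys_eval D x) = x" for x
  proof -
    have "meval (q i) (sys_eval D x) = meval (q i) x" if "i \<notin> fv" for i
      by (rule qcong[OF that]) (simp only: Dn if_True)
    then show ?thesis unfolding vec_eq_iff Dn D'n by simp
  qed
  \<comment> \<open>Without constant terms the \<open>q i\<close> vanish at 0, so \<open>D\<close>
    fixes 0 and \<open>T\<close> sends 0 to \<open>z\<close>.\<close>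
  have "meval (q i) 0 = 0" if "i \<notin> fv" for i
    unfolding meval_def
  proof (rule sum.neutral, rule ballI)
    fix m assume "m \<in> keys (q i)"
    then have "2 \<le> mdeg m" using q that by blast
    then obtain j where "lookup m j \<noteq> 0" unfolding mdeg_def by (metis not_numeral_le_zero sum.neutral)
    then have "(\<Prod>i\<in>UNIV. (0 :: 'n point) $ i ^ lookup m i) = 0" by (intro prod_zero) (auto intro!: bexI[of _ j])
    then show "lookup (q i) m * (\<Prod>i\<in>UNIV. (0 :: 'n point) $ i ^ lookup m i) = 0" by simp
  qed
  then have "sys_eval D 0 = 0" unfolding vec_eq_iff Dn by simp
  then have T0: "sys_eval T 0 = z" by (simp add: T sys_eval_comp A(2))
  obtain C' where C': "C' ** C = mat 1" using C by (auto simp: invertible_def)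
  obtain B' where B': "B' ** B = mat 1" using B by (auto simp: invertible_def)
  have "(const_matrix B' ** matrix_subst C' D) ** U =
      const_matrix B' ** ((matrix_subst C' D ** matrix_subst C D) ** const_matrix B)"
    unfolding U by (simp only: matrix_mul_assoc)
  also have "\<dots> = mat 1" by (simp add: left_inverse_subst[OF C'] left_inverse_const[OF B'])
  finally have "(const_matrix B' ** matrix_subst C' D) ** U = mat 1" .
  moreover have "sys_eval (sys_comp D' A') (sys_eval T x) = x" "sys_eval T (sys_eval (sys_comp D' A') x) = x" for x
    by (simp_all add: T sys_eval_comp A' DD' D'D)
  ultimately show ?thesis using T0 by blast
qed

lemma sys_part_homogeneous:
  "sys_eval (sys_part (\<lambda>e. e = d) H) (s *\<^sub>R x) = s ^ d *\<^sub>R sys_eval (sys_part (\<lambda>e. e = d) H) x"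
proof -
  have hom: "meval (deg_part (\<lambda>e. e = d) p) (s *\<^sub>R x) = complex_of_real (s ^ d) * meval (deg_part (\<lambda>e. e = d) p) x" for p
  proof -
    have "(\<Prod>i\<in>UNIV. (s *\<^sub>R x) $ i ^ lookup m i) = complex_of_real (s ^ d) * (\<Prod>i\<in>UNIV. x $ i ^ lookup m i)"
      if "m \<in> keys (deg_part (\<lambda>e. e = d) p)" for m
    proof -
      have "mdeg m = d" using that by (auto simp: in_keys_iff lookup_deg_part split: if_splits)
      have "(\<Prod>i\<in>UNIV. (s *\<^sub>R x) $ i ^ lookup m i) = (\<Prod>i\<in>UNIV. complex_of_real s ^ lookup m i * x $ i ^ lookup m i)"
        unfolding vector_scaleR_component by (simp only: scaleR_conv_of_real power_mult_distrib)
      also have "\<dots> = complex_of_real s ^ mdeg m * (\<Prod>i\<in>UNIV. x $ i ^ lookup m i)"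
        by (simp add: prod.distrib mdeg_def power_sum)
      finally show ?thesis using \<open>mdeg m = d\<close> by simp
    qed
    then show ?thesis unfolding meval_def sum_distrib_left by (intro sum.cong) (simp_all add: ac_simps)
  qed
  then show ?thesis
    unfolding vec_eq_iff vector_scaleR_component sys_eval_nth sys_part_def vec_lambda_beta hom
    by (simp add: scaleR_conv_of_real)
qed

theorem theorem3p1:
  fixes F :: "('n::{finite,linorder}) system"
    and z :: "'n point"
    and d \<kappa> :: nat
    and T H :: "'n system"
    and M M1 M2 :: real
    and Rm Rp :: "'n point set"
  assumes "0 < d"
    and run: "cluster_inflation F z d \<kappa> T H M M1 M2"
    and success: "eps_minus d M M2 < eps_plus M M1"
    and bound_gt: "\<And>x. norm x \<le> eps_plus M M1 \<Longrightarrow>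
          norm (sys_eval (sys_part (\<lambda>e. d < e) H) x) \<le> M1 * norm x ^ (d + 1)"
    and bound_lt: "\<And>x. norm x \<le> eps_plus M M1 \<Longrightarrow>
          norm (sys_eval (sys_part (\<lambda>e. e < d) H) x) \<le> M2"
    and Rm: "Rm = region T \<kappa> d (eps_minus d M M2)"
    and Rp: "Rp = region T \<kappa> d (eps_plus M M1)"
  shows "z \<in> Rm \<and> z \<in> Rp \<and> Rm \<subseteq> interior Rp \<and>
    (\<exists>cluster.
       cluster = {x \<in> Rm. sys_eval F x = 0} \<and>
       cluster = {x \<in> Rp. sys_eval F x = 0} \<and>
       finite cluster \<and>
       (\<exists>\<mu>. (\<forall>x\<in>cluster. has_multiplicity F x (\<mu> x)) \<and> (\<Sum>x\<in>cluster. \<mu> x) = d ^ \<kappa>))"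
proof -
  let ?em = "eps_minus d M M2" and ?ep = "eps_plus M M1"
  let ?Hd = "sys_part (\<lambda>e. e = d) H" and ?Hl = "sys_part (\<lambda>e. e < d) H" and ?Hg = "sys_part (\<lambda>e. d < e) H"
  obtain G U where \<kappa>: "\<kappa> = breadth G z" and pre: "preinflation d d G z U T"
    and H: "H = sys_comp (U *v sys_comp F T) (inflation \<kappa> d)"
    using run unfolding cluster_inflation_def by blast
  have M: "0 < M" "0 < M1" "0 < M2" and Md: "\<And>x. norm x = 1 \<Longrightarrow> M \<le> norm (sys_eval ?Hd x)"
    using run unfolding cluster_inflation_def by blast+
  obtain T' V where T': "\<And>x. sys_eval T' (sys_eval T x) = x" "\<And>x. sys_eval T (sys_eval T' x) = x"
    and T0: "sys_eval T 0 = z" and V: "V ** U = mat 1"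
    using preinflation_inverse[OF pre] by blast
  have "\<kappa> \<le> CARD('n)" unfolding \<kappa> breadth_def by (rule dim_subset_UNIV_cart_gen)
  note card\<kappa> = card_first_vars[OF this]

  \<comment> \<open>\<open>w\<close> holds the exponents of the inflation and
    \<open>\<delta>\<close> the complementary ones: substituting \<open>power_map w\<close> in
    \<open>x_i ^ \<delta> i\<close> gives \<open>x_i ^ d\<close>, and the product of the
    \<open>\<delta> i\<close> is the number of zeros.\<close>
  define w :: "'n \<Rightarrow> nat" where "w i = (if i \<in> first_vars \<kappa> then 1 else d)" for i
  define \<delta> :: "'n \<Rightarrow> nat" where "\<delta> i = (if i \<in> first_vars \<kappa> then d else 1)" for i
  have w: "0 < w i" and w\<delta>: "w i * \<delta> i = d" for i using \<open>0 < d\<close> by (auto simp: w_def \<delta>_def)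
  have \<delta>\<kappa>: "(\<Prod>i\<in>UNIV. \<delta> i) = d ^ \<kappa>"
    unfolding \<delta>_def by (simp add: prod.If_cases card\<kappa>)
  have infl: "inflation \<kappa> d = power_map w" by (simp add: inflation_def power_map_def w_def vec_eq_iff)
  define F' where "F' = U *v sys_comp F T"
  have H': "H = sys_comp F' (power_map w)" by (simp add: H F'_def infl)
  have idF': "sys_ideal F' = sys_ideal (sys_comp F T)" unfolding F'_def by (rule sys_ideal_matrix[OF V])
  have zF': "sys_eval F' y = 0 \<longleftrightarrow> sys_eval F (sys_eval T y) = 0" for y
    unfolding sys_zero_iff[of F'] idF' sys_zero_iff[symmetric] by (simp add: sys_eval_comp)

  have em: "0 < ?em" using M by (simp add: eps_minus_def)
  have emd: "M * ?em ^ d = 2 * M2"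
  proof -
    have "?em ^ d = 2 * M2 / M"
      unfolding eps_minus_def using M \<open>0 < d\<close> by (simp add: powr_powr flip: powr_realpow)
    then show ?thesis using M by simp
  qed
  have ep: "0 < ?ep" "M1 * ?ep = M / 2" using M by (simp_all add: eps_plus_def)
  have Hd: "M * norm x ^ d \<le> norm (sys_eval ?Hd x)" if "x \<noteq> 0" for x
  proof -
    have "x = norm x *\<^sub>R sgn x" using that by (simp add: sgn_div_norm)
    then have "sys_eval ?Hd x = norm x ^ d *\<^sub>R sys_eval ?Hd (sgn x)" by (metis sys_part_homogeneous)
    moreover have "M \<le> norm (sys_eval ?Hd (sgn x))" using that by (intro Md) (simp add: norm_sgn)
    ultimately show ?thesis by (simp add: mult.commute[of M] mult_left_mono)
  qed
  have nz: "sys_eval ?Hd x \<noteq> 0" if "x \<noteq> 0" for x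
  proof -
    have "0 < M * norm x ^ d" using that M(1) by simp
    then show ?thesis using Hd[OF that] by auto
  qed
  \<comment> \<open>The factor 2 in both radii allots each bound half of
    \<open>M * norm x ^ d\<close>: \<open>M2\<close> is strictly below it beyond \<open>?em\<close>,
    and the bound for the higher terms is at most equal to it up to \<open>?ep\<close>.\<close>
  have dom: "norm (sys_eval ?Hl x) + norm (sys_eval ?Hg x) < norm (sys_eval ?Hd x)"
    if x: "?em < norm x" "norm x \<le> ?ep" for x
  proof -
    have x0: "x \<noteq> 0" using x(1) em by auto
    have "?em ^ d < norm x ^ d" using x(1) em \<open>0 < d\<close> by (intro power_strict_mono) auto
    then have "M2 < M / 2 * norm x ^ d" using emd M(1) mult_strict_left_mono[of "?em ^ d" "norm x ^ d" M] by simp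
    moreover have "M1 * norm x ^ (d + 1) \<le> M / 2 * norm x ^ d"
    proof -
      have "M1 * norm x \<le> M / 2" using mult_left_mono[OF x(2), of M1] M(2) unfolding ep(2) by simp
      then have "(M1 * norm x) * norm x ^ d \<le> M / 2 * norm x ^ d" by (intro mult_right_mono) auto
      then show ?thesis by (simp add: mult.assoc)
    qed
    ultimately show ?thesis using bound_gt[OF x(2)] bound_lt[OF x(2)] Hd[OF x0] by simp
  qed
  have inner: "norm x \<le> ?em" if x: "norm x \<le> ?ep" "sys_eval H x = 0" for x
  proof (rule ccontr)
    assume "\<not> norm x \<le> ?em"
    then have "norm (sys_eval ?Hl x) + norm (sys_eval ?Hg x) < norm (sys_eval ?Hd x)" using dom x(1) by simp
    moreover have "sys_eval ?Hd x = - (sys_eval ?Hl x + sys_eval ?Hg x)"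
      using x(2) sys_part_split[of H x d] unfolding eq_neg_iff_add_eq_0 by (simp add: add.assoc)
    then have "norm (sys_eval ?Hd x) = norm (sys_eval ?Hl x + sys_eval ?Hg x)" by (simp only: norm_minus_cancel)
    ultimately show False using norm_triangle_ineq[of "sys_eval ?Hl x" "sys_eval ?Hg x"] by linarith
  qed

  have reg: "region T \<kappa> d s = sys_eval T ` {y. wnorm w y \<le> s}" for s
    unfolding region_def infl power_map_ball(2)[of w, OF w, symmetric] by (simp add: image_image sys_eval_comp)
  have w0: "wnorm w 0 = 0" by (simp add: wnorm_def flip: zero_vec_def)
  have zin: "z \<in> region T \<kappa> d s" if "0 \<le> s" for s
    unfolding reg using T0 w0 that by (intro image_eqI[of _ _ 0]) auto
  have opn: "open (sys_eval T ` {y. wnorm w y < ?ep})"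
  proof -
    have "sys_eval T ` {y. wnorm w y < ?ep} = sys_eval T' -` {y. wnorm w y < ?ep}"
      using T' by (auto simp: image_iff) metis
    then show ?thesis using open_vimage[OF open_wball continuous_on_sys_eval] by metis
  qed
  have sub: "Rm \<subseteq> interior Rp"
  proof -
    have "sys_eval T ` {y. wnorm w y < ?ep} \<subseteq> interior Rp"
      unfolding Rp reg by (rule interior_maximal[OF _ opn]) auto
    moreover have "Rm \<subseteq> sys_eval T ` {y. wnorm w y < ?ep}" unfolding Rm reg using success by auto
    ultimately show ?thesis by blast
  qed

  \<comment> \<open>The count applies to the open outer ball. All zeros in the closed outer ball
    have weighted norm at most \<open>?em < ?ep\<close>, so both closed regions contain the same
    zeros.\<close>
  define Z where "Z = {y \<in> {y. wnorm w y < ?ep}. sys_eval F' y = 0}"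
  have zeros: "wnorm w y \<le> ?em" if "wnorm w y \<le> ?ep" "sys_eval F' y = 0" for y
  proof -
    obtain x where x: "sys_eval (power_map w) x = y" using power_map_surj[of w y, OF w] by blast
    have "norm x = wnorm w y" using wnorm_power_map[of w x, OF w] x by simp
    moreover have "sys_eval H x = 0" using that(2) by (simp add: H' sys_eval_comp x)
    ultimately show ?thesis using inner[of x] that(1) by simp
  qed
  have clm: "{x \<in> Rm. sys_eval F x = 0} = sys_eval T ` Z"
    unfolding Rm reg Z_def using zeros success by (fastforce simp: zF' image_iff)
  have clp: "{x \<in> Rp. sys_eval F x = 0} = sys_eval T ` Z"
    unfolding Rp reg Z_def using zeros success by (fastforce simp: zF' image_iff)
  have "finite Z \<and> (\<exists>\<mu>. (\<forall>y\<in>Z. codim (loc (sys_ideal F') y) (\<mu> y) \<and>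
      (\<forall>i. (mvar i - mconst (y $ i)) ^ (\<Prod>i\<in>UNIV. \<delta> i) \<in> loc (sys_ideal F') y)) \<and> (\<Sum>y\<in>Z. \<mu> y) = (\<Prod>i\<in>UNIV. \<delta> i))"
    unfolding Z_def
    by (rule weighted_ball_zeros[OF \<open>0 < d\<close> w\<delta> ep(1)]) (use nz dom success in \<open>auto simp: H'[symmetric]\<close>)
  then obtain \<mu> where fin: "finite Z" and \<mu>: "\<And>y. y \<in> Z \<Longrightarrow> codim (loc (sys_ideal F') y) (\<mu> y)"
    "\<And>y i. y \<in> Z \<Longrightarrow> (mvar i - mconst (y $ i)) ^ (\<Prod>i\<in>UNIV. \<delta> i) \<in> loc (sys_ideal F') y"
    and sum: "(\<Sum>y\<in>Z. \<mu> y) = (\<Prod>i\<in>UNIV. \<delta> i)" by blast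
  have inj: "inj_on (sys_eval T) Z" by (rule inj_on_inverseI[where g = "sys_eval T'"]) (rule T'(1))
  have mult: "has_multiplicity F x (\<mu> (sys_eval T' x))" if x: "x \<in> sys_eval T ` Z" for x
  proof -
    obtain y where y: "y \<in> Z" "x = sys_eval T y" using x by blast
    have "has_multiplicity F (sys_eval T y) (\<mu> y)"
      by (rule has_multiplicity_codim[OF codim_comp[OF T' \<mu>(1)[OF y(1), unfolded idF']]
          nilpotent_comp[OF T' \<mu>(2)[OF y(1), unfolded idF']]])
    then show ?thesis by (simp add: y(2) T')
  qed
  have "(\<Sum>x\<in>sys_eval T ` Z. \<mu> (sys_eval T' x)) = d ^ \<kappa>"
    using sum by (simp add: sum.reindex[OF inj] T' \<delta>\<kappa>)
  then have "\<exists>\<mu>. (\<forall>x\<in>sys_eval T ` Z. has_multiplicity F x (\<mu> x)) \<and> (\<Sum>x\<in>sys_eval T ` Z. \<mu> x) = d ^ \<kappa>"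
    by (intro exI[of _ "\<lambda>x. \<mu> (sys_eval T' x)"] conjI ballI mult)
  moreover have "z \<in> Rm" "z \<in> Rp" unfolding Rm Rp using em ep(1) by (auto intro: zin)
  ultimately show ?thesis
    by (intro conjI sub exI[of _ "sys_eval T ` Z"] clm[symmetric] clp[symmetric] finite_imageI fin)
qed

end
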